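(* Let $H$ be a finite-dimensional Hopf algebra with the dual Chevalley property over a field $\Bbbk$, and let $H_0$ be its coradical. Then: (1) If $H$ is non-cosemisimple and $\operatorname{char}\Bbbk=0$, then $\exp_0(H)=\infty$. (2) If $\operatorname{char}\Bbbk=p>0$, and one denotes $N:=\exp_0(H_0)<\infty$ and $L:=\mathrm{Lw}(H)$, then $\exp_0(H)\mid Np^M$, where $M$ is a positive integer satisfying $p^M\ge L$.
   Context: Let $(H,m,u,\Delta,\varepsilon)$ be a Hopf algebra over a field $\Bbbk$. For $n\ge 1$ let $m_n:H^{\otimes n}\to H$, $h_1\otimes\cdots\otimes h_n\mapsto h_1\cdots h_n$, and $\Delta_n:H\to H^{\otimes n}$, $h\mapsto\sum h_{(1)}\otimes\cdots\otimes h_{(n)}$. Define $\exp_0(H):=\min\{n\ge 1\mid m_n\circ\Delta_n=u\circ\varepsilon\}$, with the convention $\min\varnothing=\infty$. The coradical $H_0$ is the sum of all simple subcoalgebras of $H$; $H$ is non-cosemisimple if $H\ne H_0$. $H$ has the dual Chevalley property if $H_0$ is a Hopf subalgebra. $\{H_n\}_{n\ge 0}$ denotes the coradical filtration of $H$ (so $H_n=\Delta^{-1}(H\otimes H_{n-1}+H_0\otimes H)$ for $n\ge1$), and the Loewy length of a finite-dimensional $H$ is $\mathrm{Lw}(H):=\min\{l\ge 1\mid H_{l-1}=H\}<\infty$. *)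

theory Defs
  imports
    "HOL-Computational_Algebra.Computational_Algebra"
    "HOL-Library.Function_Algebras"
    "HOL-Library.Extended_Nat"
begin

section \<open>Tensor powers of a vector space\<close>

text \<open>
  Over a field, the canonical map from \<open>V \<otimes> \<dots> \<otimes> V\<close> to the multilinear forms on the dual of
  \<open>V\<close>, sending \<open>x\<^sub>1 \<otimes> \<dots> \<otimes> x\<^sub>n\<close> to
  \<open>(\<phi>\<^sub>1, \<dots>, \<phi>\<^sub>n) \<mapsto> \<phi>\<^sub>1 x\<^sub>1 * \<dots> * \<phi>\<^sub>n x\<^sub>n\<close>, is injective. A tensor of degree \<open>n\<close> is represented by
  its image under this map, a function on lists of functionals which is \<open>0\<close> on lists of any other
  length and on lists containing a non-linear function. With this representation
  \<open>U \<otimes> W\<close> is literally a subset of \<open>V \<otimes> V\<close> for subspaces \<open>U\<close> and \<open>W\<close> of \<open>V\<close>.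
  The universal property is given by lemmas \<open>lift_sum_pure\<close> and \<open>tensors_sum_pure\<close> below.
\<close>

type_synonym ('k, 'v) tensor = "('v \<Rightarrow> 'k) list \<Rightarrow> 'k"

definition pure :: "('k::field \<Rightarrow> 'v::ab_group_add \<Rightarrow> 'v) \<Rightarrow> 'v list \<Rightarrow> ('k, 'v) tensor" where
  "pure s xs = (\<lambda>\<phi>s.
     if length \<phi>s = length xs \<and> (\<forall>\<phi>\<in>set \<phi>s. Vector_Spaces.linear s (*) \<phi>)
     then \<Prod>i<length xs. (\<phi>s ! i) (xs ! i) else 0)"

definition tscale :: "'k::field \<Rightarrow> ('k, 'v) tensor \<Rightarrow> ('k, 'v) tensor" where
  "tscale c t = (\<lambda>\<phi>s. c * t \<phi>s)"

text \<open>The subspace \<open>U\<^sub>1 \<otimes> \<dots> \<otimes> U\<^sub>n\<close>.\<close>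

definition tensors ::
  "('k::field \<Rightarrow> 'v::ab_group_add \<Rightarrow> 'v) \<Rightarrow> 'v set list \<Rightarrow> ('k, 'v) tensor set" where
  "tensors s Us = module.span tscale (pure s ` {xs. list_all2 (\<in>) xs Us})"

text \<open>The product \<open>t \<otimes> t'\<close> of a tensor \<open>t\<close> of degree \<open>m\<close> with a tensor \<open>t'\<close>.\<close>

definition tprod :: "nat \<Rightarrow> ('k::field, 'v) tensor \<Rightarrow> ('k, 'v) tensor \<Rightarrow> ('k, 'v) tensor" where
  "tprod m t t' = (\<lambda>\<phi>s. t (take m \<phi>s) * t' (drop m \<phi>s))"

text \<open>
  \<open>lift s [U\<^sub>1, \<dots>, U\<^sub>n] f\<close> is, for \<open>n \<ge> 1\<close> and \<open>f\<close> multilinear on \<open>U\<^sub>1 \<times> \<dots> \<times> U\<^sub>n\<close>, the induced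
  linear map \<open>x\<^sub>1 \<otimes> \<dots> \<otimes> x\<^sub>n \<mapsto> f [x\<^sub>1, \<dots>, x\<^sub>n]\<close> on \<open>U\<^sub>1 \<otimes> \<dots> \<otimes> U\<^sub>n\<close>. (Every element is
  a sum of pure tensors, scalars being absorbed in the first factor.)
\<close>

definition lift ::
  "('k::field \<Rightarrow> 'v::ab_group_add \<Rightarrow> 'v) \<Rightarrow> 'v set list \<Rightarrow> ('v list \<Rightarrow> 'w::comm_monoid_add)
    \<Rightarrow> ('k, 'v) tensor \<Rightarrow> 'w" where
  "lift s Us f t = (THE y. \<exists>xss. (\<forall>xs\<in>set xss. list_all2 (\<in>) xs Us)
      \<and> t = (\<Sum>xs\<leftarrow>xss. pure s xs) \<and> y = (\<Sum>xs\<leftarrow>xss. f xs))"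

definition multilinear_on ::
  "('k::field \<Rightarrow> 'v::ab_group_add \<Rightarrow> 'v) \<Rightarrow> ('k \<Rightarrow> 'w::ab_group_add \<Rightarrow> 'w) \<Rightarrow> 'v set list
    \<Rightarrow> ('v list \<Rightarrow> 'w) \<Rightarrow> bool" where
  "multilinear_on s s' Us f \<longleftrightarrow>
     (\<forall>xs i x y c. list_all2 (\<in>) xs Us \<and> i < length Us \<and> x \<in> Us ! i \<and> y \<in> Us ! i \<longrightarrow>
        f (xs[i := x + y]) = f (xs[i := x]) + f (xs[i := y]) \<and>
        f (xs[i := s c x]) = s' c (f (xs[i := x])))"

lemma multilinear_on_ConsD:
  assumes f: "multilinear_on s s' (U # Us) f" and b: "b \<in> U"
  shows "multilinear_on s s' Us (\<lambda>xs. f (b # xs))"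
  unfolding multilinear_on_def
proof (intro allI impI)
  fix xs i x y c
  assume *: "list_all2 (\<in>) xs Us \<and> i < length Us \<and> x \<in> Us ! i \<and> y \<in> Us ! i"
  have "list_all2 (\<in>) (b # xs) (U # Us)" "Suc i < length (U # Us)"
    "x \<in> (U # Us) ! Suc i" "y \<in> (U # Us) ! Suc i"
    using * b by auto
  then have "f ((b # xs)[Suc i := x + y]) = f ((b # xs)[Suc i := x]) + f ((b # xs)[Suc i := y]) \<and>
        f ((b # xs)[Suc i := s c x]) = s' c (f ((b # xs)[Suc i := x]))"
    using f unfolding multilinear_on_def by blast
  then show "f (b # xs[i := x + y]) = f (b # xs[i := x]) + f (b # xs[i := y]) \<and>
      f (b # xs[i := s c x]) = s' c (f (b # xs[i := x]))"
    by simp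
qed

lemma multilinear_on_hd:
  assumes f: "multilinear_on s s' (U # Us) f" and ys: "list_all2 (\<in>) ys Us"
    and x: "x \<in> U" and y: "y \<in> U"
  shows "f ((x + y) # ys) = f (x # ys) + f (y # ys)" "f (s c x # ys) = s' c (f (x # ys))"
proof -
  have "list_all2 (\<in>) (x # ys) (U # Us)" "0 < length (U # Us)"
    "x \<in> (U # Us) ! 0" "y \<in> (U # Us) ! 0"
    using ys x y by auto
  then have "f ((x # ys)[0 := x + y]) = f ((x # ys)[0 := x]) + f ((x # ys)[0 := y]) \<and>
        f ((x # ys)[0 := s c x]) = s' c (f ((x # ys)[0 := x]))"
    using f unfolding multilinear_on_def by blast
  then show "f ((x + y) # ys) = f (x # ys) + f (y # ys)" "f (s c x # ys) = s' c (f (x # ys))"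
    by simp_all
qed

lemma multilinear_on_hd_sum:
  assumes vs: "vector_space s" "vector_space s'" and U: "module.subspace s U"
    and f: "multilinear_on s s' (U # Us) f" and ys: "list_all2 (\<in>) ys Us"
    and F: "finite F" "F \<subseteq> U"
  shows "f ((\<Sum>b\<in>F. s (r b) b) # ys) = (\<Sum>b\<in>F. s' (r b) (f (b # ys)))"
proof -
  interpret V: vector_space s by fact
  interpret W: vector_space s' by fact
  show ?thesis using F
  proof (induction F rule: finite_induct)
    case empty
    have "f (s 0 0 # ys) = s' 0 (f (0 # ys))"
      using multilinear_on_hd(2)[OF f ys, of 0 0 0] V.subspace_0[OF U] by blast
    then show ?case by simp
  next
    case (insert b F)
    have "s (r b) b \<in> U" "(\<Sum>b\<in>F. s (r b) b) \<in> U"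
      using insert.prems V.subspace_scale[OF U] by (auto intro!: V.subspace_sum[OF U])
    then have "f ((s (r b) b + (\<Sum>b\<in>F. s (r b) b)) # ys)
        = f (s (r b) b # ys) + f ((\<Sum>b\<in>F. s (r b) b) # ys)"
      using multilinear_on_hd(1)[OF f ys] by blast
    also have "f (s (r b) b # ys) = s' (r b) (f (b # ys))"
      using multilinear_on_hd(2)[OF f ys, of b b "r b"] insert.prems by blast
    finally show ?case using insert by simp
  qed
qed

text \<open>A combination of tuples which vanishes under all products of functionals vanishes under
  every multilinear map.\<close>

lemma multilinear_on_sum_eq_0:
  fixes s :: "'k::field \<Rightarrow> 'v::ab_group_add \<Rightarrow> 'v"
    and s' :: "'k \<Rightarrow> 'w::ab_group_add \<Rightarrow> 'w"
  assumes vs: "vector_space s" "vector_space s'"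
    and "\<forall>U\<in>set Us. module.subspace s U"
    and "multilinear_on s s' Us f"
    and "finite J" and "\<And>j. j \<in> J \<Longrightarrow> list_all2 (\<in>) (xs j) Us"
    and "\<And>\<phi>s. length \<phi>s = length Us \<Longrightarrow> \<forall>\<phi>\<in>set \<phi>s. Vector_Spaces.linear s (*) \<phi> \<Longrightarrow>
      (\<Sum>j\<in>J. c j * (\<Prod>i<length Us. (\<phi>s ! i) (xs j ! i))) = 0"
  shows "(\<Sum>j\<in>J. s' (c j) (f (xs j))) = 0"
  using assms(3-7)
proof (induction Us arbitrary: f c xs)
  case Nil
  interpret W: vector_space s' by fact
  have "(\<Sum>j\<in>J. s' (c j) (f (xs j))) = (\<Sum>j\<in>J. s' (c j) (f []))"
    using Nil.prems(4) by (intro sum.cong) auto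
  also have "\<dots> = s' (\<Sum>j\<in>J. c j) (f [])"
    by (simp add: W.scale_sum_left)
  finally show ?case using Nil.prems(5)[of "[]"] by simp
next
  case (Cons U Us)
  interpret V: vector_space s by fact
  interpret W: vector_space s' by fact
  have U: "V.subspace U" using Cons.prems by simp
  obtain B where B: "B \<subseteq> U" "V.independent B" "U \<subseteq> V.span B"
    by (rule V.maximal_independent_subset)
  define r where "r x b = V.representation (V.extend_basis B) x b" for x b
  have r: "r x b = V.representation B x b" if "x \<in> U" for x b
    unfolding r_def
    by (subst V.representation_extend)
       (use B that in \<open>auto simp: V.independent_extend_basis V.extend_basis_superset\<close>)
  have r_lin: "Vector_Spaces.linear s (*) (\<lambda>x. r x b)" for b
    unfolding r_def by (rule V.linear_representation)
      (use B in \<open>auto simp: V.independent_extend_basis\<close>)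
  define F where "F = (\<Union>j\<in>J. {b. V.representation B (hd (xs j)) b \<noteq> 0})"
  have xs: "hd (xs j) \<in> U" "list_all2 (\<in>) (tl (xs j)) Us" "xs j = hd (xs j) # tl (xs j)"
    if "j \<in> J" for j
    using Cons.prems(4)[OF that] by (auto simp: list_all2_Cons2)
  have F: "finite F" "F \<subseteq> B"
    using Cons.prems(3) V.finite_representation V.representation_ne_zero by (auto simp: F_def)
  have hd_eq: "hd (xs j) = (\<Sum>b\<in>F. s (r (hd (xs j)) b) b)" if j: "j \<in> J" for j
  proof -
    have "(\<Sum>b\<in>F. s (r (hd (xs j)) b) b)
        = (\<Sum>b | V.representation B (hd (xs j)) b \<noteq> 0. s (r (hd (xs j)) b) b)"
      using F j by (intro sum.mono_neutral_right) (auto simp: F_def r xs(1))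
    also have "\<dots> = hd (xs j)"
      using V.sum_nonzero_representation_eq[of B "hd (xs j)"] B xs(1)[OF j] r by auto
    finally show ?thesis by simp
  qed
  have eq: "s' (c j) (f (xs j)) = (\<Sum>b\<in>F. s' (c j * r (hd (xs j)) b) (f (b # tl (xs j))))"
    if j: "j \<in> J" for j
  proof -
    have "f (xs j) = f ((\<Sum>b\<in>F. s (r (hd (xs j)) b) b) # tl (xs j))"
      using xs(3)[OF j] hd_eq[OF j] by simp
    also have "\<dots> = (\<Sum>b\<in>F. s' (r (hd (xs j)) b) (f (b # tl (xs j))))"
      by (rule multilinear_on_hd_sum[OF vs U Cons.prems(2) xs(2)[OF j] F(1)])
         (use F B in auto)
    finally show ?thesis by (simp add: W.scale_sum_right)
  qed
  have "(\<Sum>j\<in>J. s' (c j * r (hd (xs j)) b) (f (b # tl (xs j)))) = 0" if b: "b \<in> F" for b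
  proof (rule Cons.IH[where f = "\<lambda>ys. f (b # ys)" and xs = "\<lambda>j. tl (xs j)"
      and c = "\<lambda>j. c j * r (hd (xs j)) b"])
    show "multilinear_on s s' Us (\<lambda>ys. f (b # ys))"
      by (rule multilinear_on_ConsD[OF Cons.prems(2)]) (use b F B in auto)
    fix \<phi>s :: "('v \<Rightarrow> 'k) list"
    assume \<phi>s: "length \<phi>s = length Us" "\<forall>\<phi>\<in>set \<phi>s. Vector_Spaces.linear s (*) \<phi>"
    have "(\<Sum>j\<in>J. c j * (\<Prod>i<length (U # Us). (((\<lambda>x. r x b) # \<phi>s) ! i) (xs j ! i))) = 0"
      by (rule Cons.prems(5)) (use \<phi>s r_lin in auto)
    moreover have "(\<Prod>i<length (U # Us). (((\<lambda>x. r x b) # \<phi>s) ! i) (xs j ! i))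
        = r (hd (xs j)) b * (\<Prod>i<length Us. (\<phi>s ! i) (tl (xs j) ! i))" if "j \<in> J" for j
      by (subst xs(3)[OF that]) (simp add: prod.lessThan_Suc_shift del: prod.lessThan_Suc)
    ultimately show "(\<Sum>j\<in>J. c j * r (hd (xs j)) b * (\<Prod>i<length Us. (\<phi>s ! i) (tl (xs j) ! i))) = 0"
      by (simp add: mult.assoc)
  qed (use Cons.prems xs in auto)
  then have "(\<Sum>b\<in>F. \<Sum>j\<in>J. s' (c j * r (hd (xs j)) b) (f (b # tl (xs j)))) = 0"
    by simp
  then show ?case
    by (subst (asm) sum.swap) (simp add: eq)
qed

lemma sum_fun_apply: "(\<Sum>x\<in>A. f x) y = (\<Sum>x\<in>A. f x y)"
  by (induction A rule: infinite_finite_induct) auto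

lemma sum_list_fun_apply: "(\<Sum>x\<leftarrow>xs. f x) y = (\<Sum>x\<leftarrow>xs. f x y)"
  by (induction xs) auto

lemma lift_sum_pure:
  fixes s :: "'k::field \<Rightarrow> 'v::ab_group_add \<Rightarrow> 'v"
    and s' :: "'k \<Rightarrow> 'w::ab_group_add \<Rightarrow> 'w"
  assumes vs: "vector_space s" "vector_space s'"
    and Us: "\<forall>U\<in>set Us. module.subspace s U"
    and f: "multilinear_on s s' Us f"
    and xss: "\<forall>xs\<in>set xss. list_all2 (\<in>) xs Us"
  shows "lift s Us f (\<Sum>xs\<leftarrow>xss. pure s xs) = (\<Sum>xs\<leftarrow>xss. f xs)"
proof -
  interpret W: vector_space s' by fact
  have uniq: "(\<Sum>xs\<leftarrow>yss. f xs) = (\<Sum>xs\<leftarrow>xss. f xs)"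
    if yss: "\<forall>xs\<in>set yss. list_all2 (\<in>) xs Us"
      and eq: "(\<Sum>xs\<leftarrow>xss. pure s xs) = (\<Sum>xs\<leftarrow>yss. pure s xs)" for yss
  proof -
    define zss where "zss = xss @ yss"
    define c where "c j = (if j < length xss then 1 else - 1 :: 'k)" for j
    have split: "(\<Sum>j<length zss. g (c j) (zss ! j))
        = (\<Sum>xs\<leftarrow>xss. g 1 xs) + (\<Sum>xs\<leftarrow>yss. g (- 1) xs)"
      for g :: "'k \<Rightarrow> 'v list \<Rightarrow> 'b::comm_monoid_add"
    proof -
      have "(\<Sum>j<length zss. g (c j) (zss ! j)) = (\<Sum>j<length xss. g (c j) (zss ! j))
          + (\<Sum>j<length yss. g (c (length xss + j)) (zss ! (length xss + j)))"
        unfolding zss_def length_append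
        using sum.nat_group sum.atLeastLessThan_concat[of 0 "length xss" "length xss + length yss"
            "\<lambda>j. g (c j) ((xss @ yss) ! j)"]
          sum.shift_bounds_nat_ivl[of "\<lambda>j. g (c j) ((xss @ yss) ! j)" 0 "length xss" "length yss"]
        by (simp add: atLeast0LessThan add.commute)
      then show ?thesis
        by (simp add: sum_list_sum_nth zss_def c_def nth_append atLeast0LessThan)
    qed
    have zss: "list_all2 (\<in>) (zss ! j) Us" if "j < length zss" for j
      using that xss yss nth_mem[OF that] by (auto simp: zss_def)
    have "(\<Sum>j\<in>{..<length zss}. s' (c j) (f (zss ! j))) = 0"
    proof (rule multilinear_on_sum_eq_0[OF vs Us f])
      fix \<phi>s :: "('v \<Rightarrow> 'k) list"
      assume \<phi>s: "length \<phi>s = length Us" "\<forall>\<phi>\<in>set \<phi>s. Vector_Spaces.linear s (*) \<phi>"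
      have pure: "pure s xs \<phi>s = (\<Prod>i<length Us. (\<phi>s ! i) (xs ! i))" if "list_all2 (\<in>) xs Us" for xs
        using \<phi>s list_all2_lengthD[OF that] by (simp add: pure_def)
      have "(\<Sum>j<length zss. c j * (\<Prod>i<length Us. (\<phi>s ! i) (zss ! j ! i)))
          = (\<Sum>j<length zss. c j * pure s (zss ! j) \<phi>s)"
        using zss by (intro sum.cong) (simp_all add: pure)
      also have "\<dots> = (\<Sum>xs\<leftarrow>xss. pure s xs \<phi>s) - (\<Sum>xs\<leftarrow>yss. pure s xs \<phi>s)"
        using split[of "\<lambda>a xs. a * pure s xs \<phi>s"] by (simp flip: uminus_sum_list_map[unfolded o_def])
      also have "\<dots> = 0"
        using fun_cong[OF eq, of \<phi>s] by (simp add: sum_list_fun_apply)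
      finally show "(\<Sum>j<length zss. c j * (\<Prod>i<length Us. (\<phi>s ! i) (zss ! j ! i))) = 0" .
    qed (use zss in auto)
    then show ?thesis
      using split[of "\<lambda>a xs. s' a (f xs)"]
      by (simp flip: uminus_sum_list_map[unfolded o_def])
  qed
  show ?thesis
    unfolding lift_def
  proof (rule the_equality)
    show "\<exists>yss. (\<forall>xs\<in>set yss. list_all2 (\<in>) xs Us) \<and>
        (\<Sum>xs\<leftarrow>xss. pure s xs) = (\<Sum>xs\<leftarrow>yss. pure s xs) \<and>
        (\<Sum>xs\<leftarrow>xss. f xs) = (\<Sum>xs\<leftarrow>yss. f xs)"
      using xss by blast
  qed (use uniq in blast)
qed

lemma vector_space_tscale: "vector_space (tscale :: 'k::field \<Rightarrow> ('k, 'v) tensor \<Rightarrow> _)"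
  by unfold_locales (auto simp: tscale_def fun_eq_iff algebra_simps)

lemma tensors_sum_pure:
  assumes s: "vector_space s" and U: "module.subspace s U" and t: "t \<in> tensors s (U # Us)"
  shows "\<exists>xss. (\<forall>xs\<in>set xss. list_all2 (\<in>) xs (U # Us)) \<and> t = (\<Sum>xs\<leftarrow>xss. pure s xs)"
proof -
  interpret V: vector_space s by fact
  interpret T: vector_space "tscale :: 'a \<Rightarrow> ('a, 'b) tensor \<Rightarrow> _"
    by (rule vector_space_tscale)
  have scale: "tscale c (pure s (x # xs)) = pure s (s c x # xs)" for c x xs
  proof
    fix \<phi>s :: "('b \<Rightarrow> 'a) list"
    show "tscale c (pure s (x # xs)) \<phi>s = pure s (s c x # xs) \<phi>s"
    proof (cases \<phi>s)
      case (Cons \<phi> \<psi>s)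
      show ?thesis
        by (auto simp: tscale_def pure_def Cons prod.lessThan_Suc_shift mult.assoc
            module_hom.scale[OF Vector_Spaces.linear.axioms(3)] simp del: prod.lessThan_Suc)
    qed (simp add: tscale_def pure_def)
  qed
  show ?thesis
    using t unfolding tensors_def
  proof (induction rule: T.span_induct_alt)
    case base
    show ?case by (rule exI[of _ "[]"]) simp
  next
    case (step c t1 t2)
    from step obtain xss where xss: "\<forall>xs\<in>set xss. list_all2 (\<in>) xs (U # Us)"
      "t2 = (\<Sum>xs\<leftarrow>xss. pure s xs)" by blast
    from step obtain x xs where t1: "t1 = pure s (x # xs)" "x \<in> U" "list_all2 (\<in>) xs Us"
      by (auto simp: list_all2_Cons2)
    have "list_all2 (\<in>) (s c x # xs) (U # Us)"
      using t1 V.subspace_scale[OF U] by simp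
    then show ?case
      using xss by (intro exI[of _ "(s c x # xs) # xss"]) (simp add: t1 scale)
  qed
qed

section \<open>Hopf algebras\<close>

text \<open>
  The underlying space \<open>hspace\<close> is a subspace of the type \<open>'h\<close>, so that a Hopf subalgebra can
  be treated as a Hopf algebra by restricting \<open>hspace\<close>; the operations are only relevant on
  \<open>hspace\<close>. The unit map \<open>u\<close> is given by \<open>u c = c 1\<close>.
\<close>

record ('k, 'h) hopf_data =
  hspace :: "'h set"
  hscale :: "'k \<Rightarrow> 'h \<Rightarrow> 'h"
  hmult :: "'h \<Rightarrow> 'h \<Rightarrow> 'h"
  hone :: "'h"
  hcomult :: "'h \<Rightarrow> ('k, 'h) tensor"
  hcounit :: "'h \<Rightarrow> 'k"

definition linear_space :: "('k::field, 'h::ab_group_add) hopf_data \<Rightarrow> bool" where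
  "linear_space H \<longleftrightarrow>
     vector_space (hscale H) \<and> module.subspace (hscale H) (hspace H)"

definition hfinite_dim :: "('k::field, 'h::ab_group_add) hopf_data \<Rightarrow> bool" where
  "hfinite_dim H \<longleftrightarrow> (\<exists>B. finite B \<and> hspace H = module.span (hscale H) B)"

definition algebra_axioms :: "('k::field, 'h::ab_group_add) hopf_data \<Rightarrow> bool" where
  "algebra_axioms H \<longleftrightarrow>
     hone H \<in> hspace H \<and>
     (\<forall>x\<in>hspace H. hmult H (hone H) x = x \<and> hmult H x (hone H) = x) \<and>
     (\<forall>x\<in>hspace H. \<forall>y\<in>hspace H. hmult H x y \<in> hspace H \<and>
        (\<forall>c. hmult H (hscale H c x) y = hscale H c (hmult H x y) \<and>
             hmult H x (hscale H c y) = hscale H c (hmult H x y)) \<and>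
        (\<forall>z\<in>hspace H.
           hmult H (x + y) z = hmult H x z + hmult H y z \<and>
           hmult H z (x + y) = hmult H z x + hmult H z y \<and>
           hmult H (hmult H x y) z = hmult H x (hmult H y z)))"

text \<open>In order: linearity of \<open>\<Delta>\<close> and \<open>\<epsilon>\<close>,
  \<open>(\<Delta> \<otimes> id) \<circ> \<Delta> = (id \<otimes> \<Delta>) \<circ> \<Delta>\<close> and \<open>(\<epsilon> \<otimes> id) \<circ> \<Delta> = id = (id \<otimes> \<epsilon>) \<circ> \<Delta>\<close>.\<close>

definition coalgebra_axioms :: "('k::field, 'h::ab_group_add) hopf_data \<Rightarrow> bool" where
  "coalgebra_axioms H \<longleftrightarrow>
     (\<forall>x\<in>hspace H.
        hcomult H x \<in> tensors (hscale H) [hspace H, hspace H] \<and>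
        (\<forall>y\<in>hspace H. hcomult H (x + y) = hcomult H x + hcomult H y \<and>
                      hcounit H (x + y) = hcounit H x + hcounit H y) \<and>
        (\<forall>c. hcomult H (hscale H c x) = tscale c (hcomult H x) \<and>
             hcounit H (hscale H c x) = c * hcounit H x) \<and>
        lift (hscale H) [hspace H, hspace H]
             (\<lambda>xs. tprod 2 (hcomult H (xs ! 0)) (pure (hscale H) [xs ! 1])) (hcomult H x) =
        lift (hscale H) [hspace H, hspace H]
             (\<lambda>xs. tprod 1 (pure (hscale H) [xs ! 0]) (hcomult H (xs ! 1))) (hcomult H x) \<and>
        lift (hscale H) [hspace H, hspace H]
             (\<lambda>xs. hscale H (hcounit H (xs ! 0)) (xs ! 1)) (hcomult H x) = x \<and>
        lift (hscale H) [hspace H, hspace H]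
             (\<lambda>xs. hscale H (hcounit H (xs ! 1)) (xs ! 0)) (hcomult H x) = x)"

text \<open>The multiplication \<open>(a \<otimes> b) (c \<otimes> d) = a c \<otimes> b d\<close> of \<open>H \<otimes> H\<close>.\<close>

definition tmult ::
  "('k::field, 'h::ab_group_add) hopf_data \<Rightarrow> ('k, 'h) tensor \<Rightarrow> ('k, 'h) tensor
    \<Rightarrow> ('k, 'h) tensor" where
  "tmult H t t' = lift (hscale H) (replicate 4 (hspace H))
     (\<lambda>xs. pure (hscale H) [hmult H (xs ! 0) (xs ! 2), hmult H (xs ! 1) (xs ! 3)]) (tprod 2 t t')"

definition bialgebra :: "('k::field, 'h::ab_group_add) hopf_data \<Rightarrow> bool" where
  "bialgebra H \<longleftrightarrow> linear_space H \<and> algebra_axioms H \<and> coalgebra_axioms H \<and>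
     hcomult H (hone H) = pure (hscale H) [hone H, hone H] \<and> hcounit H (hone H) = 1 \<and>
     (\<forall>x\<in>hspace H. \<forall>y\<in>hspace H.
        hcomult H (hmult H x y) = tmult H (hcomult H x) (hcomult H y) \<and>
        hcounit H (hmult H x y) = hcounit H x * hcounit H y)"

definition is_antipode :: "('k::field, 'h::ab_group_add) hopf_data \<Rightarrow> ('h \<Rightarrow> 'h) \<Rightarrow> bool" where
  "is_antipode H S \<longleftrightarrow>
     (\<forall>x\<in>hspace H.
        S x \<in> hspace H \<and>
        (\<forall>y\<in>hspace H. S (x + y) = S x + S y) \<and>
        (\<forall>c. S (hscale H c x) = hscale H c (S x)) \<and>
        lift (hscale H) [hspace H, hspace H] (\<lambda>xs. hmult H (S (xs ! 0)) (xs ! 1)) (hcomult H x) =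
          hscale H (hcounit H x) (hone H) \<and>
        lift (hscale H) [hspace H, hspace H] (\<lambda>xs. hmult H (xs ! 0) (S (xs ! 1))) (hcomult H x) =
          hscale H (hcounit H x) (hone H))"

definition hopf_algebra :: "('k::field, 'h::ab_group_add) hopf_data \<Rightarrow> bool" where
  "hopf_algebra H \<longleftrightarrow> bialgebra H \<and> (\<exists>S. is_antipode H S)"

definition subcoalgebra :: "('k::field, 'h::ab_group_add) hopf_data \<Rightarrow> 'h set \<Rightarrow> bool" where
  "subcoalgebra H D \<longleftrightarrow>
     module.subspace (hscale H) D \<and> D \<subseteq> hspace H \<and>
     (\<forall>x\<in>D. hcomult H x \<in> tensors (hscale H) [D, D])"

definition subalgebra :: "('k::field, 'h::ab_group_add) hopf_data \<Rightarrow> 'h set \<Rightarrow> bool" where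
  "subalgebra H A \<longleftrightarrow>
     module.subspace (hscale H) A \<and> A \<subseteq> hspace H \<and> hone H \<in> A \<and>
     (\<forall>x\<in>A. \<forall>y\<in>A. hmult H x y \<in> A)"

definition hopf_subalgebra :: "('k::field, 'h::ab_group_add) hopf_data \<Rightarrow> 'h set \<Rightarrow> bool" where
  "hopf_subalgebra H K \<longleftrightarrow>
     subalgebra H K \<and> subcoalgebra H K \<and> (\<exists>S. is_antipode H S \<and> S ` K \<subseteq> K)"

definition restrict_hopf ::
  "('k, 'h) hopf_data \<Rightarrow> 'h set \<Rightarrow> ('k, 'h) hopf_data" where
  "restrict_hopf H K = H\<lparr>hspace := K\<rparr>"


section \<open>The exponent\<close>

definition iter_mult ::
  "('k::field, 'h::ab_group_add) hopf_data \<Rightarrow> nat \<Rightarrow> ('k, 'h) tensor \<Rightarrow> 'h" where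
  "iter_mult H n =
     lift (hscale H) (replicate n (hspace H)) (\<lambda>xs. foldr (hmult H) xs (hone H))"

text \<open>\<open>\<Delta>\<^sub>1 = id\<close> and \<open>\<Delta>\<^sub>n\<^sub>+\<^sub>1 = (\<Delta> \<otimes> id) \<circ> \<Delta>\<^sub>n\<close> for \<open>n \<ge> 1\<close>; the case \<open>\<Delta>\<^sub>0 = \<epsilon>\<close> is not used.\<close>

fun iter_comult ::
  "('k::field, 'h::ab_group_add) hopf_data \<Rightarrow> nat \<Rightarrow> 'h \<Rightarrow> ('k, 'h) tensor" where
  "iter_comult H 0 h = tscale (hcounit H h) (pure (hscale H) [])"
| "iter_comult H (Suc 0) h = pure (hscale H) [h]"
| "iter_comult H (Suc (Suc n)) h =
     lift (hscale H) (replicate (Suc n) (hspace H))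
       (\<lambda>xs. tprod 2 (hcomult H (hd xs)) (pure (hscale H) (tl xs)))
       (iter_comult H (Suc n) h)"

text \<open>The infimum of the empty set of extended naturals is \<open>\<infinity>\<close>.\<close>

definition exp0 :: "('k::field, 'h::ab_group_add) hopf_data \<Rightarrow> enat" where
  "exp0 H = (INF n\<in>{n. n \<ge> 1 \<and> (\<forall>h\<in>hspace H.
      iter_mult H n (iter_comult H n h) = hscale H (hcounit H h) (hone H))}. enat n)"


section \<open>The coradical filtration\<close>

definition simple_subcoalgebra ::
  "('k::field, 'h::ab_group_add) hopf_data \<Rightarrow> 'h set \<Rightarrow> bool" where
  "simple_subcoalgebra H D \<longleftrightarrow>
     subcoalgebra H D \<and> D \<noteq> {0} \<and> (\<forall>E. subcoalgebra H E \<and> E \<subseteq> D \<longrightarrow> E = {0} \<or> E = D)"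

definition coradical :: "('k::field, 'h::ab_group_add) hopf_data \<Rightarrow> 'h set" where
  "coradical H = module.span (hscale H) (\<Union>{D. simple_subcoalgebra H D})"

definition cosemisimple :: "('k::field, 'h::ab_group_add) hopf_data \<Rightarrow> bool" where
  "cosemisimple H \<longleftrightarrow> hspace H = coradical H"

definition dual_chevalley :: "('k::field, 'h::ab_group_add) hopf_data \<Rightarrow> bool" where
  "dual_chevalley H \<longleftrightarrow> hopf_subalgebra H (coradical H)"

primrec coradical_filtration ::
  "('k::field, 'h::ab_group_add) hopf_data \<Rightarrow> nat \<Rightarrow> 'h set" where
  "coradical_filtration H 0 = coradical H"
| "coradical_filtration H (Suc n) = {h \<in> hspace H.
     \<exists>t \<in> tensors (hscale H) [hspace H, coradical_filtration H n].
     \<exists>t' \<in> tensors (hscale H) [coradical H, hspace H]. hcomult H h = t + t'}"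

definition loewy_length :: "('k::field, 'h::ab_group_add) hopf_data \<Rightarrow> enat" where
  "loewy_length H =
     (INF l\<in>{l. l \<ge> 1 \<and> coradical_filtration H (l - 1) = hspace H}. enat l)"

end

theory Submission
  imports Defs
begin

text \<open>
  The map \<open>m\<^sub>n \<circ> \<Delta>\<^sub>n\<close> is the \<open>n\<close>-th power of the identity in the convolution algebra
  \<open>End H\<close>, so \<open>exp\<^sub>0 H\<close> is the order of the identity.

  If \<open>id\<^sup>N = u \<epsilon>\<close> on \<open>H\<^sub>0\<close>, then \<open>f = id\<^sup>N - u \<epsilon>\<close> vanishes on \<open>H\<^sub>0\<close>, hence its \<open>n\<close>-th power
  vanishes on \<open>H\<^sub>n\<^sub>-\<^sub>1\<close>. In characteristic \<open>p\<close> this gives \<open>id\<close> to the power \<open>N p\<^sup>M\<close>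
  equal to \<open>u \<epsilon>\<close> plus \<open>f\<close> to the power \<open>p\<^sup>M\<close>, and the latter is \<open>0\<close> if \<open>p\<^sup>M\<close> is at
  least the Loewy length.

  In characteristic 0, let \<open>id\<^sup>n = u \<epsilon>\<close> and let \<open>K\<close> be a Hopf subalgebra. The quotient
  \<open>M = (K \<and> K) / K\<close> is a Hopf bimodule over \<open>K\<close>. For a right coinvariant \<open>y\<close> of \<open>M\<close> and a
  left invariant linear map \<open>T\<close> on \<open>M\<close>, one has \<open>0 = T (id\<^sup>n y) = n T y\<close>. Since the right
  coinvariants generate \<open>M\<close> over \<open>K\<close>, all left invariant maps vanish, so \<open>M = 0\<close> by the
  structure theorem of Hopf modules. For \<open>K = H\<^sub>0\<close> this forces \<open>H = H\<^sub>0\<close>.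
\<close>


section \<open>Tensors\<close>

text \<open>The quotient \<open>(K \<and> K) / K\<close> is never formed. A linear projection
  \<open>p\<close> onto \<open>K\<close> and its complement \<open>q\<close> stand for it: an
  identity modulo \<open>K\<close> is an identity after \<open>q\<close>. Neither map respects
  products or coproducts, so expressions in x_(1), x_(2) are compared on the two kinds of legs, K
  \<otimes> W and W \<otimes> K, into which the coproduct of the wedge W decomposes.

  The passage from M = 0 to H = H_0 rests on two facts. First, take a right coideal T of least
  dimension outside K. For \<phi> vanishing on K, the elements \<phi>(t_(1)) t_(2) form a right
  coideal that is zero or simple; if simple right coideals lie in K, this puts T into the wedge.
  Second, simple right coideals U do lie in the coradical, although that is defined by
  subcoalgebras: the subcoalgebra generated by U is a sum of copies of U, so a nonzero subcoalgebra
  of it contains a copy of U, and then U itself, because comodule maps between right coideals are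
  given by functionals acting on the left leg.

  In characteristic p the Frobenius identity is applied to t^N - 1 in the polynomial ring, as the
  convolution algebra need not be commutative.\<close>

lemma tprod_pure:
  fixes s :: "'k::field \<Rightarrow> 'v::ab_group_add \<Rightarrow> 'v"
  shows "tprod (length xs) (pure s xs) (pure s ys) = pure s (xs @ ys)"
proof
  fix \<phi>s :: "('v \<Rightarrow> 'k) list"
  have set: "(\<forall>\<phi>\<in>set \<phi>s. P \<phi>) \<longleftrightarrow>
      (\<forall>\<phi>\<in>set (take (length xs) \<phi>s). P \<phi>) \<and> (\<forall>\<phi>\<in>set (drop (length xs) \<phi>s). P \<phi>)" for P
    by (metis (no_types, lifting) Un_iff append_take_drop_id set_append)
  have len: "length \<phi>s = length (xs @ ys) \<longleftrightarrow>
      length (take (length xs) \<phi>s) = length xs \<and> length (drop (length xs) \<phi>s) = length ys"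
    by auto
  have "(\<Prod>i<length (xs @ ys). (\<phi>s ! i) ((xs @ ys) ! i))
      = (\<Prod>i<length xs. (take (length xs) \<phi>s ! i) (xs ! i)) *
        (\<Prod>i<length ys. (drop (length xs) \<phi>s ! i) (ys ! i))"
    if "length \<phi>s = length (xs @ ys)"
  proof -
    have "(\<Prod>i<length (xs @ ys). (\<phi>s ! i) ((xs @ ys) ! i))
        = (\<Prod>i<length xs. (\<phi>s ! i) ((xs @ ys) ! i)) *
          (\<Prod>i<length ys. (\<phi>s ! (length xs + i)) ((xs @ ys) ! (length xs + i)))"
      using prod.atLeastLessThan_concat[of 0 "length xs" "length xs + length ys"
          "\<lambda>i. (\<phi>s ! i) ((xs @ ys) ! i)"]
        prod.shift_bounds_nat_ivl[of "\<lambda>i. (\<phi>s ! i) ((xs @ ys) ! i)" 0 "length xs" "length ys"]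
      by (simp add: atLeast0LessThan add.commute)
    then show ?thesis
      using that by (simp add: nth_append)
  qed
  then show "tprod (length xs) (pure s xs) (pure s ys) \<phi>s = pure s (xs @ ys) \<phi>s"
    unfolding tprod_def pure_def set[of "Vector_Spaces.linear s (*)"] len by auto
qed

lemma tprod_sum_list_left: "tprod m (\<Sum>x\<leftarrow>xs. f x) t = (\<Sum>x\<leftarrow>xs. tprod m (f x) t)"
  by (auto simp: tprod_def fun_eq_iff sum_list_fun_apply simp flip: sum_list_mult_const)

lemma tprod_sum_list_right: "tprod m t (\<Sum>x\<leftarrow>xs. f x) = (\<Sum>x\<leftarrow>xs. tprod m t (f x))"
  by (auto simp: tprod_def fun_eq_iff sum_list_fun_apply simp flip: sum_list_const_mult)

lemma pure_update:
  fixes s :: "'k::field \<Rightarrow> 'v::ab_group_add \<Rightarrow> 'v"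
  assumes "i < length xs"
  shows "pure s (xs[i := x + y]) = pure s (xs[i := x]) + pure s (xs[i := y])"
    and "pure s (xs[i := s c x]) = tscale c (pure s (xs[i := x]))"
proof -
  have eq: "(\<Prod>j<length xs. (\<phi>s ! j) (xs[i := z] ! j))
      = (\<phi>s ! i) z * (\<Prod>j\<in>{..<length xs} - {i}. (\<phi>s ! j) (xs ! j))"
    for z and \<phi>s :: "('v \<Rightarrow> 'k) list"
    using assms by (subst prod.remove[of _ i]) (auto intro!: prod.cong)
  have lin: "(\<phi>s ! i) (x + y) = (\<phi>s ! i) x + (\<phi>s ! i) y" "(\<phi>s ! i) (s c x) = c * (\<phi>s ! i) x"
    if "length \<phi>s = length xs" "\<forall>\<phi>\<in>set \<phi>s. Vector_Spaces.linear s (*) \<phi>"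
    for \<phi>s :: "('v \<Rightarrow> 'k) list"
  proof -
    have "Vector_Spaces.linear s (*) (\<phi>s ! i)"
      using assms that by simp
    then show "(\<phi>s ! i) (x + y) = (\<phi>s ! i) x + (\<phi>s ! i) y" "(\<phi>s ! i) (s c x) = c * (\<phi>s ! i) x"
      by (simp_all add: Vector_Spaces.linear_iff)
  qed
  show "pure s (xs[i := x + y]) = pure s (xs[i := x]) + pure s (xs[i := y])"
    by (auto simp: pure_def fun_eq_iff eq lin algebra_simps)
  show "pure s (xs[i := s c x]) = tscale c (pure s (xs[i := x]))"
    by (auto simp: pure_def tscale_def fun_eq_iff eq lin)
qed

lemma pure_pair:
  "pure s [a, b] \<phi>s = (if length \<phi>s = 2 \<and> (\<forall>\<phi>\<in>set \<phi>s. Vector_Spaces.linear s (*) \<phi>)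
     then (\<phi>s ! 0) a * (\<phi>s ! 1) b else 0)"
  by (auto simp: pure_def eval_nat_numeral lessThan_Suc)

lemma sum_list_concat_map: "(\<Sum>x\<leftarrow>concat (map g xs). f x) = (\<Sum>x\<leftarrow>xs. \<Sum>y\<leftarrow>g x. f y)"
  by (induction xs) auto

lemma sum_list_swap:
  fixes f :: "'a \<Rightarrow> 'b \<Rightarrow> 'c::comm_monoid_add"
  shows "(\<Sum>x\<leftarrow>xs. \<Sum>y\<leftarrow>ys. f x y) = (\<Sum>y\<leftarrow>ys. \<Sum>x\<leftarrow>xs. f x y)"
  by (induction xs) (auto simp: sum_list_addf)

lemma sum_list_pair_cong:
  "(\<And>a b. (a, b) \<in> set ls \<Longrightarrow> F a b = G a b) \<Longrightarrow> (\<Sum>(a, b)\<leftarrow>ls. F a b) = (\<Sum>(a, b)\<leftarrow>ls. G a b)"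
  by (induction ls) auto

section \<open>Sweedler sums\<close>

text \<open>Assumes just what makes Sweedler sums meaningful, so that
  \<open>restrict_hopf H K\<close> becomes an instance by closure properties alone and its Sweedler
  sums can be compared with those of \<open>H\<close>.\<close>

locale precoalgebra =
  fixes H :: "('k::field, 'h::ab_group_add) hopf_data" (structure)
  assumes linear_space: "linear_space H"
    and comult_tensor: "x \<in> hspace H \<Longrightarrow> hcomult H x \<in> tensors (hscale H) [hspace H, hspace H]"
    and comult_add: "x \<in> hspace H \<Longrightarrow> y \<in> hspace H \<Longrightarrow>
      hcomult H (x + y) = hcomult H x + hcomult H y"
    and comult_scale: "x \<in> hspace H \<Longrightarrow> hcomult H (hscale H c x) = tscale c (hcomult H x)"
begin

abbreviation X where "X \<equiv> hspace H"
abbreviation s where "s \<equiv> hscale H"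

sublocale V: vector_space s
  using linear_space by (simp add: linear_space_def)

lemma vs_scalar: "vector_space ((*) :: 'k \<Rightarrow> 'k \<Rightarrow> 'k)"
  by unfold_locales (auto simp: algebra_simps)

lemmas vs = V.vector_space_axioms vs_scalar

lemma subspace_X: "V.subspace X"
  using linear_space by (simp add: linear_space_def)

lemma X_closed [simp, intro]:
  "0 \<in> X" "x \<in> X \<Longrightarrow> y \<in> X \<Longrightarrow> x + y \<in> X" "x \<in> X \<Longrightarrow> s c x \<in> X"
  "x \<in> X \<Longrightarrow> y \<in> X \<Longrightarrow> x - y \<in> X"
  using subspace_X by (auto simp: V.subspace_0 V.subspace_add V.subspace_scale V.subspace_diff)

text \<open>Linearity is asked for on \<open>X\<close> only, since the operations of
  \<open>H\<close> carry meaning only there. The vector space structure of the target is part of the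
  predicate and travels with it through compositions.\<close>

definition lin :: "('k \<Rightarrow> 'w::ab_group_add \<Rightarrow> 'w) \<Rightarrow> ('h \<Rightarrow> 'w) \<Rightarrow> bool" where
  "lin s' f \<longleftrightarrow> vector_space s' \<and> (\<forall>x\<in>X. \<forall>y\<in>X. f (x + y) = f x + f y) \<and>
     (\<forall>x\<in>X. \<forall>c. f (s c x) = s' c (f x))"

definition bilin :: "('k \<Rightarrow> 'w::ab_group_add \<Rightarrow> 'w) \<Rightarrow> ('h \<Rightarrow> 'h \<Rightarrow> 'w) \<Rightarrow> bool" where
  "bilin s' F \<longleftrightarrow> (\<forall>a\<in>X. lin s' (\<lambda>b. F a b)) \<and> (\<forall>b\<in>X. lin s' (\<lambda>a. F a b))"

definition trilin :: "('k \<Rightarrow> 'w::ab_group_add \<Rightarrow> 'w) \<Rightarrow> ('h \<Rightarrow> 'h \<Rightarrow> 'h \<Rightarrow> 'w) \<Rightarrow> bool" where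
  "trilin s' F \<longleftrightarrow> (\<forall>a\<in>X. bilin s' (F a)) \<and> (\<forall>b\<in>X. bilin s' (\<lambda>a. F a b))"

section \<open>Lists of pairs representing a coproduct\<close>

definition represents :: "('h \<times> 'h) list \<Rightarrow> 'h \<Rightarrow> bool" where
  "represents ls x \<longleftrightarrow> set ls \<subseteq> X \<times> X \<and> hcomult H x = (\<Sum>(a, b)\<leftarrow>ls. pure s [a, b])"

text \<open>An arbitrary choice, which \<open>D\<close> inherits. Rules such as
  \<open>D_cong\<close>, \<open>D_plus\<close> and \<open>D_swap\<close> only rearrange one fixed
  list; once another representation of the coproduct enters, bilinearity and \<open>D_eq\<close>
  take over.\<close>

definition rep :: "'h \<Rightarrow> ('h \<times> 'h) list" where
  "rep x = (SOME ls. represents ls x)"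

text \<open>The Sweedler sum of \<open>F x\<^sub>(\<^sub>1\<^sub>) x\<^sub>(\<^sub>2\<^sub>)\<close>.\<close>

definition D :: "'h \<Rightarrow> ('h \<Rightarrow> 'h \<Rightarrow> 'w::comm_monoid_add) \<Rightarrow> 'w" where
  "D x F = (\<Sum>(a, b)\<leftarrow>rep x. F a b)"

lemma linI:
  assumes "vector_space s'" "\<And>x y. x \<in> X \<Longrightarrow> y \<in> X \<Longrightarrow> f (x + y) = f x + f y"
    "\<And>x c. x \<in> X \<Longrightarrow> f (s c x) = s' c (f x)"
  shows "lin s' f"
  using assms by (auto simp: lin_def)

lemma lin_vs: "lin s' f \<Longrightarrow> vector_space s'"
  and lin_add: "lin s' f \<Longrightarrow> x \<in> X \<Longrightarrow> y \<in> X \<Longrightarrow> f (x + y) = f x + f y"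
  and lin_scale: "lin s' f \<Longrightarrow> x \<in> X \<Longrightarrow> f (s c x) = s' c (f x)"
  by (auto simp: lin_def)

lemma lin_0: "lin s' f \<Longrightarrow> f 0 = 0"
  using lin_add[of s' f 0 0] by simp

lemma lin_minus: "lin s' f \<Longrightarrow> x \<in> X \<Longrightarrow> f (- x) = - f x"
  using lin_add[of s' f x "- x"] lin_0[of s' f] V.subspace_neg[OF subspace_X, of x]
  by (simp add: eq_neg_iff_add_eq_0 add.commute)

lemma lin_diff: "lin s' f \<Longrightarrow> x \<in> X \<Longrightarrow> y \<in> X \<Longrightarrow> f (x - y) = f x - f y"
  using lin_add[of s' f x "- y"] lin_minus[of s' f y] V.subspace_neg[OF subspace_X, of y] by simp

lemma X_sum_list: "(\<And>x. x \<in> set xs \<Longrightarrow> f x \<in> X) \<Longrightarrow> (\<Sum>x\<leftarrow>xs. f x) \<in> X"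
  by (induction xs) auto

lemma lin_sum_list:
  assumes "lin s' f" "\<And>x. x \<in> set xs \<Longrightarrow> g x \<in> X"
  shows "f (\<Sum>x\<leftarrow>xs. g x) = (\<Sum>x\<leftarrow>xs. f (g x))"
  using assms(2) by (induction xs) (auto simp: lin_0[OF assms(1)] lin_add[OF assms(1)] X_sum_list)

lemma lin_id [intro]: "lin s (\<lambda>x. x)"
  by (rule linI) (auto simp: vs)

lemma lin_zero: "vector_space s' \<Longrightarrow> lin s' (\<lambda>x. 0)"
  by (rule linI) (auto simp: module.scale_zero_right module_iff_vector_space)

lemma lin_compose: "lin s' g \<Longrightarrow> lin s f \<Longrightarrow> (\<And>x. x \<in> X \<Longrightarrow> f x \<in> X) \<Longrightarrow> lin s' (\<lambda>x. g (f x))"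
  by (auto simp: lin_def)

lemma lin_plus:
  assumes "lin s' f" "lin s' g" shows "lin s' (\<lambda>x. f x + g x)"
proof -
  interpret W: vector_space s' by (rule lin_vs[OF assms(1)])
  show ?thesis
    using assms by (intro linI) (auto simp: lin_def algebra_simps)
qed

lemma lin_minus_fun:
  assumes "lin s' f" "lin s' g" shows "lin s' (\<lambda>x. f x - g x)"
proof -
  interpret W: vector_space s' by (rule lin_vs[OF assms(1)])
  show ?thesis
    using assms by (intro linI) (auto simp: lin_def algebra_simps)
qed

lemma lin_const_scale:
  assumes "lin s' f" shows "lin s' (\<lambda>x. s' c (f x))"
proof -
  interpret W: vector_space s' by (rule lin_vs[OF assms(1)])
  show ?thesis
    using assms by (intro linI) (auto simp: lin_def algebra_simps)
qed

lemma lin_scale_const: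
  assumes "vector_space s'" "lin (*) f" shows "lin s' (\<lambda>x. s' (f x) w)"
proof -
  interpret W: vector_space s' by fact
  show ?thesis
    using assms by (intro linI) (auto simp: lin_def algebra_simps)
qed

lemma lin_sum_list_fun:
  assumes "vector_space s'" "\<And>i. i \<in> set is \<Longrightarrow> lin s' (\<lambda>x. f x i)"
  shows "lin s' (\<lambda>x. \<Sum>i\<leftarrow>is. f x i)"
  using assms(2) by (induction "is") (auto intro: lin_plus lin_zero[OF assms(1)])

lemma lin_sum_fun:
  assumes "vector_space s'" "\<And>i. i \<in> A \<Longrightarrow> lin s' (\<lambda>x. f x i)"
  shows "lin s' (\<lambda>x. \<Sum>i\<in>A. f x i)"
  using assms(2) by (induction A rule: infinite_finite_induct) (auto intro: lin_plus lin_zero[OF assms(1)])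

lemma lin_times_left: "lin (*) f \<Longrightarrow> lin (*) (\<lambda>x. f x * c)"
  and lin_times_right: "lin (*) f \<Longrightarrow> lin (*) (\<lambda>x. c * f x)"
  by (auto simp: lin_def algebra_simps)

lemma linear_imp_lin: "Vector_Spaces.linear s s' f \<Longrightarrow> lin s' f"
  by (auto simp: lin_def Vector_Spaces.linear_iff)

lemma bilinI:
  "(\<And>a. a \<in> X \<Longrightarrow> lin s' (\<lambda>b. F a b)) \<Longrightarrow> (\<And>b. b \<in> X \<Longrightarrow> lin s' (\<lambda>a. F a b)) \<Longrightarrow> bilin s' F"
  by (simp add: bilin_def)

lemma bilinD1: "bilin s' F \<Longrightarrow> a \<in> X \<Longrightarrow> lin s' (\<lambda>b. F a b)"
  and bilinD2: "bilin s' F \<Longrightarrow> b \<in> X \<Longrightarrow> lin s' (\<lambda>a. F a b)"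
  by (auto simp: bilin_def)

lemma trilinI:
  "(\<And>a b. a \<in> X \<Longrightarrow> b \<in> X \<Longrightarrow> lin s' (\<lambda>x. F a b x)) \<Longrightarrow>
   (\<And>a b. a \<in> X \<Longrightarrow> b \<in> X \<Longrightarrow> lin s' (\<lambda>x. F a x b)) \<Longrightarrow>
   (\<And>a b. a \<in> X \<Longrightarrow> b \<in> X \<Longrightarrow> lin s' (\<lambda>x. F x a b)) \<Longrightarrow> trilin s' F"
  by (auto simp: trilin_def bilin_def)

lemma bilin_vs: "bilin s' F \<Longrightarrow> vector_space s'"
  using bilinD1[of s' F 0] lin_vs by blast

lemma multilinear_on_replicateI:
  assumes "vector_space s'"
    and "\<And>xs i. length xs = n \<Longrightarrow> set xs \<subseteq> X \<Longrightarrow> i < n \<Longrightarrow> lin s' (\<lambda>x. f (xs[i := x]))"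
  shows "multilinear_on s s' (replicate n X) f"
proof -
  have "lin s' (\<lambda>x. f (xs[i := x]))" if "list_all2 (\<in>) xs (replicate n X)" "i < n" for xs i
    using that by (intro assms(2)) (auto simp: list_all2_conv_all_nth set_conv_nth)
  then show ?thesis
    unfolding multilinear_on_def lin_def by auto
qed

lemma lift_list:
  assumes "vector_space s'" "multilinear_on s s' (replicate n X) f"
    "\<And>i. i \<in> set is \<Longrightarrow> length (g i) = n \<and> set (g i) \<subseteq> X"
  shows "lift s (replicate n X) f (\<Sum>i\<leftarrow>is. pure s (g i)) = (\<Sum>i\<leftarrow>is. f (g i))"
proof -
  have "list_all2 (\<in>) (g i) (replicate n X)" if "i \<in> set is" for i
    using assms(3)[OF that] by (auto simp: list_all2_conv_all_nth subset_iff in_set_conv_nth)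
  then show ?thesis
    using lift_sum_pure[OF vs(1) assms(1) _ assms(2), of "map g is"] subspace_X
    by (simp add: o_def)
qed

lemma bilin_multilinear:
  assumes "bilin s' F"
  shows "multilinear_on s s' (replicate 2 X) (\<lambda>xs. F (xs ! 0) (xs ! 1))"
  using assms
  by (intro multilinear_on_replicateI bilin_vs[OF assms])
     (auto simp: less_Suc_eq length_Suc_conv eval_nat_numeral bilin_def)

lemma trilin_multilinear:
  assumes "trilin s' F"
  shows "multilinear_on s s' (replicate 3 X) (\<lambda>xs. F (xs ! 0) (xs ! 1) (xs ! 2))"
proof (rule multilinear_on_replicateI)
  show "vector_space s'"
    using assms bilin_vs[of s' "F 0"] by (auto simp: trilin_def)
  fix xs and i :: nat
  assume "length xs = 3" "set xs \<subseteq> X" "i < 3"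
  then show "lin s' (\<lambda>x. F (xs[i := x] ! 0) (xs[i := x] ! 1) (xs[i := x] ! 2))"
    using assms
    by (auto simp: less_Suc_eq length_Suc_conv eval_nat_numeral bilin_def trilin_def)
qed

lemma lift_pairs:
  assumes "bilin s' F" "set ls \<subseteq> X \<times> X"
  shows "lift s [X, X] (\<lambda>xs. F (xs ! 0) (xs ! 1)) (\<Sum>(a, b)\<leftarrow>ls. pure s [a, b])
    = (\<Sum>(a, b)\<leftarrow>ls. F a b)"
proof -
  have "a \<in> X \<and> b \<in> X" if "(a, b) \<in> set ls" for a b
    using assms(2) that by auto
  then show ?thesis
    using lift_list[OF bilin_vs[OF assms(1)] bilin_multilinear[OF assms(1)],
        of ls "\<lambda>(a, b). [a, b]"]
    by (auto simp: eval_nat_numeral split_def)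
qed

lemma lift_triples:
  assumes "trilin s' F" "set ls \<subseteq> X \<times> X \<times> X"
  shows "lift s [X, X, X] (\<lambda>xs. F (xs ! 0) (xs ! 1) (xs ! 2))
    (\<Sum>(a, b, c)\<leftarrow>ls. pure s [a, b, c]) = (\<Sum>(a, b, c)\<leftarrow>ls. F a b c)"
proof -
  have "vector_space s'"
    using assms bilin_vs[of s' "F 0"] by (auto simp: trilin_def)
  moreover have "a \<in> X \<and> b \<in> X \<and> c \<in> X" if "(a, b, c) \<in> set ls" for a b c
    using assms(2) that by auto
  ultimately show ?thesis
    using lift_list[OF _ trilin_multilinear[OF assms(1)], of ls "\<lambda>(a, b, c). [a, b, c]"]
    by (auto simp: eval_nat_numeral split_def)
qed

lemma tensors_pairs:
  assumes "V.subspace U" "t \<in> tensors s [U, W]"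
  obtains ls where "set ls \<subseteq> U \<times> W" "t = (\<Sum>(a, b)\<leftarrow>ls. pure s [a, b])"
proof -
  from tensors_sum_pure[OF vs(1) assms] obtain xss
    where xss: "\<forall>xs\<in>set xss. list_all2 (\<in>) xs [U, W]" "t = (\<Sum>xs\<leftarrow>xss. pure s xs)"
    by blast
  have eq: "xs = [xs ! 0, xs ! 1] \<and> xs ! 0 \<in> U \<and> xs ! 1 \<in> W" if "xs \<in> set xss" for xs
    using xss(1) that by (auto simp: list_all2_Cons2)
  show ?thesis
  proof
    show "set (map (\<lambda>xs. (xs ! 0, xs ! 1)) xss) \<subseteq> U \<times> W"
      using eq by auto
    show "t = (\<Sum>(a, b)\<leftarrow>map (\<lambda>xs. (xs ! 0, xs ! 1)) xss. pure s [a, b])"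
      unfolding xss(2) map_map o_def split_def fst_conv snd_conv
      by (intro arg_cong[of _ _ sum_list] map_cong refl arg_cong[of _ _ "pure s"])
        (use eq in blast)
  qed
qed

lemma represents_rep: "x \<in> X \<Longrightarrow> represents (rep x) x"
  unfolding rep_def represents_def
  by (rule someI_ex) (metis tensors_pairs subspace_X comult_tensor)

lemma rep_X: "x \<in> X \<Longrightarrow> (a, b) \<in> set (rep x) \<Longrightarrow> a \<in> X \<and> b \<in> X"
  using represents_rep[of x] by (auto simp: represents_def)

lemma comult_rep: "x \<in> X \<Longrightarrow> hcomult H x = D x (\<lambda>a b. pure s [a, b])"
  using represents_rep[of x] by (auto simp: represents_def D_def)

lemma D_lift: "x \<in> X \<Longrightarrow> bilin s' F \<Longrightarrow> lift s [X, X] (\<lambda>xs. F (xs ! 0) (xs ! 1)) (hcomult H x) = D x F"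
  using represents_rep[of x] lift_pairs[of s' F "rep x"] by (simp add: represents_def D_def)

text \<open>A bilinear \<open>F\<close> induces a linear map on the tensor product, and both sums
  are its value at \<open>hcomult H x\<close>.\<close>

lemma D_eq:
  assumes "represents ls x" "x \<in> X" "bilin s' F"
  shows "D x F = (\<Sum>(a, b)\<leftarrow>ls. F a b)"
  using assms D_lift[OF assms(2,3)] lift_pairs[OF assms(3), of ls] by (simp add: represents_def)

lemma D_cong:
  assumes "x \<in> X" "\<And>a b. a \<in> X \<Longrightarrow> b \<in> X \<Longrightarrow> F a b = G a b"
  shows "D x F = D x G"
  unfolding D_def by (rule sum_list_pair_cong, rule assms(2)) (auto dest: rep_X[OF assms(1)])

lemma D_X:
  assumes "x \<in> X" "\<And>a b. a \<in> X \<Longrightarrow> b \<in> X \<Longrightarrow> F a b \<in> X"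
  shows "D x F \<in> X"
  unfolding D_def by (rule X_sum_list) (auto intro!: assms(2) dest: rep_X[OF assms(1)])

lemma D_zero: "D x (\<lambda>a b. 0) = 0"
  by (simp add: D_def split_def)

lemma D_plus: "D x (\<lambda>a b. F a b + G a b) = D x F + D x G"
  by (simp add: D_def split_def sum_list_addf)

lemma D_swap: "D x (\<lambda>a b. D y (\<lambda>c d. F a b c d)) = D y (\<lambda>c d. D x (\<lambda>a b. F a b c d))"
  unfolding D_def split_def by (rule sum_list_swap)

lemma D_scale_out:
  "vector_space s' \<Longrightarrow> D x (\<lambda>a b. s' c (F a b)) = s' c (D x F)"
proof -
  assume "vector_space s'"
  then interpret W: vector_space s' .
  have "(\<Sum>(a, b)\<leftarrow>ls. s' c (F a b)) = s' c (\<Sum>(a, b)\<leftarrow>ls. F a b)" for ls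
    by (induction ls) (auto simp: W.scale_right_distrib)
  then show ?thesis by (simp add: D_def)
qed

lemma D_functional_scale:
  "vector_space s' \<Longrightarrow> D x (\<lambda>a b. s' (\<phi> a b) w) = s' (D x \<phi>) w"
proof -
  assume "vector_space s'"
  then interpret W: vector_space s' .
  have "(\<Sum>(a, b)\<leftarrow>ls. s' (\<phi> a b) w) = s' (\<Sum>(a, b)\<leftarrow>ls. \<phi> a b) w" for ls
    by (induction ls) (auto simp: W.scale_left_distrib)
  then show ?thesis by (simp add: D_def)
qed

lemma lin_D_apply:
  assumes "lin s' f" "x \<in> X" "\<And>a b. a \<in> X \<Longrightarrow> b \<in> X \<Longrightarrow> F a b \<in> X"
  shows "f (D x F) = D x (\<lambda>a b. f (F a b))"
  unfolding D_def split_def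
  by (rule lin_sum_list[OF assms(1)]) (auto intro!: assms(3) dest: rep_X[OF assms(2)])

lemma represents_add:
  "represents ls x \<Longrightarrow> represents ls' y \<Longrightarrow> x \<in> X \<Longrightarrow> y \<in> X \<Longrightarrow> represents (ls @ ls') (x + y)"
  by (auto simp: represents_def comult_add)

lemma represents_scale:
  "represents ls x \<Longrightarrow> x \<in> X \<Longrightarrow> represents (map (\<lambda>(a, b). (s c a, b)) ls) (s c x)"
proof -
  have "pure s [s c a, b] = tscale c (pure s [a, b])" for a b
    using pure_update(2)[of 0 "[a, b]" s c a] by simp
  moreover have "tscale c (\<Sum>(a, b)\<leftarrow>ls. pure s [a, b]) = (\<Sum>(a, b)\<leftarrow>ls. tscale c (pure s [a, b]))"
    by (simp add: tscale_def fun_eq_iff sum_list_fun_apply split_def sum_list_const_mult)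
  ultimately show "represents ls x \<Longrightarrow> x \<in> X \<Longrightarrow> represents (map (\<lambda>(a, b). (s c a, b)) ls) (s c x)"
    by (auto simp: represents_def comult_scale o_def split_def)
qed

text \<open>The chosen \<open>rep (x + y)\<close> bears no relation to \<open>rep x\<close> and
  \<open>rep y\<close>; bilinearity allows the concatenated list to replace it, and similarly the
  rescaled list for scalar multiples.\<close>

lemma lin_D:
  assumes F: "bilin s' F"
  shows "lin s' (\<lambda>x. D x F)"
proof (rule linI)
  show "vector_space s'" by (rule bilin_vs[OF F])
  then interpret W: vector_space s' .
  show "D (x + y) F = D x F + D y F" if "x \<in> X" "y \<in> X" for x y
    using D_eq[OF represents_add[OF represents_rep represents_rep], of x y s' F] that F
    by (simp add: D_def)
  show "D (s c x) F = s' c (D x F)" if "x \<in> X" for x c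
  proof -
    have "D (s c x) F = (\<Sum>(a, b)\<leftarrow>rep x. F (s c a) b)"
      using D_eq[OF represents_scale[OF represents_rep], of x c s' F] that F
      by (simp add: o_def split_def)
    also have "\<dots> = (\<Sum>(a, b)\<leftarrow>rep x. s' c (F a b))"
      by (rule sum_list_pair_cong, rule lin_scale[OF bilinD2[OF F]]) (auto dest: rep_X[OF that])
    also have "\<dots> = s' c (D x F)"
      using D_scale_out[OF W.vector_space_axioms, of x c F] by (simp add: D_def)
    finally show ?thesis .
  qed
qed

lemma lin_D_fun:
  assumes "bilin s' F" "lin s f" "\<And>x. x \<in> X \<Longrightarrow> f x \<in> X"
  shows "lin s' (\<lambda>x. D (f x) F)"
  by (rule lin_compose[OF lin_D]) (use assms in auto)

lemma lin_D_arg: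
  assumes "vector_space s'" "y \<in> X" "\<And>a b. a \<in> X \<Longrightarrow> b \<in> X \<Longrightarrow> lin s' (\<lambda>x. F x a b)"
  shows "lin s' (\<lambda>x. D y (\<lambda>a b. F x a b))"
  unfolding D_def split_def
  by (rule lin_sum_list_fun[OF assms(1)]) (auto intro!: assms(3) dest: rep_X[OF assms(2)])

lemma represents_tensors:
  assumes "represents ls x" "set ls \<subseteq> U \<times> W"
  shows "hcomult H x \<in> tensors s [U, W]"
proof -
  interpret T: vector_space "tscale :: 'k \<Rightarrow> ('k, 'h) tensor \<Rightarrow> _"
    by (rule vector_space_tscale)
  have "pure s [a, b] \<in> tensors s [U, W]" if "a \<in> U" "b \<in> W" for a b
    unfolding tensors_def by (rule T.span_base) (use that in auto)
  then have "(\<Sum>(a, b)\<leftarrow>ls. pure s [a, b]) \<in> tensors s [U, W]"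
    using assms(2)
    by (induction ls) (auto simp: tensors_def intro: T.span_add T.span_zero)
  then show ?thesis
    using assms(1) by (simp add: represents_def)
qed

text \<open>Lets bilinear expressions be compared on the legs of a convenient representation only,
  for instance one with legs in a subcoalgebra.\<close>

lemma D_cong_rep:
  assumes "represents ls x" "x \<in> X" "bilin s' F" "bilin s' G"
    and "\<And>a b. (a, b) \<in> set ls \<Longrightarrow> F a b = G a b"
  shows "D x F = D x G"
  unfolding D_eq[OF assms(1,2,3)] D_eq[OF assms(1,2,4)]
  by (rule sum_list_pair_cong) (rule assms(5))

lemma D_subspace_rep:
  assumes "represents ls x" "x \<in> X" "bilin s F" "V.subspace W"
    and "\<And>a b. (a, b) \<in> set ls \<Longrightarrow> F a b \<in> W"
  shows "D x F \<in> W"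
  unfolding D_eq[OF assms(1,2,3)] using assms(5)
  by (induction ls) (auto simp: V.subspace_0[OF assms(4)] intro!: V.subspace_add[OF assms(4)])

end


section \<open>Convolution\<close>

locale prebialgebra = precoalgebra H
  for H :: "('k::field, 'h::ab_group_add) hopf_data" (structure) +
  assumes algebra: "algebra_axioms H"
begin

abbreviation mult (infixl "\<odot>" 70) where "x \<odot> y \<equiv> hmult H x y"
abbreviation one ("\<one>") where "\<one> \<equiv> hone H"
abbreviation counit ("\<epsilon>") where "\<epsilon> \<equiv> hcounit H"

lemma mult_closed [simp, intro]: "x \<in> X \<Longrightarrow> y \<in> X \<Longrightarrow> x \<odot> y \<in> X"
  and one_closed [simp, intro]: "\<one> \<in> X"
  and one_left [simp]: "x \<in> X \<Longrightarrow> \<one> \<odot> x = x"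
  and one_right [simp]: "x \<in> X \<Longrightarrow> x \<odot> \<one> = x"
  and mult_scale_left: "x \<in> X \<Longrightarrow> y \<in> X \<Longrightarrow> s c x \<odot> y = s c (x \<odot> y)"
  and mult_scale_right: "x \<in> X \<Longrightarrow> y \<in> X \<Longrightarrow> x \<odot> s c y = s c (x \<odot> y)"
  and mult_add_left: "x \<in> X \<Longrightarrow> y \<in> X \<Longrightarrow> z \<in> X \<Longrightarrow> (x + y) \<odot> z = x \<odot> z + y \<odot> z"
  and mult_add_right: "x \<in> X \<Longrightarrow> y \<in> X \<Longrightarrow> z \<in> X \<Longrightarrow> z \<odot> (x + y) = z \<odot> x + z \<odot> y"
  and mult_assoc: "x \<in> X \<Longrightarrow> y \<in> X \<Longrightarrow> z \<in> X \<Longrightarrow> x \<odot> y \<odot> z = x \<odot> (y \<odot> z)"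
  using algebra by (auto simp: algebra_axioms_def)

lemma lin_mult_left:
  "lin s f \<Longrightarrow> (\<And>x. x \<in> X \<Longrightarrow> f x \<in> X) \<Longrightarrow> c \<in> X \<Longrightarrow> lin s (\<lambda>x. f x \<odot> c)"
  by (rule linI) (auto simp: vs lin_add lin_scale mult_add_left mult_scale_left)

lemma lin_mult_right:
  "lin s f \<Longrightarrow> (\<And>x. x \<in> X \<Longrightarrow> f x \<in> X) \<Longrightarrow> c \<in> X \<Longrightarrow> lin s (\<lambda>x. c \<odot> f x)"
  by (rule linI) (auto simp: vs lin_add lin_scale mult_add_right mult_scale_right)

lemmas lin_intros = vs lin_id lin_mult_left lin_mult_right lin_D_fun lin_D_arg bilinI mult_closed
  lin_minus_fun lin_plus lin_const_scale lin_scale_const lin_times_left lin_times_right D_X X_closed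

definition conv :: "('h \<Rightarrow> 'h) \<Rightarrow> ('h \<Rightarrow> 'h) \<Rightarrow> 'h \<Rightarrow> 'h" where
  "conv f g x = D x (\<lambda>a b. f a \<odot> g b)"

definition endo :: "('h \<Rightarrow> 'h) \<Rightarrow> bool" where
  "endo f \<longleftrightarrow> lin s f \<and> (\<forall>x\<in>X. f x \<in> X)"

lemma endoI: "lin s f \<Longrightarrow> (\<And>x. x \<in> X \<Longrightarrow> f x \<in> X) \<Longrightarrow> endo f"
  by (simp add: endo_def)

lemma endo_lin: "endo f \<Longrightarrow> lin s f"
  and endo_X [intro]: "endo f \<Longrightarrow> x \<in> X \<Longrightarrow> f x \<in> X"
  by (auto simp: endo_def)

lemma endo_lin_fun: "endo g \<Longrightarrow> lin s f \<Longrightarrow> (\<And>x. x \<in> X \<Longrightarrow> f x \<in> X) \<Longrightarrow> lin s (\<lambda>x. g (f x))"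
  by (auto intro: lin_compose endo_lin)

lemma endo_id: "endo (\<lambda>x. x)"
  by (auto simp: endo_def)

lemma bilin_endos: "endo f \<Longrightarrow> endo g \<Longrightarrow> bilin s (\<lambda>a b. f a \<odot> g b)"
  by (intro lin_intros) (auto intro: endo_lin)

lemma endo_conv: "endo f \<Longrightarrow> endo g \<Longrightarrow> endo (conv f g)"
  by (rule endoI) (auto simp: conv_def[abs_def] intro!: lin_D bilin_endos D_X)

lemma conv_cong:
  assumes "\<And>x. x \<in> X \<Longrightarrow> f x = f' x" "\<And>x. x \<in> X \<Longrightarrow> g x = g' x" "x \<in> X"
  shows "conv f g x = conv f' g' x"
  unfolding conv_def by (rule D_cong[OF assms(3)]) (simp add: assms)

lemma multilinear_foldr_mult:
  "multilinear_on s s (replicate n X) (\<lambda>xs. foldr (\<odot>) xs \<one>)"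
proof (rule multilinear_on_replicateI[OF vs(1)])
  fix xs and i :: nat
  have closed: "set xs \<subseteq> X \<Longrightarrow> foldr (\<odot>) xs \<one> \<in> X" for xs
    by (induction xs) auto
  assume "length xs = n" "set xs \<subseteq> X" "i < n"
  then show "lin s (\<lambda>x. foldr (\<odot>) (xs[i := x]) \<one>)"
  proof (induction xs arbitrary: i n)
    case (Cons y ys)
    show ?case
    proof (cases i)
      case 0
      then show ?thesis
        using Cons.prems by (auto intro!: lin_mult_left closed)
    next
      case (Suc j)
      have "foldr (\<odot>) (ys[j := x]) \<one> \<in> X" if "x \<in> X" for x
        using Cons.prems that by (intro closed) (auto dest: set_update_subset_insert[THEN subsetD])
      then show ?thesis
        using Cons Suc by (auto intro!: lin_mult_right)
    qed
  qed simp
qed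

lemma multilinear_comult_hd:
  "multilinear_on s tscale (replicate (Suc n) X) (\<lambda>xs. tprod 2 (hcomult H (hd xs)) (pure s (tl xs)))"
proof (rule multilinear_on_replicateI[OF vector_space_tscale])
  fix xs and i :: nat
  assume xs: "length xs = Suc n" "set xs \<subseteq> X" "i < Suc n"
  then obtain y ys where ys: "xs = y # ys" "y \<in> X" "length ys = n"
    by (cases xs) auto
  show "lin tscale (\<lambda>x. tprod 2 (hcomult H (hd (xs[i := x]))) (pure s (tl (xs[i := x]))))"
  proof (cases i)
    case 0
    then show ?thesis
      using ys by (intro linI vector_space_tscale)
        (auto simp: comult_add comult_scale tprod_def tscale_def fun_eq_iff algebra_simps)
  next
    case (Suc j)
    have "j < length ys"
      using Suc xs ys by simp
    then show ?thesis
      using ys Suc by (intro linI vector_space_tscale)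
        (auto simp: pure_update tprod_def tscale_def fun_eq_iff algebra_simps)
  qed
qed

text \<open>Each further coproduct splits the first leg, so the induction has to leave a map
  \<open>g\<close> on that leg free: splitting the head into \<open>c\<close> and \<open>d\<close>
  replaces \<open>g\<close> by \<open>conv g (\<lambda>x. x)\<close>, and the induction hypothesis
  is used at this new map. For this the list \<open>xss\<close> must be the same for all
  \<open>g\<close>.\<close>

lemma iter_comult_list:
  assumes "x \<in> X"
  shows "\<exists>xss. (\<forall>xs\<in>set xss. length xs = Suc n \<and> set xs \<subseteq> X) \<and>
    iter_comult H (Suc n) x = (\<Sum>xs\<leftarrow>xss. pure s xs) \<and>
    (\<forall>g. endo g \<longrightarrow> (\<Sum>xs\<leftarrow>xss. g (hd xs) \<odot> foldr (\<odot>) (tl xs) \<one>) =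
      ((\<lambda>f. conv f (\<lambda>x. x)) ^^ n) g x)"
proof (induction n)
  case 0
  show ?case
    by (rule exI[of _ "[[x]]"]) (use assms in \<open>auto intro: one_right\<close>)
next
  case (Suc n)
  then obtain xss where len: "\<And>xs. xs \<in> set xss \<Longrightarrow> length xs = Suc n \<and> set xs \<subseteq> X"
    and comult: "iter_comult H (Suc n) x = (\<Sum>xs\<leftarrow>xss. pure s xs)"
    and conv: "\<And>g. endo g \<Longrightarrow> (\<Sum>xs\<leftarrow>xss. g (hd xs) \<odot> foldr (\<odot>) (tl xs) \<one>) =
      ((\<lambda>f. conv f (\<lambda>x. x)) ^^ n) g x"
    by blast
  have hd_tl: "hd xs \<in> X" "set (tl xs) \<subseteq> X" "length (tl xs) = n" if "xs \<in> set xss" for xs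
    using len[OF that] by (cases xs; auto)+
  have closed: "set xs \<subseteq> X \<Longrightarrow> foldr (\<odot>) xs \<one> \<in> X" for xs
    by (induction xs) auto
  define yss where
    "yss = concat (map (\<lambda>xs. map (\<lambda>(c, d). c # d # tl xs) (rep (hd xs))) xss)"
  have sum: "(\<Sum>xs\<leftarrow>yss. F xs) = (\<Sum>xs\<leftarrow>xss. D (hd xs) (\<lambda>c d. F (c # d # tl xs)))"
    for F :: "'h list \<Rightarrow> 'w::comm_monoid_add"
    by (simp add: yss_def sum_list_concat_map D_def o_def split_def)
  have "iter_comult H (Suc (Suc n)) x = lift s (replicate (Suc n) X)
      (\<lambda>xs. tprod 2 (hcomult H (hd xs)) (pure s (tl xs))) (\<Sum>xs\<leftarrow>xss. pure s xs)"
    by (simp flip: comult)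
  also have "\<dots> = (\<Sum>xs\<leftarrow>xss. tprod 2 (hcomult H (hd xs)) (pure s (tl xs)))"
    using lift_list[OF vector_space_tscale multilinear_comult_hd, of xss "\<lambda>xs. xs" n] len by simp
  also have "\<dots> = (\<Sum>xs\<leftarrow>xss. D (hd xs) (\<lambda>c d. pure s (c # d # tl xs)))"
  proof (intro arg_cong[of _ _ sum_list] map_cong refl)
    fix xs assume "xs \<in> set xss"
    then have "hcomult H (hd xs) = (\<Sum>(c, d)\<leftarrow>rep (hd xs). pure s [c, d])"
      using hd_tl comult_rep by (simp add: D_def)
    then show "tprod 2 (hcomult H (hd xs)) (pure s (tl xs))
        = D (hd xs) (\<lambda>c d. pure s (c # d # tl xs))"
      using tprod_pure[of "[_, _]" s]
      by (simp add: tprod_sum_list_left D_def split_def eval_nat_numeral)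
  qed
  also have "\<dots> = (\<Sum>xs\<leftarrow>yss. pure s xs)"
    by (simp add: sum)
  finally have 1: "iter_comult H (Suc (Suc n)) x = (\<Sum>xs\<leftarrow>yss. pure s xs)" .
  have 2: "(\<Sum>xs\<leftarrow>yss. g (hd xs) \<odot> foldr (\<odot>) (tl xs) \<one>)
      = ((\<lambda>f. conv f (\<lambda>x. x)) ^^ Suc n) g x" if g: "endo g" for g
  proof -
    have "(\<Sum>xs\<leftarrow>yss. g (hd xs) \<odot> foldr (\<odot>) (tl xs) \<one>)
        = (\<Sum>xs\<leftarrow>xss. D (hd xs) (\<lambda>c d. g c \<odot> (d \<odot> foldr (\<odot>) (tl xs) \<one>)))"
      by (simp add: sum)
    also have "\<dots> = (\<Sum>xs\<leftarrow>xss. conv g (\<lambda>x. x) (hd xs) \<odot> foldr (\<odot>) (tl xs) \<one>)"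
    proof (intro arg_cong[of _ _ sum_list] map_cong refl)
      fix xs assume xs: "xs \<in> set xss"
      let ?r = "foldr (\<odot>) (tl xs) \<one>"
      have r: "?r \<in> X" by (rule closed) (rule hd_tl[OF xs])
      have "conv g (\<lambda>x. x) (hd xs) \<odot> ?r = D (hd xs) (\<lambda>c d. g c \<odot> d \<odot> ?r)"
        unfolding conv_def
        by (rule lin_D_apply[where f = "\<lambda>y. y \<odot> ?r"])
           (use r g hd_tl[OF xs] in \<open>auto intro: lin_mult_left\<close>)
      also have "\<dots> = D (hd xs) (\<lambda>c d. g c \<odot> (d \<odot> ?r))"
        by (rule D_cong) (use r g hd_tl[OF xs] in \<open>auto intro: mult_assoc\<close>)
      finally show "D (hd xs) (\<lambda>c d. g c \<odot> (d \<odot> ?r)) = conv g (\<lambda>x. x) (hd xs) \<odot> ?r" ..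
    qed
    also have "\<dots> = ((\<lambda>f. conv f (\<lambda>x. x)) ^^ n) (conv g (\<lambda>x. x)) x"
      by (rule conv) (intro endo_conv g endo_id)
    finally show ?thesis by (simp only: funpow_Suc_right o_apply)
  qed
  have 3: "length xs = Suc (Suc n) \<and> set xs \<subseteq> X" if xs: "xs \<in> set yss" for xs
  proof -
    obtain ys c d where "ys \<in> set xss" "(c, d) \<in> set (rep (hd ys))" "xs = c # d # tl ys"
      using xs by (auto simp: yss_def)
    then show ?thesis
      using hd_tl[of ys] rep_X[of "hd ys" c d] by auto
  qed
  show ?case using 1 2 3 by blast
qed

lemma iter_mult_iter_comult:
  assumes "x \<in> X"
  shows "iter_mult H (Suc n) (iter_comult H (Suc n) x) = ((\<lambda>f. conv f (\<lambda>x. x)) ^^ n) (\<lambda>x. x) x"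
proof -
  obtain xss where len: "\<And>xs. xs \<in> set xss \<Longrightarrow> length xs = Suc n \<and> set xs \<subseteq> X"
    and comult: "iter_comult H (Suc n) x = (\<Sum>xs\<leftarrow>xss. pure s xs)"
    and conv: "\<And>g. endo g \<Longrightarrow> (\<Sum>xs\<leftarrow>xss. g (hd xs) \<odot> foldr (\<odot>) (tl xs) \<one>) =
      ((\<lambda>f. conv f (\<lambda>x. x)) ^^ n) g x"
    using iter_comult_list[OF assms, of n] by blast
  have "iter_mult H (Suc n) (iter_comult H (Suc n) x) = (\<Sum>xs\<leftarrow>xss. foldr (\<odot>) xs \<one>)"
    unfolding comult iter_mult_def
    using lift_list[OF vs(1) multilinear_foldr_mult, of xss "\<lambda>xs. xs" "Suc n"] len by simp
  also have "\<dots> = (\<Sum>xs\<leftarrow>xss. hd xs \<odot> foldr (\<odot>) (tl xs) \<one>)"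
    by (intro arg_cong[of _ _ sum_list] map_cong refl)
       (use len in \<open>metis Zero_not_Suc foldr.simps(2) list.exhaust_sel list.size(3) o_apply\<close>)
  finally show ?thesis
    using conv[OF endo_id] by simp
qed

end

section \<open>Hopf algebras\<close>

locale hopf =
  fixes H :: "('k::field, 'h::ab_group_add) hopf_data" and S :: "'h \<Rightarrow> 'h"
  assumes bialgebra: "bialgebra H" and antipode: "is_antipode H S"

sublocale hopf \<subseteq> prebialgebra
  using bialgebra by unfold_locales (auto simp: bialgebra_def coalgebra_axioms_def)

context hopf
begin

section \<open>The Hopf algebra axioms in Sweedler form\<close>

lemma lin_counit: "lin (*) \<epsilon>"
  using bialgebra by (auto simp: lin_def vs bialgebra_def coalgebra_axioms_def)

lemma counit_one [simp]: "\<epsilon> \<one> = 1"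
  and counit_mult [simp]: "x \<in> X \<Longrightarrow> y \<in> X \<Longrightarrow> \<epsilon> (x \<odot> y) = \<epsilon> x * \<epsilon> y"
  using bialgebra by (auto simp: bialgebra_def)

lemma lin_comult: "lin tscale (hcomult H)"
  by (rule linI) (auto simp: comult_add comult_scale vector_space_tscale)

lemma lin_pure: "lin tscale (\<lambda>x. pure s [x])"
  using pure_update[of 0 "[0]" s]
  by (intro linI) (auto simp: vector_space_tscale)

lemma lin_counit_fun: "lin s f \<Longrightarrow> (\<And>x. x \<in> X \<Longrightarrow> f x \<in> X) \<Longrightarrow> lin (*) (\<lambda>x. \<epsilon> (f x))"
  by (rule lin_compose[OF lin_counit])

lemma endo_S: "endo S"
  using antipode by (auto simp: endo_def lin_def vs is_antipode_def)

lemma S_X [simp, intro]: "x \<in> X \<Longrightarrow> S x \<in> X"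
  using endo_S by blast

lemma lin_S_fun: "lin s f \<Longrightarrow> (\<And>x. x \<in> X \<Longrightarrow> f x \<in> X) \<Longrightarrow> lin s (\<lambda>x. S (f x))"
  by (rule endo_lin_fun[OF endo_S])

lemmas lin_rules = lin_intros lin_counit_fun lin_S_fun S_X

lemma D_counit_left:
  assumes "x \<in> X" "lin s' f"
  shows "D x (\<lambda>a b. s' (\<epsilon> a) (f b)) = f x"
proof -
  have "bilin s (\<lambda>a b. s (\<epsilon> a) b)"
    by (intro bilinI lin_const_scale[OF lin_id] lin_scale_const vs lin_counit)
  from D_lift[OF assms(1) this] have "D x (\<lambda>a b. s (\<epsilon> a) b) = x"
    using assms(1) bialgebra by (simp add: bialgebra_def coalgebra_axioms_def)
  then have "f x = D x (\<lambda>a b. f (s (\<epsilon> a) b))"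
    using lin_D_apply[OF assms(2,1), of "\<lambda>a b. s (\<epsilon> a) b"] by simp
  also have "\<dots> = D x (\<lambda>a b. s' (\<epsilon> a) (f b))"
    using assms(1) by (rule D_cong) (rule lin_scale[OF assms(2)])
  finally show ?thesis ..
qed

lemma D_counit_right:
  assumes "x \<in> X" "lin s' f"
  shows "D x (\<lambda>a b. s' (\<epsilon> b) (f a)) = f x"
proof -
  have "bilin s (\<lambda>a b. s (\<epsilon> b) a)"
    by (intro bilinI lin_const_scale[OF lin_id] lin_scale_const vs lin_counit)
  from D_lift[OF assms(1) this] have "D x (\<lambda>a b. s (\<epsilon> b) a) = x"
    using assms(1) bialgebra by (simp add: bialgebra_def coalgebra_axioms_def)
  then have "f x = D x (\<lambda>a b. f (s (\<epsilon> b) a))"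
    using lin_D_apply[OF assms(2,1), of "\<lambda>a b. s (\<epsilon> b) a"] by simp
  also have "\<dots> = D x (\<lambda>a b. s' (\<epsilon> b) (f a))"
    using assms(1) by (rule D_cong) (rule lin_scale[OF assms(2)])
  finally show ?thesis ..
qed

lemma D_antipode_left:
  assumes "x \<in> X" shows "D x (\<lambda>a b. S a \<odot> b) = s (\<epsilon> x) \<one>"
proof -
  have "bilin s (\<lambda>a b. S a \<odot> b)"
    by (intro lin_rules)
  from D_lift[OF assms this] show ?thesis
    using assms antipode by (simp add: is_antipode_def)
qed

lemma D_antipode_right:
  assumes "x \<in> X" shows "D x (\<lambda>a b. a \<odot> S b) = s (\<epsilon> x) \<one>"
proof -
  have "bilin s (\<lambda>a b. a \<odot> S b)"
    by (intro lin_rules)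
  from D_lift[OF assms this] show ?thesis
    using assms antipode by (simp add: is_antipode_def)
qed

text \<open>The axiom equates two tensors of degree 3. With \<open>ls\<close> and \<open>ls'\<close>
  listing the triples of its two sides, the map induced by the trilinear \<open>F\<close> turns that
  equation into the claim.\<close>

lemma D_coassoc:
  assumes "x \<in> X" "trilin s' F"
  shows "D x (\<lambda>a b. D a (\<lambda>c d. F c d b)) = D x (\<lambda>a b. D b (\<lambda>c d. F a c d))"
proof -
  define ls where "ls = concat (map (\<lambda>(a, b). map (\<lambda>(c, d). (c, d, b)) (rep a)) (rep x))"
  define ls' where "ls' = concat (map (\<lambda>(a, b). map (\<lambda>(c, d). (a, c, d)) (rep b)) (rep x))"
  have ls: "(\<Sum>(a, b, c)\<leftarrow>ls. G a b c) = D x (\<lambda>a b. D a (\<lambda>c d. G c d b))"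
    and ls': "(\<Sum>(a, b, c)\<leftarrow>ls'. G a b c) = D x (\<lambda>a b. D b (\<lambda>c d. G a c d))"
    for G :: "'h \<Rightarrow> 'h \<Rightarrow> 'h \<Rightarrow> 'w::comm_monoid_add"
    by (simp_all add: ls_def ls'_def D_def sum_list_concat_map o_def split_def)
  have sets: "set ls \<subseteq> X \<times> X \<times> X" "set ls' \<subseteq> X \<times> X \<times> X"
    using rep_X[OF assms(1)] by (fastforce simp: ls_def ls'_def dest: rep_X)+
  have bil: "bilin tscale (\<lambda>a b. tprod 2 (hcomult H a) (pure s [b]))"
    "bilin tscale (\<lambda>a b. tprod 1 (pure s [a]) (hcomult H b))"
    using lin_pure lin_comult
    by (auto simp: bilin_def lin_def vector_space_tscale tprod_def tscale_def fun_eq_iff algebra_simps)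
  have left: "tprod 2 (hcomult H a) (pure s [b]) = D a (\<lambda>c d. pure s [c, d, b])"
    and right: "tprod 1 (pure s [b]) (hcomult H a) = D a (\<lambda>c d. pure s [b, c, d])"
    if "a \<in> X" for a b
    using comult_rep[OF that] tprod_pure[of "[_, _]" s "[_]"] tprod_pure[of "[_]" s "[_, _]"]
    by (simp_all add: D_def tprod_sum_list_left tprod_sum_list_right split_def eval_nat_numeral)
  have "D x (\<lambda>a b. tprod 2 (hcomult H a) (pure s [b]))
      = D x (\<lambda>a b. tprod 1 (pure s [a]) (hcomult H b))"
    using D_lift[OF assms(1) bil(1)] D_lift[OF assms(1) bil(2)] assms(1) bialgebra
    by (auto simp: bialgebra_def coalgebra_axioms_def)
  also have "D x (\<lambda>a b. tprod 2 (hcomult H a) (pure s [b]))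
      = (\<Sum>(a, b, c)\<leftarrow>ls. pure s [a, b, c])"
    unfolding ls by (rule D_cong[OF assms(1)]) (rule left)
  also have "D x (\<lambda>a b. tprod 1 (pure s [a]) (hcomult H b))
      = (\<Sum>(a, b, c)\<leftarrow>ls'. pure s [a, b, c])"
    unfolding ls' by (rule D_cong[OF assms(1)]) (rule right)
  finally have "(\<Sum>(a, b, c)\<leftarrow>ls. pure s [a, b, c]) = (\<Sum>(a, b, c)\<leftarrow>ls'. pure s [a, b, c])" .
  then have "(\<Sum>(a, b, c)\<leftarrow>ls. F a b c) = (\<Sum>(a, b, c)\<leftarrow>ls'. F a b c)"
    using lift_triples[OF assms(2) sets(1)] lift_triples[OF assms(2) sets(2)] by simp
  then show ?thesis
    unfolding ls ls' .
qed

lemma represents_mult: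
  assumes ls: "represents ls x" "represents ls' y" and xy: "x \<in> X" "y \<in> X"
  shows "represents (map (\<lambda>((a, b), (c, d)). (a \<odot> c, b \<odot> d)) (List.product ls ls')) (x \<odot> y)"
proof -
  let ?f = "\<lambda>xs. pure s [xs ! 0 \<odot> xs ! 2, xs ! 1 \<odot> xs ! 3]"
  let ?g = "\<lambda>((a, b), (c, d)). [a, b, c, d]"
  have prod: "(\<Sum>i\<leftarrow>List.product ls ls'. G i) = (\<Sum>i\<leftarrow>ls. \<Sum>j\<leftarrow>ls'. G (i, j))"
    for G :: "_ \<Rightarrow> 'w::comm_monoid_add"
    by (induction ls) (auto simp: o_def)
  have bil: "lin tscale (\<lambda>x. pure s [f x, b])" "lin tscale (\<lambda>x. pure s [b, f x])"
    if "lin s f" for f b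
    using that pure_update[of 0 "[0, b]" s] pure_update[of 1 "[b, 0]" s]
    by (auto intro!: linI vector_space_tscale simp: lin_add lin_scale)
  have "multilinear_on s tscale (replicate 4 X) ?f"
  proof (rule multilinear_on_replicateI[OF vector_space_tscale])
    fix xs and i :: nat
    assume "length xs = 4" "set xs \<subseteq> X" "i < 4"
    then show "lin tscale (\<lambda>x. ?f (xs[i := x]))"
      by (auto simp: less_Suc_eq length_Suc_conv eval_nat_numeral
          intro!: bil lin_mult_left lin_mult_right)
  qed
  moreover have "length (?g i) = 4 \<and> set (?g i) \<subseteq> X" if "i \<in> set (List.product ls ls')" for i
    using ls that by (auto simp: represents_def)
  ultimately have "lift s (replicate 4 X) ?f (\<Sum>i\<leftarrow>List.product ls ls'. pure s (?g i))
      = (\<Sum>i\<leftarrow>List.product ls ls'. ?f (?g i))"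
    by (rule lift_list[OF vector_space_tscale])
  moreover have "tprod 2 (hcomult H x) (hcomult H y)
      = (\<Sum>i\<leftarrow>List.product ls ls'. pure s (?g i))"
    using ls tprod_pure[of "[_, _]" s "[_, _]"] unfolding prod represents_def
    by (subst sum_list_swap)
       (simp add: tprod_sum_list_left tprod_sum_list_right split_def eval_nat_numeral)
  moreover have "hcomult H (x \<odot> y) = tmult H (hcomult H x) (hcomult H y)"
    using xy bialgebra by (auto simp: bialgebra_def)
  ultimately have "hcomult H (x \<odot> y) = (\<Sum>i\<leftarrow>List.product ls ls'. ?f (?g i))"
    by (simp add: tmult_def)
  moreover have "a \<odot> c \<in> X \<and> b \<odot> d \<in> X" if "(a, b) \<in> set ls" "(c, d) \<in> set ls'" for a b c d
    using ls that by (auto simp: represents_def subset_iff)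
  ultimately show ?thesis
    by (auto simp: represents_def o_def split_def eval_nat_numeral)
qed

lemma D_mult:
  assumes "x \<in> X" "y \<in> X" "bilin s' F"
  shows "D (x \<odot> y) F = D x (\<lambda>a b. D y (\<lambda>c d. F (a \<odot> c) (b \<odot> d)))"
proof -
  have prod: "(\<Sum>i\<leftarrow>List.product ls ls'. G i) = (\<Sum>i\<leftarrow>ls. \<Sum>j\<leftarrow>ls'. G (i, j))"
    for G :: "_ \<Rightarrow> 'w::comm_monoid_add" and ls ls'
    by (induction ls) (auto simp: o_def)
  show ?thesis
    using D_eq[OF represents_mult[OF represents_rep represents_rep] _ assms(3), of x y] assms
    by (simp add: prod o_def split_def D_def)
qed

lemma D_one: "bilin s' F \<Longrightarrow> D \<one> F = F \<one> \<one>"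
  using D_eq[of "[(\<one>, \<one>)]" \<one> s' F] bialgebra
  by (simp add: represents_def bialgebra_def)

end


section \<open>Convolution powers of the identity\<close>

text \<open>Recovers the defining property of \<open>exp0\<close> and of \<open>loewy_length\<close>
  from the fact that their value is finite: the index set is then nonempty, and an infimum of
  naturals is attained.\<close>

lemma INF_enat_attained:
  assumes "(INF n\<in>A. enat n) = enat N"
  shows "N \<in> A"
proof -
  have "A \<noteq> {}"
    using assms by (auto simp: top_enat_def)
  then have "Inf (enat ` A) \<in> enat ` A"
    by (auto simp: Inf_enat_def intro: LeastI)
  then show ?thesis
    using assms by auto
qed

context hopf
begin

text \<open>The n-th convolution power of the identity. Starting at the unit
  \<open>u \<epsilon>\<close> of convolution makes the power 0 available, as division with remainder
  and polynomials require.\<close>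

definition pw :: "nat \<Rightarrow> 'h \<Rightarrow> 'h" where
  "pw n = ((\<lambda>f. conv f (\<lambda>x. x)) ^^ n) (\<lambda>x. s (\<epsilon> x) \<one>)"

lemma pw_0: "pw 0 x = s (\<epsilon> x) \<one>"
  and pw_Suc: "pw (Suc n) x = conv (pw n) (\<lambda>x. x) x"
  by (simp_all add: pw_def)

lemma endo_pw: "endo (pw n)"
proof (induction n)
  case 0
  show ?case
    using lin_counit by (auto simp: pw_def intro!: endoI lin_scale_const vs)
next
  case (Suc n)
  then show ?case
    by (simp add: pw_def endo_conv endo_id)
qed

lemma pw_X [simp, intro]: "x \<in> X \<Longrightarrow> pw n x \<in> X"
  using endo_pw by blast

lemma conv_pw_0_left: "endo f \<Longrightarrow> x \<in> X \<Longrightarrow> conv (pw 0) f x = f x"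
  using D_counit_left[of x s f] D_cong[of x "\<lambda>a b. s (\<epsilon> a) \<one> \<odot> f b" "\<lambda>a b. s (\<epsilon> a) (f b)"]
  by (auto simp: conv_def pw_0 mult_scale_left endo_lin endo_X)

lemma conv_pw_0_right: "endo f \<Longrightarrow> x \<in> X \<Longrightarrow> conv f (pw 0) x = f x"
  using D_counit_right[of x s f] D_cong[of x "\<lambda>a b. f a \<odot> s (\<epsilon> b) \<one>" "\<lambda>a b. s (\<epsilon> b) (f a)"]
  by (auto simp: conv_def pw_0 mult_scale_right endo_lin endo_X)

lemma pw_1: "x \<in> X \<Longrightarrow> pw (Suc 0) x = x"
  by (simp add: pw_Suc conv_pw_0_left endo_id)

lemma conv_assoc:
  assumes "endo f" "endo g" "endo h" "x \<in> X"
  shows "conv (conv f g) h x = conv f (conv g h) x"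
proof -
  note closed = endo_X[OF assms(1)] endo_X[OF assms(2)] endo_X[OF assms(3)]
  have "conv (conv f g) h x = D x (\<lambda>a b. D a (\<lambda>c d. f c \<odot> g d \<odot> h b))"
    unfolding conv_def
    by (rule D_cong[OF assms(4)], rule lin_D_apply[where f = "\<lambda>y. y \<odot> _"])
       (auto intro!: lin_mult_left closed)
  also have "\<dots> = D x (\<lambda>a b. D b (\<lambda>c d. f a \<odot> g c \<odot> h d))"
    by (rule D_coassoc[OF assms(4)], rule trilinI)
       (auto intro!: lin_mult_left lin_mult_right closed assms(1-3)[THEN endo_lin])
  also have "\<dots> = D x (\<lambda>a b. D b (\<lambda>c d. f a \<odot> (g c \<odot> h d)))"
    by (rule D_cong[OF assms(4)], rule D_cong) (auto intro!: mult_assoc closed)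
  also have "\<dots> = conv f (conv g h) x"
    unfolding conv_def
    by (rule sym, rule D_cong[OF assms(4)], rule lin_D_apply[where f = "\<lambda>y. _ \<odot> y"])
       (auto intro!: lin_mult_right closed)
  finally show ?thesis .
qed

lemma pw_add: "x \<in> X \<Longrightarrow> pw (m + n) x = conv (pw m) (pw n) x"
proof (induction n arbitrary: x)
  case 0
  then show ?case by (simp add: conv_pw_0_right endo_pw)
next
  case (Suc n)
  have "pw (m + Suc n) x = conv (conv (pw m) (pw n)) (\<lambda>x. x) x"
    using Suc by (auto simp: pw_Suc intro: conv_cong)
  also have "\<dots> = conv (pw m) (conv (pw n) (\<lambda>x. x)) x"
    by (intro conv_assoc endo_pw endo_id Suc)
  finally show ?case
    using Suc by (auto simp: pw_Suc intro: conv_cong)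
qed

lemma funpow_conv_cong:
  "(\<And>y. y \<in> X \<Longrightarrow> f y = g y) \<Longrightarrow> x \<in> X \<Longrightarrow>
    ((\<lambda>f. conv f (\<lambda>x. x)) ^^ n) f x = ((\<lambda>f. conv f (\<lambda>x. x)) ^^ n) g x"
  by (induction n arbitrary: x) (auto intro: conv_cong)

lemma funpow_conv_id: "x \<in> X \<Longrightarrow> ((\<lambda>f. conv f (\<lambda>x. x)) ^^ n) (\<lambda>x. x) x = pw (Suc n) x"
  unfolding pw_def funpow_Suc_right o_apply
  by (rule funpow_conv_cong) (auto simp: pw_Suc[symmetric] pw_1 simp flip: pw_def[of 0, simplified])

lemma iter_mult_iter_comult_pw:
  "x \<in> X \<Longrightarrow> n \<ge> 1 \<Longrightarrow> iter_mult H n (iter_comult H n x) = pw n x"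
  using iter_mult_iter_comult[of x "n - 1"] funpow_conv_id[of x "n - 1"] by simp

text \<open>The exponent of a Hopf subalgebra is defined by \<open>lift\<close> over
  \<open>K\<close>, not over \<open>X\<close>. A representation of a coproduct with legs in
  \<open>K\<close> is also one with legs in \<open>X\<close>, so the Sweedler sums of both
  structures agree on bilinear maps, and hence so do the convolution powers.\<close>

lemma iter_mult_iter_comult_restrict:
  assumes K: "subcoalgebra H K" "subalgebra H K" and "x \<in> K" "n \<ge> 1"
  shows "iter_mult (restrict_hopf H K) n (iter_comult (restrict_hopf H K) n x) = pw n x"
proof -
  let ?R = "restrict_hopf H K"
  have KX: "K \<subseteq> X" using K by (auto simp: subcoalgebra_def)
  interpret R: prebialgebra ?R
  proof
    show "linear_space ?R" "algebra_axioms ?R"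
      using K V.vector_space_axioms algebra KX
      by (auto simp: linear_space_def subcoalgebra_def subalgebra_def algebra_axioms_def
          restrict_hopf_def subset_iff)
  qed (use K KX in \<open>auto simp: restrict_hopf_def subcoalgebra_def comult_add comult_scale subset_iff\<close>)
  have R [simp]: "hspace ?R = K" "hscale ?R = s" "hmult ?R = (\<odot>)" "hcomult ?R = hcomult H"
    by (simp_all add: restrict_hopf_def)
  have D: "R.D y F = D y F" if "y \<in> K" "bilin s F" for y and F :: "'h \<Rightarrow> 'h \<Rightarrow> 'h"
  proof -
    have "represents (R.rep y) y"
      using R.represents_rep[of y] that(1) KX by (auto simp: R.represents_def represents_def)
    from D_eq[OF this _ that(2)] show ?thesis
      using that(1) KX by (auto simp: R.D_def)
  qed
  have "R.endo (((\<lambda>f. R.conv f (\<lambda>x. x)) ^^ n) (\<lambda>x. x)) \<and>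
      (\<forall>y\<in>K. ((\<lambda>f. R.conv f (\<lambda>x. x)) ^^ n) (\<lambda>x. x) y = pw (Suc n) y)" for n
  proof (induction n)
    case 0
    then show ?case using KX by (auto simp: pw_1 R.endo_id)
  next
    case (Suc n)
    let ?f = "((\<lambda>f. R.conv f (\<lambda>x. x)) ^^ n) (\<lambda>x. x)"
    have "R.conv ?f (\<lambda>x. x) y = conv (pw (Suc n)) (\<lambda>x. x) y" if "y \<in> K" for y
    proof -
      have "R.conv ?f (\<lambda>x. x) y = R.D y (\<lambda>a b. pw (Suc n) a \<odot> b)"
        unfolding R.conv_def[of ?f] by (rule R.D_cong) (use that Suc in auto)
      also have "\<dots> = conv (pw (Suc n)) (\<lambda>x. x) y"
        unfolding conv_def by (rule D[OF that]) (intro bilin_endos endo_pw endo_id)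
      finally show ?thesis .
    qed
    then show ?case
      using Suc R.endo_conv R.endo_id by (simp add: pw_Suc)
  qed
  then show ?thesis
    using R.iter_mult_iter_comult[of x "n - 1"] assms by simp
qed

section \<open>The exponent as the order of the identity\<close>

lemma exp0_eq_enatD:
  assumes "exp0 H = enat n"
  shows "n \<ge> 1" "x \<in> X \<Longrightarrow> pw n x = s (\<epsilon> x) \<one>"
  using INF_enat_attained[OF assms[unfolded exp0_def]] iter_mult_iter_comult_pw by auto

text \<open>The least exponent \<open>e\<close> is a period of \<open>pw\<close>, so the remainder
  of \<open>n\<close> modulo \<open>e\<close> is again an exponent unless it is 0; minimality of
  \<open>e\<close> leaves only 0.\<close>

lemma exp0_dvd:
  assumes n: "n \<ge> 1" "\<And>x. x \<in> X \<Longrightarrow> pw n x = s (\<epsilon> x) \<one>"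
  shows "\<exists>e. exp0 H = enat e \<and> e dvd n"
proof -
  have le: "exp0 H \<le> enat m" if "m \<ge> 1" "\<And>x. x \<in> X \<Longrightarrow> pw m x = s (\<epsilon> x) \<one>" for m
    unfolding exp0_def by (rule INF_lower) (use that iter_mult_iter_comult_pw in auto)
  obtain e where e: "exp0 H = enat e"
    using le[OF n] by (cases "exp0 H") auto
  note eD = exp0_eq_enatD[OF e]
  have period: "pw (e + m) x = pw m x" if "x \<in> X" for m x
  proof -
    have "pw (e + m) x = conv (pw 0) (pw m) x"
      unfolding pw_add[OF that] by (rule conv_cong) (use that eD(2) in \<open>auto simp: pw_0\<close>)
    then show ?thesis
      using conv_pw_0_left[OF endo_pw that] by simp
  qed
  have "pw (e * k + m) x = pw m x" if "x \<in> X" for k m x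
    using period[OF that] by (induction k) (simp_all add: add.assoc)
  from this[of _ "n div e" "n mod e"] have "pw (n mod e) x = s (\<epsilon> x) \<one>" if "x \<in> X" for x
    using n(2) that by simp
  then have "n mod e = 0"
    using le[of "n mod e"] e eD(1) by (cases "n mod e = 0") (auto simp: not_less[symmetric])
  then show ?thesis
    using e by auto
qed

section \<open>Polynomials in the identity\<close>

text \<open>The algebra homomorphism from polynomials to the convolution algebra that sends the
  variable to the identity. Through it, calculations with powers of the identity take place in the
  commutative ring \<open>'k poly\<close>.\<close>

definition ev :: "'k poly \<Rightarrow> 'h \<Rightarrow> 'h" where
  "ev P x = (\<Sum>i\<le>degree P. s (coeff P i) (pw i x))"

lemma ev_bound: "degree P \<le> n \<Longrightarrow> ev P x = (\<Sum>i\<le>n. s (coeff P i) (pw i x))"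
  unfolding ev_def by (rule sum.mono_neutral_left) (auto simp: coeff_eq_0)

lemma endo_ev: "endo (ev P)"
proof (rule endoI)
  show "lin s (ev P)"
    unfolding ev_def by (intro lin_sum_fun vs lin_const_scale endo_lin endo_pw)
  show "ev P x \<in> X" if "x \<in> X" for x
    unfolding ev_def using that by (auto intro: V.subspace_sum[OF subspace_X])
qed

lemma ev_add: "ev (P + Q) x = ev P x + ev Q x"
proof -
  let ?n = "max (degree P) (degree Q)"
  have "degree (P + Q) \<le> ?n"
    by (rule degree_add_le_max)
  then show ?thesis
    by (simp add: ev_bound[of _ ?n] V.scale_left_distrib sum.distrib)
qed

lemma ev_smult: "ev (smult c P) x = s c (ev P x)"
  by (simp add: ev_bound[of "smult c P" "degree P"] ev_def degree_smult_le V.scale_sum_right)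

lemma ev_pCons_0:
  assumes "x \<in> X" shows "ev (pCons 0 P) x = conv (\<lambda>x. x) (ev P) x"
proof -
  have "ev (pCons 0 P) x = (\<Sum>i\<le>degree P. s (coeff P i) (pw (Suc i) x))"
    unfolding ev_bound[OF degree_pCons_le] sum.atMost_Suc_shift by simp
  also have "\<dots> = (\<Sum>i\<le>degree P. s (coeff P i) (D x (\<lambda>a b. a \<odot> pw i b)))"
  proof (rule sum.cong[OF refl])
    fix i
    have "pw (Suc i) x = conv (pw (Suc 0)) (pw i) x"
      using pw_add[OF assms, of "Suc 0" i] by simp
    also have "\<dots> = D x (\<lambda>a b. a \<odot> pw i b)"
      unfolding conv_def by (rule D_cong[OF assms]) (simp add: pw_1)
    finally show "s (coeff P i) (pw (Suc i) x) = s (coeff P i) (D x (\<lambda>a b. a \<odot> pw i b))" by simp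
  qed
  also have "\<dots> = D x (\<lambda>a b. \<Sum>i\<le>degree P. s (coeff P i) (a \<odot> pw i b))"
  proof -
    have "s c (D x (\<lambda>a b. a \<odot> pw i b)) = D x (\<lambda>a b. s c (a \<odot> pw i b))" for c i
      by (rule lin_D_apply) (use assms in \<open>auto intro: lin_const_scale\<close>)
    moreover have "(\<Sum>i\<in>I. D x (F i)) = D x (\<lambda>a b. \<Sum>i\<in>I. F i a b)"
      for I :: "nat set" and F :: "nat \<Rightarrow> 'h \<Rightarrow> 'h \<Rightarrow> 'h"
      by (induction I rule: infinite_finite_induct) (simp_all add: D_zero D_plus)
    ultimately show ?thesis by simp
  qed
  also have "\<dots> = conv (\<lambda>x. x) (ev P) x"
    unfolding conv_def
  proof (rule D_cong[OF assms])
    fix a b assume "a \<in> X" "b \<in> X"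
    then have "a \<odot> (\<Sum>i\<in>I. s (c i) (pw i b)) = (\<Sum>i\<in>I. s (c i) (a \<odot> pw i b))"
      for I :: "nat set" and c
      by (induction I rule: infinite_finite_induct)
         (auto simp: mult_add_right mult_scale_right V.subspace_sum[OF subspace_X]
           lin_0[OF lin_mult_right[OF lin_id]])
    then show "(\<Sum>i\<le>degree P. s (coeff P i) (a \<odot> pw i b)) = a \<odot> ev P b"
      by (simp add: ev_def)
  qed
  finally show ?thesis .
qed

text \<open>Induction on \<open>P\<close>, written as c + t P. Multiplying by t convolves with the
  identity on the left, and associativity of convolution moves this factor past
  \<open>ev Q\<close>.\<close>

lemma ev_mult:
  assumes "x \<in> X" shows "ev (P * Q) x = conv (ev P) (ev Q) x"
  using assms
proof (induction P arbitrary: x)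
  case 0
  then show ?case
    using D_cong[of x "\<lambda>a b. 0 \<odot> ev Q b" "\<lambda>a b. 0"] endo_X[OF endo_ev] mult_scale_left[of 0 _ 0]
    by (simp add: ev_def conv_def D_zero)
next
  case (pCons c P)
  have split: "ev (pCons c P) y = s c (pw 0 y) + conv (\<lambda>x. x) (ev P) y" if "y \<in> X" for y
  proof -
    have "ev (pCons c P) y = ev ([:c:] + pCons 0 P) y" by simp
    also have "\<dots> = ev [:c:] y + ev (pCons 0 P) y" by (rule ev_add)
    finally show ?thesis
      using ev_pCons_0[OF that] by (simp add: ev_def)
  qed
  have "ev (pCons c P * Q) x = s c (ev Q x) + conv (\<lambda>x. x) (ev (P * Q)) x"
    using ev_pCons_0[OF pCons.prems] by (simp add: ev_add ev_smult)
  also have "conv (\<lambda>x. x) (ev (P * Q)) x = conv (\<lambda>x. x) (conv (ev P) (ev Q)) x"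
    using pCons by (intro conv_cong) auto
  also have "\<dots> = conv (conv (\<lambda>x. x) (ev P)) (ev Q) x"
    by (rule conv_assoc[symmetric]) (intro endo_id endo_ev pCons.prems)+
  also have "s c (ev Q x) = s c (conv (pw 0) (ev Q) x)"
    using conv_pw_0_left[OF endo_ev pCons.prems] by simp
  also have "\<dots> = D x (\<lambda>a b. s c (pw 0 a) \<odot> ev Q b)"
  proof -
    have "s c (conv (pw 0) (ev Q) x) = D x (\<lambda>a b. s c (pw 0 a \<odot> ev Q b))"
      unfolding conv_def
      by (rule lin_D_apply) (use pCons.prems in \<open>auto intro: lin_const_scale endo_X endo_ev\<close>)
    also have "\<dots> = D x (\<lambda>a b. s c (pw 0 a) \<odot> ev Q b)"
      by (rule D_cong[OF pCons.prems]) (auto simp: mult_scale_left endo_X[OF endo_ev])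
    finally show ?thesis .
  qed
  also have "D x (\<lambda>a b. s c (pw 0 a) \<odot> ev Q b) + conv (conv (\<lambda>x. x) (ev P)) (ev Q) x
      = conv (ev (pCons c P)) (ev Q) x"
    unfolding conv_def[of _ "ev Q"] D_plus[symmetric]
    by (rule D_cong[OF pCons.prems])
       (auto simp: split mult_add_left endo_X[OF endo_ev] endo_X[OF endo_conv[OF endo_id endo_ev]])
  finally show ?case .
qed

lemma ev_monom: "ev (monom c n) x = s c (pw n x)"
proof -
  have "ev (monom c n) x = (\<Sum>i\<le>n. s (coeff (monom c n) i) (pw i x))"
    by (rule ev_bound) (rule degree_monom_le)
  also have "\<dots> = (\<Sum>i\<in>{n}. s (coeff (monom c n) i) (pw i x))"
    by (rule sum.mono_neutral_right) auto
  finally show ?thesis by simp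
qed

lemma ev_monom_minus_1: "ev (monom 1 n - 1) x = pw n x - s (\<epsilon> x) \<one>"
proof -
  have "ev (monom 1 n) x = ev (monom 1 n - 1) x + ev 1 x"
    using ev_add[of "monom 1 n - 1" 1 x] by simp
  moreover have "ev 1 x = s (\<epsilon> x) \<one>"
    by (simp add: ev_def pw_0)
  ultimately show ?thesis
    by (simp add: ev_monom)
qed

section \<open>The coradical filtration\<close>

lemma coradical_subspace: "V.subspace (coradical H)"
  by (simp add: coradical_def)

lemma coradical_X: "coradical H \<subseteq> X"
  unfolding coradical_def
  by (rule V.span_minimal[OF _ subspace_X])
     (auto simp: simple_subcoalgebra_def subcoalgebra_def)

lemma coradical_filtration_X: "coradical_filtration H n \<subseteq> X"
  using coradical_X by (cases n) auto

text \<open>Split the power as P times P^(n+1) and use the two parts of the coproduct of H_(n+1): on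
  H_0 \<otimes> H the first factor vanishes, on H \<otimes> H_n the second one does by
  induction.\<close>

lemma ev_power_coradical_filtration:
  assumes P: "\<And>x. x \<in> coradical H \<Longrightarrow> ev P x = 0"
  shows "x \<in> coradical_filtration H n \<Longrightarrow> ev (P ^ Suc n) x = 0"
proof (induction n arbitrary: x)
  case 0
  then show ?case using P by simp
next
  case (Suc n)
  let ?K = "coradical H" and ?F = "coradical_filtration H n"
  have x: "x \<in> X"
    using Suc.prems coradical_filtration_X by blast
  obtain t t' where t: "t \<in> tensors s [X, ?F]" "t' \<in> tensors s [?K, X]" "hcomult H x = t + t'"
    using Suc.prems by auto
  obtain ls where ls: "set ls \<subseteq> X \<times> ?F" "t = (\<Sum>(a, b)\<leftarrow>ls. pure s [a, b])"
    using tensors_pairs[OF subspace_X t(1)] by blast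
  obtain ls' where ls': "set ls' \<subseteq> ?K \<times> X" "t' = (\<Sum>(a, b)\<leftarrow>ls'. pure s [a, b])"
    using tensors_pairs[OF coradical_subspace t(2)] by blast
  have rep: "represents (ls @ ls') x"
    using ls ls' t coradical_X coradical_filtration_X[of n] by (auto simp: represents_def)
  have zero: "0 \<odot> y = 0" "y \<odot> 0 = 0" if "y \<in> X" for y
    using that lin_0[OF lin_mult_left[OF lin_id]] lin_0[OF lin_mult_right[OF lin_id]] by auto
  have "D x (\<lambda>a b. ev P a \<odot> ev (P ^ Suc n) b) = D x (\<lambda>a b. 0)"
  proof (rule D_cong_rep[OF rep x bilin_endos[OF endo_ev endo_ev]])
    show "bilin s (\<lambda>a b. 0)"
      by (intro bilinI lin_zero vs)
    fix a b assume "(a, b) \<in> set (ls @ ls')"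
    then consider "a \<in> X" "b \<in> ?F" | "a \<in> ?K" "b \<in> X"
      using ls ls' by auto
    then show "ev P a \<odot> ev (P ^ Suc n) b = 0"
      by cases (use P Suc.IH zero endo_X[OF endo_ev] in auto)
  qed
  then have "conv (ev P) (ev (P ^ Suc n)) x = 0"
    by (simp only: conv_def D_zero)
  then show ?case
    using ev_mult[OF x, of P "P ^ Suc n"] by simp
qed

lemma exp0_dvd_coradical:
  assumes dc: "dual_chevalley H" and p: "CHAR('k) = p" "p > 0"
    and N: "exp0 (restrict_hopf H (coradical H)) = enat N"
    and L: "loewy_length H \<le> enat (p ^ M)"
  shows "\<exists>e. exp0 H = enat e \<and> e dvd N * p ^ M"
proof -
  let ?K = "coradical H" and ?P = "monom 1 N - 1 :: 'k poly"
  have K: "subcoalgebra H ?K" "subalgebra H ?K"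
    using dc by (auto simp: dual_chevalley_def hopf_subalgebra_def)
  have N1: "N \<ge> 1" and NK: "\<And>x. x \<in> ?K \<Longrightarrow> pw N x = s (\<epsilon> x) \<one>"
    using INF_enat_attained[OF N[unfolded exp0_def]] iter_mult_iter_comult_restrict[OF K]
    by (auto simp: restrict_hopf_def)
  obtain l where l: "loewy_length H = enat l"
    using L by (cases "loewy_length H") auto
  have l1: "l \<ge> 1" "coradical_filtration H (l - 1) = X"
    using INF_enat_attained[OF l[unfolded loewy_length_def]] by auto
  have lM: "l \<le> p ^ M" using l L by simp
  \<comment> \<open>As H_(l-1) is everything, \<open>ev_power_coradical_filtration\<close> at l - 1
    gives exactly the power l.\<close>
  have 0: "ev (?P ^ l) x = 0" if "x \<in> X" for x
    using ev_power_coradical_filtration[of ?P x "l - 1"] NK l1 that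
    by (simp add: ev_monom_minus_1 del: power_Suc)
  have nil: "ev (?P ^ (p ^ M)) x = 0" if "x \<in> X" for x
  proof -
    have "ev (?P ^ (p ^ M)) x = conv (ev (?P ^ l)) (ev (?P ^ (p ^ M - l))) x"
      using ev_mult[OF that, of "?P ^ l" "?P ^ (p ^ M - l)"] lM by (simp flip: power_add)
    also have "\<dots> = D x (\<lambda>a b. 0)"
      unfolding conv_def
      by (rule D_cong[OF that])
         (use 0 endo_X[OF endo_ev] lin_0[OF lin_mult_left[OF lin_id]] in auto)
    finally show ?thesis by (simp add: D_zero)
  qed
  \<comment> \<open>Frobenius in \<open>'k poly\<close>: since \<open>?P + 1\<close> is t^N, its
    power p^M gives t^(N p^M) = \<open>?P ^ (p ^ M)\<close> + 1.\<close>
  have "prime p"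
    using p prime_CHAR_semidom[where 'a = 'k] by auto
  moreover have "CHAR('k poly) = p"
    using p by simp
  ultimately have "(?P + 1) ^ (p ^ M) = ?P ^ (p ^ M) + 1 ^ (p ^ M)"
    using freshmans_dream'[where 'a = "'k poly" and x = ?P and y = 1 and n = M] by simp
  then have "?P ^ (p ^ M) = monom 1 (N * p ^ M) - 1"
    by (simp add: monom_power algebra_simps)
  then have "pw (N * p ^ M) x = s (\<epsilon> x) \<one>" if "x \<in> X" for x
    using nil[OF that] by (simp add: ev_monom_minus_1)
  then show ?thesis
    using N1 p by (intro exp0_dvd) auto
qed

end


context hopf
begin

section \<open>The antipode is an antimorphism\<close>

text \<open>Rebrackets a fourfold coproduct so that the two middle legs come from one common
  element, where the antipode or counit axiom can contract them.\<close>

lemma D_coassoc4: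
  assumes x: "x \<in> X"
    and "\<And>a b c. a \<in> X \<Longrightarrow> b \<in> X \<Longrightarrow> c \<in> X \<Longrightarrow> lin s' (\<lambda>x. Q x a b c)"
    and "\<And>a b c. a \<in> X \<Longrightarrow> b \<in> X \<Longrightarrow> c \<in> X \<Longrightarrow> lin s' (\<lambda>x. Q a x b c)"
    and "\<And>a b c. a \<in> X \<Longrightarrow> b \<in> X \<Longrightarrow> c \<in> X \<Longrightarrow> lin s' (\<lambda>x. Q a b x c)"
    and "\<And>a b c. a \<in> X \<Longrightarrow> b \<in> X \<Longrightarrow> c \<in> X \<Longrightarrow> lin s' (\<lambda>x. Q a b c x)"
  shows "D x (\<lambda>a b. D a (\<lambda>c d. D b (\<lambda>e f. Q c d e f)))
    = D x (\<lambda>c y. D y (\<lambda>z f. D z (\<lambda>d e. Q c d e f)))"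
proof -
  have vs': "vector_space s'"
    using assms(2)[OF X_closed(1) X_closed(1) X_closed(1)] by (rule lin_vs)
  have "D x (\<lambda>a b. D a (\<lambda>c d. D b (\<lambda>e f. Q c d e f)))
      = D x (\<lambda>c y. D y (\<lambda>d b. D b (\<lambda>e f. Q c d e f)))"
    by (rule D_coassoc[OF x, where s' = s'], rule trilinI)
       (intro lin_D lin_D_arg bilinI assms vs'; assumption)+
  also have "\<dots> = D x (\<lambda>c y. D y (\<lambda>z f. D z (\<lambda>d e. Q c d e f)))"
    by (rule D_cong[OF x], rule D_coassoc[where s' = s', symmetric], assumption, rule trilinI)
       (intro assms; assumption)+
  finally show ?thesis .
qed

text \<open>In the convolution algebra Hom(H, H \<otimes> H), \<Delta> S is a left inverse of
  \<Delta>, and x \<mapsto> S x_(2) \<otimes> S x_(1) is a right inverse, so they coincide. The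
  calculation brackets the product of left inverse, \<Delta> and right inverse in both ways,
  evaluated under \<open>F\<close>.\<close>

lemma D_antipode:
  assumes x: "x \<in> X" and F: "bilin s' F"
  shows "D (S x) F = D x (\<lambda>a b. F (S b) (S a))"
proof -
  have vs': "vector_space s'" by (rule bilin_vs[OF F])
  have F1: "lin s' (\<lambda>x. F a (f x))" if "a \<in> X" "lin s f" "\<And>x. x \<in> X \<Longrightarrow> f x \<in> X" for a f
    by (rule lin_compose[OF bilinD1[OF F that(1)] that(2,3)])
  have F2: "lin s' (\<lambda>x. F (f x) a)" if "a \<in> X" "lin s f" "\<And>x. x \<in> X \<Longrightarrow> f x \<in> X" for a f
    by (rule lin_compose[OF bilinD2[OF F that(1)] that(2,3)])
  note rules = vs' F1 F2 lin_id lin_mult_left lin_mult_right lin_S_fun lin_D_fun lin_D_arg bilinI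
    mult_closed S_X D_X
  \<comment> \<open>This is \<open>F\<close> evaluated at u \<otimes> v times the convolution of
    \<Delta> with the right inverse at \<open>y\<close>. It collapses from the inside: first b S(c),
    then a S(r).\<close>
  define E where "E y u v = D y (\<lambda>c d. D c (\<lambda>c1 c2. D d (\<lambda>d1 d2.
      F (u \<odot> (c1 \<odot> S d2)) (v \<odot> (c2 \<odot> S d1)))))" for y u v
  have E: "E y u v = s' (\<epsilon> y) (F u v)" if y: "y \<in> X" and u: "u \<in> X" and v: "v \<in> X" for y u v
  proof -
    have "E y u v = D y (\<lambda>a r. D r (\<lambda>m d. D m (\<lambda>b c. F (u \<odot> (a \<odot> S d)) (v \<odot> (b \<odot> S c)))))"
      unfolding E_def using u v by (intro D_coassoc4[OF y, where s' = s'] rules)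
    also have "\<dots> = D y (\<lambda>a r. F (u \<odot> (a \<odot> S r)) v)"
    proof (rule D_cong[OF y])
      fix a r assume a: "a \<in> X" and r: "r \<in> X"
      have "D r (\<lambda>m d. D m (\<lambda>b c. F (u \<odot> (a \<odot> S d)) (v \<odot> (b \<odot> S c))))
          = D r (\<lambda>m d. s' (\<epsilon> m) (F (u \<odot> (a \<odot> S d)) v))"
      proof (rule D_cong[OF r])
        fix m d assume m: "m \<in> X" and d: "d \<in> X"
        let ?f = "\<lambda>z. F (u \<odot> (a \<odot> S d)) (v \<odot> z)"
        have f: "lin s' ?f" using u v a d by (intro rules)
        have "D m (\<lambda>b c. ?f (b \<odot> S c)) = ?f (s (\<epsilon> m) \<one>)"
          using lin_D_apply[OF f m, of "\<lambda>b c. b \<odot> S c"] D_antipode_right[OF m] by simp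
        then show "D m (\<lambda>b c. ?f (b \<odot> S c)) = s' (\<epsilon> m) (F (u \<odot> (a \<odot> S d)) v)"
          using lin_scale[OF f] v by simp
      qed
      also have "\<dots> = F (u \<odot> (a \<odot> S r)) v"
        by (rule D_counit_left[OF r]) (use u v a in \<open>intro rules\<close>)
      finally show "D r (\<lambda>m d. D m (\<lambda>b c. F (u \<odot> (a \<odot> S d)) (v \<odot> (b \<odot> S c))))
        = F (u \<odot> (a \<odot> S r)) v" .
    qed
    also have "\<dots> = F (u \<odot> s (\<epsilon> y) \<one>) v"
    proof -
      have f: "lin s' (\<lambda>z. F (u \<odot> z) v)" using u v by (intro rules)
      show ?thesis
        using lin_D_apply[OF f y, of "\<lambda>b c. b \<odot> S c"] D_antipode_right[OF y] by simp
    qed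
    also have "\<dots> = s' (\<epsilon> y) (F u v)"
      using u v by (simp add: mult_scale_right lin_scale[OF bilinD2[OF F]])
    finally show ?thesis .
  qed
  \<comment> \<open>Here u \<otimes> v is multiplied by the right inverse at \<open>d\<close> alone;
    this form remains after the factor \<Delta> has been absorbed into
    \<open>D (S a \<odot> c)\<close>.\<close>
  define G where "G d u v = D d (\<lambda>d1 d2. F (u \<odot> S d2) (v \<odot> S d1))" for d u v
  have G: "bilin s' (G d)" if "d \<in> X" for d
    unfolding G_def[abs_def] using that by (intro rules)
  have G_lin: "lin s' (\<lambda>d. G d u v)" if "u \<in> X" "v \<in> X" for u v
    unfolding G_def using that by (intro rules lin_D)
  have "D (S x) F = D x (\<lambda>a y. s' (\<epsilon> y) (D (S a) F))"
    by (rule D_counit_right[OF x, symmetric]) (intro lin_D_fun[OF F] lin_S_fun lin_id S_X)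
  also have "\<dots> = D x (\<lambda>a y. D (S a) (\<lambda>u v. E y u v))"
  proof (rule D_cong[OF x])
    fix a y assume a: "a \<in> X" and y: "y \<in> X"
    have "D (S a) (\<lambda>u v. E y u v) = D (S a) (\<lambda>u v. s' (\<epsilon> y) (F u v))"
      by (rule D_cong) (use a y E in auto)
    also have "\<dots> = s' (\<epsilon> y) (D (S a) F)"
      by (rule D_scale_out[OF vs'])
    finally show "s' (\<epsilon> y) (D (S a) F) = D (S a) (\<lambda>u v. E y u v)" ..
  qed
  also have "\<dots> = D x (\<lambda>a y. D y (\<lambda>c d. D (S a \<odot> c) (G d)))"
  proof (rule D_cong[OF x])
    fix a y assume a: "a \<in> X" and y: "y \<in> X"
    have "D (S a) (\<lambda>u v. E y u v) = D y (\<lambda>c d. D (S a) (\<lambda>u v. D c (\<lambda>c1 c2. D d (\<lambda>d1 d2.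
      F (u \<odot> (c1 \<odot> S d2)) (v \<odot> (c2 \<odot> S d1))))))"
      unfolding E_def by (rule D_swap)
    also have "\<dots> = D y (\<lambda>c d. D (S a \<odot> c) (G d))"
    proof (rule D_cong[OF y])
      fix c d assume c: "c \<in> X" and d: "d \<in> X"
      have "D (S a \<odot> c) (G d) = D (S a) (\<lambda>u v. D c (\<lambda>c1 c2. G d (u \<odot> c1) (v \<odot> c2)))"
        by (rule D_mult[OF _ c G[OF d]]) (use a in auto)
      also have "\<dots> = D (S a) (\<lambda>u v. D c (\<lambda>c1 c2. D d (\<lambda>d1 d2.
          F (u \<odot> (c1 \<odot> S d2)) (v \<odot> (c2 \<odot> S d1)))))"
        unfolding G_def
        by (rule D_cong, use a in blast, rule D_cong[OF c], rule D_cong[OF d])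
           (simp add: mult_assoc)
      finally show "D (S a) (\<lambda>u v. D c (\<lambda>c1 c2. D d (\<lambda>d1 d2.
          F (u \<odot> (c1 \<odot> S d2)) (v \<odot> (c2 \<odot> S d1))))) = D (S a \<odot> c) (G d)" ..
    qed
    finally show "D (S a) (\<lambda>u v. E y u v) = D y (\<lambda>c d. D (S a \<odot> c) (G d))" .
  qed
  also have "\<dots> = D x (\<lambda>m d. D m (\<lambda>a c. D (S a \<odot> c) (G d)))"
  proof (rule D_coassoc[OF x, symmetric], rule trilinI)
    fix a b assume ab: "a \<in> X" "b \<in> X"
    show "lin s' (\<lambda>x. D (S a \<odot> b) (G x))"
      by (rule lin_D_arg[OF vs']) (use ab G_lin in auto)
    show "lin s' (\<lambda>x. D (S a \<odot> x) (G b))"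
      by (rule lin_D_fun[OF G[OF ab(2)]]) (use ab in \<open>auto intro!: lin_mult_right\<close>)
    show "lin s' (\<lambda>x. D (S x \<odot> a) (G b))"
      by (rule lin_D_fun[OF G[OF ab(2)]]) (use ab in \<open>auto intro!: lin_mult_left lin_S_fun\<close>)
  qed
  also have "\<dots> = D x (\<lambda>m d. s' (\<epsilon> m) (G d \<one> \<one>))"
  proof (rule D_cong[OF x])
    fix m d assume m: "m \<in> X" and d: "d \<in> X"
    have "D m (\<lambda>a c. D (S a \<odot> c) (G d)) = D (s (\<epsilon> m) \<one>) (G d)"
      using lin_D_apply[OF lin_D[OF G[OF d]] m, of "\<lambda>a c. S a \<odot> c"] D_antipode_left[OF m]
      by simp
    then show "D m (\<lambda>a c. D (S a \<odot> c) (G d)) = s' (\<epsilon> m) (G d \<one> \<one>)"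
      using lin_scale[OF lin_D[OF G[OF d]]] D_one[OF G[OF d]] by simp
  qed
  also have "\<dots> = G x \<one> \<one>"
    by (rule D_counit_left[OF x G_lin]) auto
  also have "\<dots> = D x (\<lambda>a b. F (S b) (S a))"
    unfolding G_def by (rule D_cong[OF x]) auto
  finally show ?thesis .
qed

text \<open>The argument of \<open>D_antipode\<close> with Hom(H \<otimes> H, H) in place of Hom(H,
  H \<otimes> H): the composite of \<open>S\<close> with the product is a left convolution inverse
  of the product, and x \<otimes> y \<mapsto> S y S x is a right one. \<open>E\<close> is the
  convolution of the product with that right inverse.\<close>

lemma S_mult:
  assumes x: "x \<in> X" and y: "y \<in> X"
  shows "S (x \<odot> y) = S y \<odot> S x"
proof -
  note rules = vs lin_id lin_mult_left lin_mult_right lin_S_fun lin_D_fun lin_D_arg bilinI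
    mult_closed S_X D_X
  define E where "E p q = D p (\<lambda>p1 p2. D q (\<lambda>q1 q2. p1 \<odot> q1 \<odot> (S q2 \<odot> S p2)))" for p q
  have E: "E p q = s (\<epsilon> p * \<epsilon> q) \<one>" if p: "p \<in> X" and q: "q \<in> X" for p q
  proof -
    have "D q (\<lambda>q1 q2. p1 \<odot> q1 \<odot> (S q2 \<odot> S p2)) = s (\<epsilon> q) (p1 \<odot> S p2)"
      if "p1 \<in> X" "p2 \<in> X" for p1 p2
    proof -
      let ?f = "\<lambda>z. p1 \<odot> (z \<odot> S p2)"
      have f: "lin s ?f" using that by (intro rules)
      have "D q (\<lambda>q1 q2. p1 \<odot> q1 \<odot> (S q2 \<odot> S p2)) = D q (\<lambda>q1 q2. ?f (q1 \<odot> S q2))"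
        by (rule D_cong[OF q]) (use that in \<open>simp add: mult_assoc\<close>)
      also have "\<dots> = ?f (s (\<epsilon> q) \<one>)"
        using lin_D_apply[OF f q, of "\<lambda>b c. b \<odot> S c"] D_antipode_right[OF q] by simp
      finally show ?thesis
        using that by (simp add: mult_scale_left mult_scale_right)
    qed
    then have "E p q = D p (\<lambda>p1 p2. s (\<epsilon> q) (p1 \<odot> S p2))"
      unfolding E_def by (intro D_cong[OF p])
    also have "\<dots> = s (\<epsilon> q) (s (\<epsilon> p) \<one>)"
      using lin_D_apply[OF lin_const_scale[OF lin_id] p, of "\<lambda>b c. b \<odot> S c" "\<epsilon> q"]
        D_antipode_right[OF p] by simp
    finally show ?thesis by (simp add: mult.commute)
  qed
  have "S (x \<odot> y) = D x (\<lambda>a p. s (\<epsilon> p) (S (a \<odot> y)))"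
    by (rule D_counit_right[OF x, symmetric]) (use y in \<open>intro rules\<close>)
  also have "\<dots> = D x (\<lambda>a p. D y (\<lambda>b q. S (a \<odot> b) \<odot> E p q))"
  proof (rule D_cong[OF x])
    fix a p assume a: "a \<in> X" and p: "p \<in> X"
    have "s (\<epsilon> p) (S (a \<odot> y)) = D y (\<lambda>b q. s (\<epsilon> q) (s (\<epsilon> p) (S (a \<odot> b))))"
      by (rule D_counit_right[OF y, symmetric]) (use a in \<open>intro lin_const_scale rules\<close>)
    also have "\<dots> = D y (\<lambda>b q. S (a \<odot> b) \<odot> E p q)"
      by (rule D_cong[OF y]) (use a p in \<open>simp add: E mult_scale_right mult.commute\<close>)
    finally show "s (\<epsilon> p) (S (a \<odot> y)) = D y (\<lambda>b q. S (a \<odot> b) \<odot> E p q)" .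
  qed
  also have "\<dots> = D x (\<lambda>a p. D p (\<lambda>p1 p2. D y (\<lambda>b q. D q (\<lambda>q1 q2.
      S (a \<odot> b) \<odot> (p1 \<odot> q1) \<odot> (S q2 \<odot> S p2)))))"
  proof (rule D_cong[OF x])
    fix a p assume a: "a \<in> X" and p: "p \<in> X"
    have "D y (\<lambda>b q. S (a \<odot> b) \<odot> E p q) = D y (\<lambda>b q. D p (\<lambda>p1 p2. D q (\<lambda>q1 q2.
      S (a \<odot> b) \<odot> (p1 \<odot> q1) \<odot> (S q2 \<odot> S p2))))"
    proof (rule D_cong[OF y])
      fix b q assume b: "b \<in> X" and q: "q \<in> X"
      let ?f = "\<lambda>z. S (a \<odot> b) \<odot> z"
      have f: "lin s ?f" using a b by (intro rules)
      have "?f (E p q) = D p (\<lambda>p1 p2. ?f (D q (\<lambda>q1 q2. p1 \<odot> q1 \<odot> (S q2 \<odot> S p2))))"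
        unfolding E_def by (rule lin_D_apply[OF f p]) (use q in \<open>intro rules\<close>)
      also have "\<dots> = D p (\<lambda>p1 p2. D q (\<lambda>q1 q2. ?f (p1 \<odot> q1 \<odot> (S q2 \<odot> S p2))))"
        by (rule D_cong[OF p], rule lin_D_apply[OF f q]) (intro rules)
      also have "\<dots> = D p (\<lambda>p1 p2. D q (\<lambda>q1 q2.
          S (a \<odot> b) \<odot> (p1 \<odot> q1) \<odot> (S q2 \<odot> S p2)))"
        by (rule D_cong[OF p], rule D_cong[OF q]) (use a b in \<open>simp add: mult_assoc\<close>)
      finally show "?f (E p q) = D p (\<lambda>p1 p2. D q (\<lambda>q1 q2.
          S (a \<odot> b) \<odot> (p1 \<odot> q1) \<odot> (S q2 \<odot> S p2)))" .
    qed
    also have "\<dots> = D p (\<lambda>p1 p2. D y (\<lambda>b q. D q (\<lambda>q1 q2.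
      S (a \<odot> b) \<odot> (p1 \<odot> q1) \<odot> (S q2 \<odot> S p2))))"
      by (rule D_swap)
    finally show "D y (\<lambda>b q. S (a \<odot> b) \<odot> E p q) = D p (\<lambda>p1 p2. D y (\<lambda>b q. D q (\<lambda>q1 q2.
      S (a \<odot> b) \<odot> (p1 \<odot> q1) \<odot> (S q2 \<odot> S p2))))" .
  qed
  also have "\<dots> = D x (\<lambda>m p2. D m (\<lambda>a p1. D y (\<lambda>b q. D q (\<lambda>q1 q2.
      S (a \<odot> b) \<odot> (p1 \<odot> q1) \<odot> (S q2 \<odot> S p2)))))"
    by (rule D_coassoc[OF x, where s' = s, symmetric], rule trilinI) (intro rules y; assumption)+
  also have "\<dots> = D x (\<lambda>m p2. s (\<epsilon> m) (S y \<odot> S p2))"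
  proof (rule D_cong[OF x])
    fix m p2 assume m: "m \<in> X" and p2: "p2 \<in> X"
    have "D m (\<lambda>a p1. D y (\<lambda>b q. D q (\<lambda>q1 q2.
          S (a \<odot> b) \<odot> (p1 \<odot> q1) \<odot> (S q2 \<odot> S p2))))
        = D m (\<lambda>a p1. D y (\<lambda>n q2. D n (\<lambda>b q1.
          S (a \<odot> b) \<odot> (p1 \<odot> q1) \<odot> (S q2 \<odot> S p2))))"
      by (rule D_cong[OF m], rule D_coassoc[OF y, where s' = s, symmetric], rule trilinI)
         (intro rules p2; assumption)+
    also have "\<dots> = D y (\<lambda>n q2. D m (\<lambda>a p1. D n (\<lambda>b q1.
          S (a \<odot> b) \<odot> (p1 \<odot> q1) \<odot> (S q2 \<odot> S p2))))"
      by (rule D_swap)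
    also have "\<dots> = D y (\<lambda>n q2. s (\<epsilon> n) (s (\<epsilon> m) (S q2 \<odot> S p2)))"
    proof (rule D_cong[OF y])
      fix n q2 assume n: "n \<in> X" and q2: "q2 \<in> X"
      let ?f = "\<lambda>z. z \<odot> (S q2 \<odot> S p2)"
      have f: "lin s ?f" using q2 p2 by (intro rules)
      have bil: "bilin s (\<lambda>u v. ?f (S u \<odot> v))" using q2 p2 by (intro rules)
      \<comment> \<open>Reading \<open>D_mult\<close> backwards merges both sums into one over the
        coproduct of \<open>m \<odot> n\<close>, to which the antipode axiom applies.\<close>
      have "D m (\<lambda>a p1. D n (\<lambda>b q1. ?f (S (a \<odot> b) \<odot> (p1 \<odot> q1))))
          = D (m \<odot> n) (\<lambda>u v. ?f (S u \<odot> v))"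
        by (rule D_mult[OF m n bil, symmetric])
      also have "\<dots> = ?f (s (\<epsilon> (m \<odot> n)) \<one>)"
        using lin_D_apply[OF f, of "m \<odot> n" "\<lambda>u v. S u \<odot> v"] D_antipode_left[of "m \<odot> n"] m n
        by simp
      finally show "D m (\<lambda>a p1. D n (\<lambda>b q1. ?f (S (a \<odot> b) \<odot> (p1 \<odot> q1))))
          = s (\<epsilon> n) (s (\<epsilon> m) (S q2 \<odot> S p2))"
        using m n q2 p2 by (simp add: mult_scale_left mult.commute)
    qed
    also have "\<dots> = s (\<epsilon> m) (S y \<odot> S p2)"
      by (rule D_counit_left[OF y]) (use p2 in \<open>intro lin_const_scale rules\<close>)
    finally show "D m (\<lambda>a p1. D y (\<lambda>b q. D q (\<lambda>q1 q2.
          S (a \<odot> b) \<odot> (p1 \<odot> q1) \<odot> (S q2 \<odot> S p2)))) = s (\<epsilon> m) (S y \<odot> S p2)" .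
  qed
  also have "\<dots> = S y \<odot> S x"
    by (rule D_counit_left[OF x]) (use y in \<open>intro rules\<close>)
  finally show ?thesis .
qed

section \<open>The actions of the dual\<close>

text \<open>The action of the dual algebra usually written with a harpoon, here x \<mapsto>
  \<phi>(x_(1)) x_(2), with \<open>R\<close> as its mirror image. Conditions on the coproduct of a
  subspace become stability under these maps.\<close>

definition L :: "('h \<Rightarrow> 'k) \<Rightarrow> 'h \<Rightarrow> 'h" where
  "L \<phi> x = D x (\<lambda>a b. s (\<phi> a) b)"

definition R :: "('h \<Rightarrow> 'k) \<Rightarrow> 'h \<Rightarrow> 'h" where
  "R \<phi> x = D x (\<lambda>a b. s (\<phi> b) a)"

lemma bilin_L: "lin (*) \<phi> \<Longrightarrow> bilin s (\<lambda>a b. s (\<phi> a) b)"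
  and bilin_R: "lin (*) \<phi> \<Longrightarrow> bilin s (\<lambda>a b. s (\<phi> b) a)"
  by (intro bilinI lin_const_scale[OF lin_id] lin_scale_const vs; assumption)+

lemma L_X [simp, intro]: "x \<in> X \<Longrightarrow> L \<phi> x \<in> X"
  and R_X [simp, intro]: "x \<in> X \<Longrightarrow> R \<phi> x \<in> X"
  unfolding L_def R_def by (intro D_X X_closed; assumption)+

lemma lin_L: "lin (*) \<phi> \<Longrightarrow> lin s (L \<phi>)"
  and lin_R: "lin (*) \<phi> \<Longrightarrow> lin s (R \<phi>)"
  unfolding L_def[abs_def] R_def[abs_def] by (intro lin_D bilin_L bilin_R; assumption)+

lemma lin_apply_L:
  assumes "lin s' f" "x \<in> X"
  shows "f (L \<phi> x) = D x (\<lambda>a b. s' (\<phi> a) (f b))"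
  unfolding L_def using lin_D_apply[OF assms, of "\<lambda>a b. s (\<phi> a) b"]
    D_cong[OF assms(2), of "\<lambda>a b. f (s (\<phi> a) b)"] lin_scale[OF assms(1)] by simp

lemma lin_apply_R:
  assumes "lin s' f" "x \<in> X"
  shows "f (R \<phi> x) = D x (\<lambda>a b. s' (\<phi> b) (f a))"
  unfolding R_def using lin_D_apply[OF assms, of "\<lambda>a b. s (\<phi> b) a"]
    D_cong[OF assms(2), of "\<lambda>a b. f (s (\<phi> b) a)"] lin_scale[OF assms(1)] by simp

lemma L_counit: "x \<in> X \<Longrightarrow> L \<epsilon> x = x"
  unfolding L_def by (rule D_counit_left[OF _ lin_id])

lemma functional_L_R:
  assumes "x \<in> X" "lin (*) \<phi>" "lin (*) \<psi>"
  shows "\<psi> (L \<phi> x) = \<phi> (R \<psi> x)"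
  using assms by (simp add: lin_apply_L lin_apply_R mult.commute)

lemma lin_D_functionals: "lin (*) \<phi> \<Longrightarrow> lin (*) \<psi> \<Longrightarrow> lin (*) (\<lambda>y. D y (\<lambda>a b. \<phi> a * \<psi> b))"
  by (intro lin_D bilinI lin_times_left lin_times_right)

text \<open>This is coassociativity; it makes every \<open>L \<phi>\<close> a map of right
  comodules.\<close>

lemma L_R_commute:
  assumes x: "x \<in> X" and \<phi>: "lin (*) \<phi>" and \<psi>: "lin (*) \<psi>"
  shows "L \<phi> (R \<psi> x) = R \<psi> (L \<phi> x)"
proof -
  have "L \<phi> (R \<psi> x) = D x (\<lambda>y d. D y (\<lambda>a b. s (\<psi> d) (s (\<phi> a) b)))"
    unfolding lin_apply_R[OF lin_L[OF \<phi>] x] by (simp add: L_def D_scale_out[OF vs(1)] del: V.scale_scale)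
  also have "\<dots> = D x (\<lambda>a r. D r (\<lambda>b d. s (\<psi> d) (s (\<phi> a) b)))"
    by (rule D_coassoc[OF x, where s' = s], rule trilinI)
       (intro lin_const_scale lin_scale_const lin_id vs \<phi> \<psi>)+
  also have "\<dots> = R \<psi> (L \<phi> x)"
    unfolding lin_apply_L[OF lin_R[OF \<psi>] x]
    unfolding R_def V.scale_left_commute[of "\<psi> _"]
    by (simp add: D_scale_out[OF vs(1)] del: V.scale_scale)
  finally show ?thesis .
qed

lemma L_L:
  assumes x: "x \<in> X" and \<phi>: "lin (*) \<phi>" and \<psi>: "lin (*) \<psi>"
  shows "L \<phi> (L \<psi> x) = L (\<lambda>y. D y (\<lambda>a b. \<psi> a * \<phi> b)) x"
proof -
  have "L \<phi> (L \<psi> x) = D x (\<lambda>a b. D b (\<lambda>c d. s (\<psi> a) (s (\<phi> c) d)))"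
    unfolding lin_apply_L[OF lin_L[OF \<phi>] x] by (simp add: L_def D_scale_out[OF vs(1)] del: V.scale_scale)
  also have "\<dots> = D x (\<lambda>m d. D m (\<lambda>a c. s (\<psi> a) (s (\<phi> c) d)))"
    by (rule D_coassoc[OF x, where s' = s, symmetric], rule trilinI)
       (intro lin_const_scale lin_scale_const lin_id vs \<phi> \<psi>)+
  also have "\<dots> = L (\<lambda>y. D y (\<lambda>a b. \<psi> a * \<phi> b)) x"
    by (simp add: L_def D_functional_scale[OF vs(1)])
  finally show ?thesis .
qed

section \<open>Subcoalgebras through the actions of the dual\<close>

lemma functionals_separate:
  assumes "\<And>\<phi>. Vector_Spaces.linear s (*) \<phi> \<Longrightarrow> \<phi> x = \<phi> y"
  shows "x = y"
proof -
  let ?B = "V.extend_basis {}"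
  have B: "V.independent ?B" "V.span ?B = UNIV"
    by (rule V.independent_extend_basis[OF V.independent_empty])
       (rule V.span_extend_basis[OF V.independent_empty])
  have eq: "V.representation ?B x = V.representation ?B y"
    by (intro ext assms V.linear_representation B)
  have sum: "(\<Sum>b | V.representation ?B z b \<noteq> 0. s (V.representation ?B z b) b) = z" for z
    by (rule V.sum_nonzero_representation_eq[OF B(1)]) (simp add: B(2))
  show ?thesis
    using sum[of x] unfolding eq sum[of y] by (rule sym)
qed

text \<open>A tensor is by its encoding a function of functionals, so tensors of degree 2 are
  compared by testing on pairs of linear functionals.\<close>

lemma representsI:
  assumes "set ls \<subseteq> X \<times> X" "x \<in> X"
    and "\<And>\<phi> \<psi>. Vector_Spaces.linear s (*) \<phi> \<Longrightarrow> Vector_Spaces.linear s (*) \<psi> \<Longrightarrow>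
      (\<Sum>(a, b)\<leftarrow>ls. \<phi> a * \<psi> b) = D x (\<lambda>a b. \<phi> a * \<psi> b)"
  shows "represents ls x"
proof -
  have "(\<Sum>(a, b)\<leftarrow>rep x. pure s [a, b]) \<phi>s = (\<Sum>(a, b)\<leftarrow>ls. pure s [a, b]) \<phi>s" for \<phi>s
  proof (cases "length \<phi>s = 2 \<and> (\<forall>\<phi>\<in>set \<phi>s. Vector_Spaces.linear s (*) \<phi>)")
    case True
    then show ?thesis
      using assms(3)[of "\<phi>s ! 0" "\<phi>s ! 1"]
      by (simp add: sum_list_fun_apply split_def pure_pair D_def)
  next
    case False
    then have "pure s [a, b] \<phi>s = 0" for a b
      by (simp only: pure_pair if_False)
    then show ?thesis
      by (simp add: sum_list_fun_apply split_def)
  qed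
  then show ?thesis
    using assms(1,2) comult_rep[OF assms(2)] by (auto simp: represents_def D_def)
qed

lemma projection_exists:
  assumes "V.subspace U"
  obtains P where "Vector_Spaces.linear s s P" "\<And>x. P x \<in> U" "\<And>x. x \<in> U \<Longrightarrow> P x = x"
proof -
  interpret VV: vector_space_pair s s by unfold_locales
  show ?thesis
    using VV.linear_exists_left_inverse_on[OF V.linear_id assms] that by (auto simp: id_def)
qed

text \<open>Another form of subcoalgebras, as \<open>subcoalgebra_iff_bistable\<close> shows; it
  treats one leg of the coproduct at a time.\<close>

definition bistable :: "'h set \<Rightarrow> bool" where
  "bistable U \<longleftrightarrow> V.subspace U \<and> U \<subseteq> X \<and>
     (\<forall>x\<in>U. \<forall>\<phi>. lin (*) \<phi> \<longrightarrow> L \<phi> x \<in> U \<and> R \<phi> x \<in> U)"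

text \<open>Stability under \<open>L\<close> controls the right legs and stability under
  \<open>R\<close> the left legs; the point is that both can be placed in \<open>U\<close> at once.
  A projection \<open>P\<close> onto \<open>U\<close> is applied to all legs. By
  \<open>functional_L_R\<close> a test with \<phi> \<otimes> \<psi> can be evaluated on either side,
  and on each side \<open>P\<close> acts on an element already in \<open>U\<close>.\<close>

lemma bistable_rep:
  assumes U: "bistable U" and x: "x \<in> U"
  obtains ls where "represents ls x" "set ls \<subseteq> U \<times> U"
proof -
  obtain P where P: "Vector_Spaces.linear s s P" "\<And>x. P x \<in> U" "\<And>x. x \<in> U \<Longrightarrow> P x = x"
    using projection_exists U by (auto simp: bistable_def)
  have X: "x \<in> X" "\<And>y. P y \<in> X" using U x P(2) by (auto simp: bistable_def)
  show ?thesis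
  proof
    show sub: "set (map (\<lambda>(a, b). (P a, P b)) (rep x)) \<subseteq> U \<times> U"
      using P(2) by auto
    show "represents (map (\<lambda>(a, b). (P a, P b)) (rep x)) x"
    proof (rule representsI)
      show "set (map (\<lambda>(a, b). (P a, P b)) (rep x)) \<subseteq> X \<times> X"
        using X(2) by auto
      show "x \<in> X" by fact
      fix \<phi> \<psi> assume "Vector_Spaces.linear s (*) \<phi>" "Vector_Spaces.linear s (*) \<psi>"
      then have l: "lin (*) \<phi>" "lin (*) \<psi>"
        by (auto intro: linear_imp_lin)
      then have lP: "lin (*) (\<lambda>x. \<phi> (P x))" "lin (*) (\<lambda>x. \<psi> (P x))"
        using X(2) by (auto intro: lin_compose linear_imp_lin[OF P(1)])
      have "D x (\<lambda>a b. \<phi> a * \<psi> b) = \<psi> (L \<phi> x)"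
        using l X by (simp add: lin_apply_L)
      also have "\<dots> = \<psi> (P (L \<phi> x))"
        using U x l P(3) by (simp add: bistable_def)
      also have "\<dots> = \<phi> (R (\<lambda>x. \<psi> (P x)) x)"
        using functional_L_R[OF X(1) l(1) lP(2)] by simp
      also have "\<dots> = \<phi> (P (R (\<lambda>x. \<psi> (P x)) x))"
        using U x lP P(3) by (simp add: bistable_def)
      also have "\<dots> = D x (\<lambda>a b. \<phi> (P a) * \<psi> (P b))"
        using lin_apply_R[OF lP(1) X(1), of "\<lambda>x. \<psi> (P x)"] by (simp add: mult.commute)
      finally show "(\<Sum>(a, b)\<leftarrow>map (\<lambda>(a, b). (P a, P b)) (rep x). \<phi> a * \<psi> b) = D x (\<lambda>a b. \<phi> a * \<psi> b)"
        by (simp add: D_def o_def split_def)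
    qed
  qed
qed

lemma subcoalgebra_rep:
  assumes "subcoalgebra H E" "x \<in> E"
  obtains ls where "represents ls x" "set ls \<subseteq> E \<times> E"
proof -
  have "hcomult H x \<in> tensors s [E, E]" "V.subspace E" "E \<subseteq> X"
    using assms by (auto simp: subcoalgebra_def)
  then show ?thesis
    using that by (elim tensors_pairs) (auto simp: represents_def)
qed

lemma subcoalgebra_iff_bistable: "subcoalgebra H E \<longleftrightarrow> bistable E"
proof
  assume E: "subcoalgebra H E"
  then have sub: "V.subspace E" "E \<subseteq> X" by (auto simp: subcoalgebra_def)
  have "L \<phi> x \<in> E \<and> R \<phi> x \<in> E" if x: "x \<in> E" and \<phi>: "lin (*) \<phi>" for x \<phi>
  proof -
    obtain ls where "represents ls x" "set ls \<subseteq> E \<times> E"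
      using subcoalgebra_rep[OF E x] .
    then show ?thesis
      using sub x \<phi> unfolding L_def R_def
      by (auto intro!: D_subspace_rep bilin_L bilin_R V.subspace_scale[OF sub(1)])
  qed
  then show "bistable E" using sub by (simp add: bistable_def)
next
  assume E: "bistable E"
  then show "subcoalgebra H E"
    unfolding subcoalgebra_def
    by (auto simp: bistable_def elim!: bistable_rep[OF E] intro: represents_tensors)
qed

end


section \<open>The wedge of a Hopf subalgebra with itself\<close>

locale hopf_pair = hopf H S
  for H :: "('k::field, 'h::ab_group_add) hopf_data" (structure) and S +
  fixes K
  assumes subalg: "subalgebra H K" and subcoalg: "subcoalgebra H K" and S_image: "S ` K \<subseteq> K"
begin

lemma K_X [simp, intro]: "x \<in> K \<Longrightarrow> x \<in> X"
  using subcoalg by (auto simp: subcoalgebra_def)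

lemma subspace_K: "V.subspace K"
  using subcoalg by (auto simp: subcoalgebra_def)

lemma K_closed [simp, intro]:
  "0 \<in> K" "x \<in> K \<Longrightarrow> y \<in> K \<Longrightarrow> x + y \<in> K" "x \<in> K \<Longrightarrow> s c x \<in> K"
  "x \<in> K \<Longrightarrow> y \<in> K \<Longrightarrow> x - y \<in> K" "\<one> \<in> K" "x \<in> K \<Longrightarrow> y \<in> K \<Longrightarrow> x \<odot> y \<in> K"
  "x \<in> K \<Longrightarrow> S x \<in> K"
  using subspace_K subalg S_image
  by (auto simp: V.subspace_0 V.subspace_add V.subspace_scale V.subspace_diff subalgebra_def)

text \<open>The projection and its complement \<open>q\<close> replace the quotient map modulo
  \<open>K\<close>: the kernel of \<open>q\<close> is \<open>K\<close>, and \<open>q x\<close>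
  represents the class of \<open>x\<close>.\<close>

definition p :: "'h \<Rightarrow> 'h" where
  "p = (SOME P. Vector_Spaces.linear s s P \<and> (\<forall>x. P x \<in> K) \<and> (\<forall>x\<in>K. P x = x))"

definition q :: "'h \<Rightarrow> 'h" where
  "q x = x - p x"

lemma p_props: "Vector_Spaces.linear s s p \<and> (\<forall>x. p x \<in> K) \<and> (\<forall>x\<in>K. p x = x)"
proof -
  obtain P where "Vector_Spaces.linear s s P" "\<And>x. P x \<in> K" "\<And>x. x \<in> K \<Longrightarrow> P x = x"
    using projection_exists[OF subspace_K] by blast
  then have "\<exists>P. Vector_Spaces.linear s s P \<and> (\<forall>x. P x \<in> K) \<and> (\<forall>x\<in>K. P x = x)"
    by blast
  then show ?thesis
    unfolding p_def by (rule someI_ex)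
qed

lemma p_K [simp, intro]: "p x \<in> K"
  and p_eq [simp]: "x \<in> K \<Longrightarrow> p x = x"
  and linear_p: "Vector_Spaces.linear s s p"
  using p_props by auto

lemma linear_q: "Vector_Spaces.linear s s q"
proof -
  interpret VV: vector_space_pair s s by unfold_locales
  show ?thesis
    unfolding q_def[abs_def] by (intro VV.linear_compose_sub linear_p V.linear_ident)
qed

lemma lin_p: "lin s p" and lin_q: "lin s q"
  by (rule linear_imp_lin linear_p linear_q)+

lemma q_X [simp, intro]: "x \<in> X \<Longrightarrow> q x \<in> X"
  by (simp add: q_def K_X)

lemma q_K [simp]: "x \<in> K \<Longrightarrow> q x = 0"
  by (simp add: q_def)

lemma q_eq_0D: "q x = 0 \<Longrightarrow> x \<in> K"
  using p_K[of x] by (simp add: q_def)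

lemma p_plus_q: "x = p x + q x"
  by (simp add: q_def)

lemma lin_p_fun: "lin s f \<Longrightarrow> (\<And>x. x \<in> X \<Longrightarrow> f x \<in> X) \<Longrightarrow> lin s (\<lambda>x. p (f x))"
  and lin_q_fun: "lin s f \<Longrightarrow> (\<And>x. x \<in> X \<Longrightarrow> f x \<in> X) \<Longrightarrow> lin s (\<lambda>x. q (f x))"
  by (rule lin_compose[OF lin_p] lin_compose[OF lin_q]; assumption)+

lemma p_X [simp, intro]: "p x \<in> X"
  by (simp add: K_X)

lemmas pair_rules = vs(1) lin_id lin_mult_left lin_mult_right lin_S_fun lin_p_fun lin_q_fun
  lin_D_fun lin_D_arg bilinI mult_closed S_X p_X q_X D_X one_closed

lemma zero_mult [simp]: "y \<in> X \<Longrightarrow> 0 \<odot> y = 0" "y \<in> X \<Longrightarrow> y \<odot> 0 = 0"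
  using lin_0[OF lin_mult_left[OF lin_id]] lin_0[OF lin_mult_right[OF lin_id]] by auto

lemma mult_diff_left: "x \<in> X \<Longrightarrow> y \<in> X \<Longrightarrow> z \<in> X \<Longrightarrow> (x - y) \<odot> z = x \<odot> z - y \<odot> z"
  and mult_diff_right: "x \<in> X \<Longrightarrow> y \<in> X \<Longrightarrow> z \<in> X \<Longrightarrow> z \<odot> (x - y) = z \<odot> x - z \<odot> y"
  using lin_diff[OF lin_mult_left[OF lin_id]] lin_diff[OF lin_mult_right[OF lin_id]] by auto

text \<open>The wedge K \<and> K, that is the preimage under \<Delta> of K \<otimes> H + H \<otimes>
  K. The free legs are only required to lie in \<open>X\<close>; \<open>W_rep\<close> later places
  them in \<open>W\<close>.\<close>

definition W :: "'h set" where
  "W = {x \<in> X. \<exists>ls. represents ls x \<and> set ls \<subseteq> K \<times> X \<union> X \<times> K}"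

lemma WI: "x \<in> X \<Longrightarrow> represents ls x \<Longrightarrow> set ls \<subseteq> K \<times> X \<union> X \<times> K \<Longrightarrow> x \<in> W"
  by (auto simp: W_def)

lemma W_wedge_rep:
  assumes "x \<in> W" obtains ls where "represents ls x" "set ls \<subseteq> K \<times> X \<union> X \<times> K"
  using assms by (auto simp: W_def)

lemma W_X [simp, intro]: "x \<in> W \<Longrightarrow> x \<in> X"
  by (simp add: W_def)

lemma K_rep:
  assumes "x \<in> K" obtains ls where "represents ls x" "set ls \<subseteq> K \<times> K"
  using subcoalgebra_rep[OF subcoalg assms] .

lemma K_W [simp, intro]:
  assumes "x \<in> K" shows "x \<in> W"
proof -
  obtain ls where "represents ls x" "set ls \<subseteq> K \<times> K"
    using K_rep[OF assms] .
  then show ?thesis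
    using assms by (intro WI) auto
qed

lemma subspace_W: "V.subspace W"
proof (rule V.subspaceI)
  show "0 \<in> W" by auto
  show "x + y \<in> W" if xy: "x \<in> W" "y \<in> W" for x y
  proof -
    obtain ls where ls: "represents ls x" "set ls \<subseteq> K \<times> X \<union> X \<times> K"
      using W_wedge_rep[OF xy(1)] .
    obtain ls' where ls': "represents ls' y" "set ls' \<subseteq> K \<times> X \<union> X \<times> K"
      using W_wedge_rep[OF xy(2)] .
    show ?thesis
      by (rule WI[OF _ represents_add[OF ls(1) ls'(1)]]) (use xy ls(2) ls'(2) in auto)
  qed
  show "s c x \<in> W" if x: "x \<in> W" for c x
  proof -
    obtain ls where ls: "represents ls x" "set ls \<subseteq> K \<times> X \<union> X \<times> K"
      using W_wedge_rep[OF x] .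
    have "set (map (\<lambda>(a, b). (s c a, b)) ls) \<subseteq> K \<times> X \<union> X \<times> K"
      using ls(2) by auto
    then show ?thesis
      using x by (intro WI[OF _ represents_scale[OF ls(1)]]) auto
  qed
qed

lemma W_closed [simp, intro]:
  "x \<in> W \<Longrightarrow> y \<in> W \<Longrightarrow> x + y \<in> W" "x \<in> W \<Longrightarrow> y \<in> W \<Longrightarrow> x - y \<in> W"
  using subspace_W by (auto simp: V.subspace_add V.subspace_diff)

lemma q_W [simp, intro]: "x \<in> W \<Longrightarrow> q x \<in> W"
  by (simp add: q_def K_W)

lemma mult_W [simp, intro]:
  assumes x: "x \<in> W" and k: "k \<in> K"
  shows "x \<odot> k \<in> W" "k \<odot> x \<in> W"
proof -
  obtain ls where ls: "represents ls x" "set ls \<subseteq> K \<times> X \<union> X \<times> K"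
    using W_wedge_rep[OF x] .
  obtain ls' where ls': "represents ls' k" "set ls' \<subseteq> K \<times> K"
    using K_rep[OF k] .
  have "(fst i \<odot> fst j, snd i \<odot> snd j) \<in> K \<times> X \<union> X \<times> K"
    "(fst j \<odot> fst i, snd j \<odot> snd i) \<in> K \<times> X \<union> X \<times> K"
    if "i \<in> set ls" "j \<in> set ls'" for i j
  proof -
    have "fst j \<in> K" "snd j \<in> K" "fst i \<in> K \<and> snd i \<in> X \<or> fst i \<in> X \<and> snd i \<in> K"
      using ls(2) ls'(2) that by auto
    then show "(fst i \<odot> fst j, snd i \<odot> snd j) \<in> K \<times> X \<union> X \<times> K"
      "(fst j \<odot> fst i, snd j \<odot> snd i) \<in> K \<times> X \<union> X \<times> K"
      by auto
  qed
  then have "set (map (\<lambda>((a, b), (c, d)). (a \<odot> c, b \<odot> d)) (List.product ls ls')) \<subseteq> K \<times> X \<union> X \<times> K"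
    "set (map (\<lambda>((a, b), (c, d)). (a \<odot> c, b \<odot> d)) (List.product ls' ls)) \<subseteq> K \<times> X \<union> X \<times> K"
    by (simp_all add: image_subset_iff split_def)
  note sub = this
  have X: "x \<in> X" "k \<in> X" using x k by auto
  show "x \<odot> k \<in> W"
    by (rule WI[OF _ represents_mult[OF ls(1) ls'(1) X] sub(1)]) (use X in auto)
  show "k \<odot> x \<in> W"
    by (rule WI[OF _ represents_mult[OF ls'(1) ls(1) X(2,1)] sub(2)]) (use X in auto)
qed

text \<open>In dual terms, the wedge is the annihilator of the square of the annihilator of
  \<open>K\<close>. For the converse, \<phi> q and \<psi> q vanish on \<open>K\<close>, so the q
  \<otimes> q component of \<Delta> x is zero, and p \<otimes> id + q \<otimes> p remains.\<close>

lemma W_iff_functionals: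
  assumes x: "x \<in> X"
  shows "x \<in> W \<longleftrightarrow> (\<forall>\<phi> \<psi>. lin (*) \<phi> \<longrightarrow> lin (*) \<psi> \<longrightarrow> (\<forall>k\<in>K. \<phi> k = 0 \<and> \<psi> k = 0) \<longrightarrow>
    D x (\<lambda>a b. \<phi> a * \<psi> b) = 0)" (is "_ \<longleftrightarrow> ?rhs")
proof
  assume "x \<in> W"
  then obtain ls where ls: "represents ls x" "set ls \<subseteq> K \<times> X \<union> X \<times> K"
    by (rule W_wedge_rep)
  show ?rhs
  proof (intro allI impI)
    fix \<phi> \<psi> assume *: "lin (*) \<phi>" "lin (*) \<psi>" "\<forall>k\<in>K. \<phi> k = 0 \<and> \<psi> k = 0"
    have "D x (\<lambda>a b. \<phi> a * \<psi> b) = D x (\<lambda>a b. 0)"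
      by (rule D_cong_rep[OF ls(1) x, where s' = "(*)"])
         (use * ls(2) in \<open>auto intro!: bilinI lin_times_left lin_times_right lin_zero vs\<close>)
    then show "D x (\<lambda>a b. \<phi> a * \<psi> b) = 0"
      by (simp add: D_zero)
  qed
next
  assume *: ?rhs
  define ls where "ls = concat (map (\<lambda>(a, b). [(p a, b), (q a, p b)]) (rep x))"
  have sum: "(\<Sum>(a, b)\<leftarrow>ls. F a b) = D x (\<lambda>a b. F (p a) b + F (q a) (p b))"
    for F :: "'h \<Rightarrow> 'h \<Rightarrow> 'k"
    by (simp add: ls_def D_def sum_list_concat_map o_def split_def)
  have sub: "set ls \<subseteq> K \<times> X \<union> X \<times> K"
    using rep_X[OF x] by (auto simp: ls_def)
  have "represents ls x"
  proof (rule representsI[OF _ x])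
    show "set ls \<subseteq> X \<times> X" using sub by auto
    fix \<phi> \<psi> :: "'h \<Rightarrow> 'k"
    assume "Vector_Spaces.linear s (*) \<phi>" "Vector_Spaces.linear s (*) \<psi>"
    then have l: "lin (*) \<phi>" "lin (*) \<psi>" by (auto intro: linear_imp_lin)
    then have "lin (*) (\<lambda>x. \<phi> (q x))" "lin (*) (\<lambda>x. \<psi> (q x))"
      by (auto intro: lin_compose lin_q)
    then have "D x (\<lambda>a b. \<phi> (q a) * \<psi> (q b)) = 0"
      using * lin_0[OF l(1)] lin_0[OF l(2)] by auto
    then have "D x (\<lambda>a b. \<phi> (p a) * \<psi> b + \<phi> (q a) * \<psi> (p b))
        = D x (\<lambda>a b. (\<phi> (p a) * \<psi> b + \<phi> (q a) * \<psi> (p b)) + \<phi> (q a) * \<psi> (q b))"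
      by (simp add: D_plus)
    also have "\<dots> = D x (\<lambda>a b. \<phi> a * \<psi> b)"
    proof (rule D_cong[OF x])
      fix a b assume "a \<in> X" "b \<in> X"
      then have "\<phi> a = \<phi> (p a) + \<phi> (q a)" "\<psi> b = \<psi> (p b) + \<psi> (q b)"
        using lin_add[OF l(1), of "p a" "q a"] lin_add[OF l(2), of "p b" "q b"]
        by (simp_all flip: p_plus_q)
      then show "(\<phi> (p a) * \<psi> b + \<phi> (q a) * \<psi> (p b)) + \<phi> (q a) * \<psi> (q b) = \<phi> a * \<psi> b"
        by (simp add: algebra_simps)
    qed
    finally show "(\<Sum>(a, b)\<leftarrow>ls. \<phi> a * \<psi> b) = D x (\<lambda>a b. \<phi> a * \<psi> b)"
      by (simp add: sum)
  qed
  then show "x \<in> W" using x sub by (intro WI)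
qed

text \<open>As \<open>K\<close> is a subcoalgebra, its annihilator is a two-sided ideal of the dual
  algebra.\<close>

lemma functional_product_K:
  assumes "k \<in> K" "lin (*) \<phi>" "lin (*) \<psi>"
    and "(\<forall>k\<in>K. \<phi> k = 0) \<or> (\<forall>k\<in>K. \<psi> k = 0)"
  shows "D k (\<lambda>a b. \<phi> a * \<psi> b) = 0"
proof -
  obtain ls where ls: "represents ls k" "set ls \<subseteq> K \<times> K"
    using K_rep[OF assms(1)] .
  have "D k (\<lambda>a b. \<phi> a * \<psi> b) = D k (\<lambda>a b. 0)"
    by (rule D_cong_rep[OF ls(1), where s' = "(*)"])
       (use assms ls(2) in \<open>auto intro!: bilinI lin_times_left lin_times_right lin_zero vs\<close>)
  then show ?thesis by (simp add: D_zero)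
qed

text \<open>The functional of the action is absorbed by associativity into one of the two test
  functionals, which stays in the annihilator of \<open>K\<close> because that is an ideal.\<close>

lemma bistable_W: "bistable W"
proof -
  have "L \<phi> x \<in> W \<and> R \<phi> x \<in> W" if x: "x \<in> W" and \<phi>: "lin (*) \<phi>" for x \<phi>
  proof -
    have xX: "x \<in> X" using x by auto
    have "D (L \<phi> x) (\<lambda>a b. \<psi> a * \<chi> b) = 0" "D (R \<phi> x) (\<lambda>a b. \<psi> a * \<chi> b) = 0"
      if l: "lin (*) \<psi>" "lin (*) \<chi>" and z: "\<forall>k\<in>K. \<psi> k = 0 \<and> \<chi> k = 0" for \<psi> \<chi>
    proof -
      have tri: "trilin (*) (\<lambda>a c d. \<phi> a * (\<psi> c * \<chi> d))" "trilin (*) (\<lambda>a c d. \<phi> d * (\<psi> a * \<chi> c))"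
        by (rule trilinI; intro lin_times_left lin_times_right l \<phi>)+
      have "D (L \<phi> x) (\<lambda>a b. \<psi> a * \<chi> b) = D x (\<lambda>a b. D b (\<lambda>c d. \<phi> a * (\<psi> c * \<chi> d)))"
        unfolding lin_apply_L[OF lin_D_functionals[OF l] xX] by (simp add: D_scale_out[OF vs(2)])
      also have "\<dots> = D x (\<lambda>m d. D m (\<lambda>a c. \<phi> a * (\<psi> c * \<chi> d)))"
        by (rule D_coassoc[OF xX tri(1), symmetric])
      also have "\<dots> = D x (\<lambda>m d. D m (\<lambda>a c. \<phi> a * \<psi> c) * \<chi> d)"
        unfolding mult.assoc[symmetric] by (simp add: D_functional_scale[OF vs(2)])
      also have "\<dots> = 0"
        using x lin_D_functionals[OF \<phi> l(1)] l(2) z functional_product_K[OF _ \<phi> l(1)]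
        unfolding W_iff_functionals[OF xX] by auto
      finally show "D (L \<phi> x) (\<lambda>a b. \<psi> a * \<chi> b) = 0" .
      have "D (R \<phi> x) (\<lambda>a b. \<psi> a * \<chi> b) = D x (\<lambda>b d. D b (\<lambda>a c. \<phi> d * (\<psi> a * \<chi> c)))"
        unfolding lin_apply_R[OF lin_D_functionals[OF l] xX] by (simp add: D_scale_out[OF vs(2)])
      also have "\<dots> = D x (\<lambda>a m. D m (\<lambda>c d. \<phi> d * (\<psi> a * \<chi> c)))"
        by (rule D_coassoc[OF xX tri(2)])
      also have "\<dots> = D x (\<lambda>a m. D m (\<lambda>c d. \<psi> a * (\<chi> c * \<phi> d)))"
        by (simp add: ac_simps)
      also have "\<dots> = D x (\<lambda>a m. \<psi> a * D m (\<lambda>c d. \<chi> c * \<phi> d))"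
        by (simp add: D_scale_out[OF vs(2)])
      also have "\<dots> = 0"
        using x lin_D_functionals[OF l(2) \<phi>] l(1) z functional_product_K[OF _ l(2) \<phi>]
        unfolding W_iff_functionals[OF xX] by auto
      finally show "D (R \<phi> x) (\<lambda>a b. \<psi> a * \<chi> b) = 0" .
    qed
    then show ?thesis
      using W_iff_functionals[of "L \<phi> x"] W_iff_functionals[of "R \<phi> x"] xX by auto
  qed
  then show ?thesis
    using subspace_W by (auto simp: bistable_def)
qed

text \<open>Since \<open>W\<close> is itself a subcoalgebra, the decomposition p \<otimes> id + q
  \<otimes> p can start from legs in \<open>W\<close>. This is what makes W / K a bicomodule over
  \<open>K\<close>.\<close>

lemma W_rep:
  assumes x: "x \<in> W"
  obtains ls where "represents ls x" "set ls \<subseteq> K \<times> W \<union> W \<times> K"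
proof -
  have xX: "x \<in> X" using x by auto
  obtain ls where ls: "represents ls x" "set ls \<subseteq> W \<times> W"
    using bistable_rep[OF bistable_W x] .
  define ls' where "ls' = concat (map (\<lambda>(a, b). [(p a, b), (q a, p b)]) ls)"
  have sum: "(\<Sum>(a, b)\<leftarrow>ls'. F a b) = (\<Sum>(a, b)\<leftarrow>ls. F (p a) b + F (q a) (p b))"
    for F :: "'h \<Rightarrow> 'h \<Rightarrow> 'k"
    by (simp add: ls'_def sum_list_concat_map o_def split_def)
  have sub: "set ls' \<subseteq> K \<times> W \<union> W \<times> K"
    using ls(2) by (auto simp: ls'_def)
  have "represents ls' x"
  proof (rule representsI[OF _ xX])
    show "set ls' \<subseteq> X \<times> X" using sub by auto
    fix \<phi> \<psi> :: "'h \<Rightarrow> 'k"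
    assume "Vector_Spaces.linear s (*) \<phi>" "Vector_Spaces.linear s (*) \<psi>"
    then have l: "lin (*) \<phi>" "lin (*) \<psi>" by (auto intro: linear_imp_lin)
    have lp: "lin (*) (\<lambda>x. \<phi> (p x))" "lin (*) (\<lambda>x. \<psi> (p x))"
      and lq: "lin (*) (\<lambda>x. \<phi> (q x))" "lin (*) (\<lambda>x. \<psi> (q x))"
      using l by (auto intro: lin_compose lin_p lin_q)
    have "(\<Sum>(a, b)\<leftarrow>ls'. \<phi> a * \<psi> b) = D x (\<lambda>a b. \<phi> (p a) * \<psi> b + \<phi> (q a) * \<psi> (p b))"
      unfolding sum
      by (rule D_eq[OF ls(1) xX, where s' = "(*)", symmetric])
         (intro bilinI lin_plus lin_times_left lin_times_right l lp lq)
    also have "D x (\<lambda>a b. \<phi> (q a) * \<psi> (q b)) = 0"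
      using x lq lin_0[OF l(1)] lin_0[OF l(2)] unfolding W_iff_functionals[OF xX] by auto
    then have "D x (\<lambda>a b. \<phi> (p a) * \<psi> b + \<phi> (q a) * \<psi> (p b))
        = D x (\<lambda>a b. (\<phi> (p a) * \<psi> b + \<phi> (q a) * \<psi> (p b)) + \<phi> (q a) * \<psi> (q b))"
      by (simp add: D_plus)
    also have "\<dots> = D x (\<lambda>a b. \<phi> a * \<psi> b)"
    proof (rule D_cong[OF xX])
      fix a b assume "a \<in> X" "b \<in> X"
      then have "\<phi> a = \<phi> (p a) + \<phi> (q a)" "\<psi> b = \<psi> (p b) + \<psi> (q b)"
        using lin_add[OF l(1), of "p a" "q a"] lin_add[OF l(2), of "p b" "q b"]
        by (simp_all flip: p_plus_q)
      then show "(\<phi> (p a) * \<psi> b + \<phi> (q a) * \<psi> (p b)) + \<phi> (q a) * \<psi> (q b) = \<phi> a * \<psi> b"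
        by (simp add: algebra_simps)
    qed
    finally show "(\<Sum>(a, b)\<leftarrow>ls'. \<phi> a * \<psi> b) = D x (\<lambda>a b. \<phi> a * \<psi> b)" .
  qed
  then show ?thesis using sub that by blast
qed

text \<open>The means of calculating modulo \<open>K\<close>: a bilinear identity on the wedge
  splits into the case of a left leg in \<open>K\<close> and that of a right leg in
  \<open>K\<close>, where \<open>p\<close> and \<open>q\<close> simplify.\<close>

lemma W_cong:
  assumes "x \<in> W" "bilin s' F" "bilin s' G"
    and "\<And>a b. a \<in> K \<Longrightarrow> b \<in> W \<Longrightarrow> F a b = G a b" "\<And>a b. a \<in> W \<Longrightarrow> b \<in> K \<Longrightarrow> F a b = G a b"
  shows "D x F = D x G"
proof -
  obtain ls where ls: "represents ls x" "set ls \<subseteq> K \<times> W \<union> W \<times> K"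
    using W_rep[OF assms(1)] .
  show ?thesis
    by (rule D_cong_rep[OF ls(1) _ assms(2,3)]) (use ls(2) assms(1,4,5) in auto)
qed

lemma W_mem:
  assumes "x \<in> W" "bilin s F" "V.subspace U"
    and "\<And>a b. a \<in> K \<Longrightarrow> b \<in> W \<Longrightarrow> F a b \<in> U" "\<And>a b. a \<in> W \<Longrightarrow> b \<in> K \<Longrightarrow> F a b \<in> U"
  shows "D x F \<in> U"
proof -
  obtain ls where ls: "represents ls x" "set ls \<subseteq> K \<times> W \<union> W \<times> K"
    using W_rep[OF assms(1)] .
  show ?thesis
    by (rule D_subspace_rep[OF ls(1) _ assms(2,3)]) (use ls(2) assms(1,4,5) in auto)
qed

lemma K_cong:
  assumes "x \<in> K" "bilin s' F" "bilin s' G" "\<And>a b. a \<in> K \<Longrightarrow> b \<in> K \<Longrightarrow> F a b = G a b"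
  shows "D x F = D x G"
proof -
  obtain ls where ls: "represents ls x" "set ls \<subseteq> K \<times> K"
    using K_rep[OF assms(1)] .
  show ?thesis
    by (rule D_cong_rep[OF ls(1) _ assms(2,3)]) (use ls(2) assms(1,4) in auto)
qed

lemma K_mem:
  assumes "x \<in> K" "bilin s F" "\<And>a b. a \<in> K \<Longrightarrow> b \<in> K \<Longrightarrow> F a b \<in> K"
  shows "D x F \<in> K"
proof -
  obtain ls where ls: "represents ls x" "set ls \<subseteq> K \<times> K"
    using K_rep[OF assms(1)] .
  show ?thesis
    by (rule D_subspace_rep[OF ls(1) _ assms(2) subspace_K]) (use ls(2) assms(1,3) in auto)
qed

lemma pw_K: "x \<in> K \<Longrightarrow> pw n x \<in> K"
proof (induction n arbitrary: x)
  case (Suc n)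
  show ?case
    unfolding pw_Suc conv_def
    by (rule K_mem[OF Suc.prems bilin_endos[OF endo_pw endo_id]]) (use Suc.IH in auto)
qed (simp add: pw_0)

lemma counit_pw: "x \<in> X \<Longrightarrow> \<epsilon> (pw n x) = \<epsilon> x"
proof (induction n arbitrary: x)
  case 0
  then show ?case using lin_scale[OF lin_counit] by (simp add: pw_0)
next
  case (Suc n)
  have "\<epsilon> (pw (Suc n) x) = D x (\<lambda>a b. \<epsilon> (pw n a \<odot> b))"
    unfolding pw_Suc conv_def by (rule lin_D_apply[OF lin_counit]) (use Suc.prems in auto)
  also have "\<dots> = D x (\<lambda>a b. \<epsilon> a * \<epsilon> b)"
    by (rule D_cong[OF Suc.prems]) (simp add: Suc.IH)
  also have "\<dots> = \<epsilon> x"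
    by (rule D_counit_left[OF Suc.prems lin_counit])
  finally show ?case .
qed

text \<open>
  The quotient \<open>W / K\<close> is a Hopf bimodule over \<open>K\<close>. The maps \<open>\<omega>\<close> and \<open>\<pi>\<close> induce its standard
  projections \<open>x \<mapsto> x\<^sub>(\<^sub>0\<^sub>) S x\<^sub>(\<^sub>1\<^sub>)\<close> and \<open>x \<mapsto> S x\<^sub>(\<^sub>-\<^sub>1\<^sub>) x\<^sub>(\<^sub>0\<^sub>)\<close> onto the right and
  the left coinvariants.
\<close>

definition \<omega> :: "'h \<Rightarrow> 'h" where
  "\<omega> x = D x (\<lambda>a b. q a \<odot> S (p b))"

definition \<pi> :: "'h \<Rightarrow> 'h" where
  "\<pi> x = D x (\<lambda>a b. S (p a) \<odot> q b)"

lemma bilin_\<omega>: "bilin s (\<lambda>a b. q a \<odot> S (p b))"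
  and bilin_\<pi>: "bilin s (\<lambda>a b. S (p a) \<odot> q b)"
  by (intro pair_rules; assumption)+

lemma \<omega>_X [simp, intro]: "x \<in> X \<Longrightarrow> \<omega> x \<in> X"
  and \<pi>_X [simp, intro]: "x \<in> X \<Longrightarrow> \<pi> x \<in> X"
  unfolding \<omega>_def \<pi>_def by (intro pair_rules; assumption)+

lemma lin_\<omega>: "lin s \<omega>" and lin_\<pi>: "lin s \<pi>"
  unfolding \<omega>_def[abs_def] \<pi>_def[abs_def] by (intro lin_D bilin_\<omega> bilin_\<pi>)+

lemma \<omega>_K [simp]: "x \<in> K \<Longrightarrow> \<omega> x = 0"
  unfolding \<omega>_def
  using K_cong[OF _ bilin_\<omega>, of x "\<lambda>a b. 0"] bilinI[OF lin_zero lin_zero, OF vs(1) vs(1)]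
  by (simp add: D_zero)

lemma \<pi>_K [simp]: "x \<in> K \<Longrightarrow> \<pi> x = 0"
  unfolding \<pi>_def
  using K_cong[OF _ bilin_\<pi>, of x "\<lambda>a b. 0"] bilinI[OF lin_zero lin_zero, OF vs(1) vs(1)]
  by (simp add: D_zero)

lemma \<omega>_W: "x \<in> W \<Longrightarrow> \<omega> x \<in> W"
  unfolding \<omega>_def by (rule W_mem[OF _ bilin_\<omega> subspace_W]) auto

text \<open>The Hopf module identity x_(0) S(x_(1)) x_(2) = x_(0): W / K is generated by the image
  of \<omega> as a right module over \<open>K\<close>.\<close>

lemma D_\<omega>:
  assumes x: "x \<in> W"
  shows "D x (\<lambda>a b. \<omega> a \<odot> p b) = q x"
proof -
  have xX: "x \<in> X" using x by auto
  have "D x (\<lambda>a b. \<omega> a \<odot> p b) = D x (\<lambda>a b. D a (\<lambda>c d. q c \<odot> S (p d) \<odot> p b))"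
    unfolding \<omega>_def
    by (rule D_cong[OF xX], rule lin_D_apply[where s' = s and f = "\<lambda>y. y \<odot> _"])
       (auto intro: lin_mult_left lin_mult_right)
  also have "\<dots> = D x (\<lambda>c y. D y (\<lambda>d b. q c \<odot> S (p d) \<odot> p b))"
    by (rule D_coassoc[OF xX, where s' = s], rule trilinI) (intro pair_rules; assumption)+
  also have "\<dots> = D x (\<lambda>c y. s (\<epsilon> y) (q c))"
  proof (rule W_cong[OF x, where s' = s])
    show "bilin s (\<lambda>c y. D y (\<lambda>d b. q c \<odot> S (p d) \<odot> p b))"
      by (intro pair_rules; assumption)
    show "bilin s (\<lambda>c y. s (\<epsilon> y) (q c))"
      by (intro bilinI lin_const_scale lin_scale_const lin_q lin_counit vs)
    fix c y
    show "D y (\<lambda>d b. q c \<odot> S (p d) \<odot> p b) = s (\<epsilon> y) (q c)" if "c \<in> K" "y \<in> W"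
      using that by (simp add: D_zero)
    show "D y (\<lambda>d b. q c \<odot> S (p d) \<odot> p b) = s (\<epsilon> y) (q c)" if c: "c \<in> W" and y: "y \<in> K"
    proof -
      have cX: "q c \<in> X" and yX: "y \<in> X" using c y by auto
      have f: "lin s (\<lambda>z. q c \<odot> z)" by (intro pair_rules cX)
      have "D y (\<lambda>d b. q c \<odot> S (p d) \<odot> p b) = D y (\<lambda>d b. q c \<odot> (S d \<odot> b))"
        by (rule K_cong[OF y, where s' = s]) (use cX in \<open>auto intro!: pair_rules simp: mult_assoc\<close>)
      also have "\<dots> = q c \<odot> (s (\<epsilon> y) \<one>)"
        using lin_D_apply[OF f yX, of "\<lambda>d b. S d \<odot> b"] D_antipode_left[OF yX] by simp
      finally show ?thesis using cX by (simp add: mult_scale_right)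
    qed
  qed
  also have "\<dots> = q x"
    by (rule D_counit_right[OF xX lin_q])
  finally show ?thesis .
qed

text \<open>The mirror image of \<open>D_\<omega>\<close> for the left coaction; it recovers a class
  from values of \<pi>.\<close>

lemma D_\<pi>:
  assumes x: "x \<in> W"
  shows "D x (\<lambda>a b. p a \<odot> \<pi> b) = q x"
proof -
  have xX: "x \<in> X" using x by auto
  have "D x (\<lambda>a b. p a \<odot> \<pi> b) = D x (\<lambda>a b. D b (\<lambda>c d. p a \<odot> (S (p c) \<odot> q d)))"
    unfolding \<pi>_def
    by (rule D_cong[OF xX], rule lin_D_apply[where s' = s and f = "\<lambda>y. _ \<odot> y"])
       (auto intro: lin_mult_left lin_mult_right)
  also have "\<dots> = D x (\<lambda>y d. D y (\<lambda>a c. p a \<odot> (S (p c) \<odot> q d)))"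
    by (rule D_coassoc[OF xX, where s' = s, symmetric], rule trilinI)
       (intro pair_rules; assumption)+
  also have "\<dots> = D x (\<lambda>y d. s (\<epsilon> y) (q d))"
  proof (rule W_cong[OF x, where s' = s])
    show "bilin s (\<lambda>y d. D y (\<lambda>a c. p a \<odot> (S (p c) \<odot> q d)))"
      by (intro pair_rules; assumption)
    show "bilin s (\<lambda>y d. s (\<epsilon> y) (q d))"
      by (intro bilinI lin_const_scale lin_scale_const lin_q lin_counit vs)
    fix d y
    show "D y (\<lambda>a c. p a \<odot> (S (p c) \<odot> q d)) = s (\<epsilon> y) (q d)" if "y \<in> W" "d \<in> K"
      using that by (simp add: D_zero)
    show "D y (\<lambda>a c. p a \<odot> (S (p c) \<odot> q d)) = s (\<epsilon> y) (q d)" if y: "y \<in> K" and d: "d \<in> W"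
    proof -
      have dX: "q d \<in> X" and yX: "y \<in> X" using d y by auto
      have f: "lin s (\<lambda>z. z \<odot> q d)" by (intro pair_rules dX)
      have "D y (\<lambda>a c. p a \<odot> (S (p c) \<odot> q d)) = D y (\<lambda>a c. a \<odot> S c \<odot> q d)"
        by (rule K_cong[OF y, where s' = s]) (use dX in \<open>auto intro!: pair_rules simp: mult_assoc\<close>)
      also have "\<dots> = s (\<epsilon> y) \<one> \<odot> q d"
        using lin_D_apply[OF f yX, of "\<lambda>a c. a \<odot> S c"] D_antipode_right[OF yX] by simp
      finally show ?thesis using dX by (simp add: mult_scale_left)
    qed
  qed
  also have "\<dots> = q x"
    by (rule D_counit_left[OF xX lin_q])
  finally show ?thesis .
qed

text \<open>Says that the right coaction of W / K sends the class of \<open>y\<close> to its product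
  with 1. Elements of the tensor product of W / K with \<open>K\<close> are tested by bilinear maps:
  vanishing for \<open>a\<close> in \<open>K\<close> makes \<open>G\<close> factor through the
  quotient, and \<open>p\<close> restricts the second argument to \<open>K\<close>.\<close>

definition coinvariant :: "'h \<Rightarrow> bool" where
  "coinvariant y \<longleftrightarrow> (\<forall>G. bilin s G \<longrightarrow> (\<forall>a\<in>K. \<forall>b\<in>X. G a b = 0) \<longrightarrow>
     D y (\<lambda>a b. G a (p b)) = G y \<one>)"

text \<open>The coaction of x_(0) S(x_(1)) is x_(0) S(x_(3)) \<otimes> x_(1) S(x_(2)), because
  \<open>S\<close> reverses coproducts; the inner pair then contracts to 1.\<close>

lemma coinvariant_\<omega>:
  assumes x: "x \<in> W"
  shows "coinvariant (\<omega> x)"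
  unfolding coinvariant_def
proof (intro allI impI)
  fix G :: "'h \<Rightarrow> 'h \<Rightarrow> 'h"
  assume G: "bilin s G" and "\<forall>a\<in>K. \<forall>b\<in>X. G a b = 0"
  then have G_K: "G a b = 0" if "a \<in> K" "b \<in> X" for a b using that by blast
  have xX: "x \<in> X" using x by auto
  have G1: "lin s (\<lambda>x. G a (f x))" if "a \<in> X" "lin s f" "\<And>x. x \<in> X \<Longrightarrow> f x \<in> X" for a f
    by (rule lin_compose[OF bilinD1[OF G that(1)] that(2,3)])
  have G2: "lin s (\<lambda>x. G (f x) a)" if "a \<in> X" "lin s f" "\<And>x. x \<in> X \<Longrightarrow> f x \<in> X" for a f
    by (rule lin_compose[OF bilinD2[OF G that(1)] that(2,3)])
  note rules = pair_rules G1 G2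
  let ?G = "\<lambda>a b. G a (p b)"
  have G': "bilin s ?G" by (intro rules; assumption)
  have G'_K: "D k ?G = 0" if "k \<in> K" for k
    using K_cong[OF that G', of "\<lambda>a b. 0"] bilinI[OF lin_zero lin_zero, OF vs(1) vs(1)] G_K
    by (simp add: D_zero)
  \<comment> \<open>The arguments \<open>c\<close>, \<open>d\<close>, \<open>e\<close>,
    \<open>f\<close> are the legs x_(0), x_(1), x_(2), x_(3) of that formula.\<close>
  let ?Q = "\<lambda>c d e f. G (q c \<odot> S (p f)) (p d \<odot> S (p e))"
  have "D (\<omega> x) ?G = D x (\<lambda>a b. D (q a \<odot> S (p b)) ?G)"
    unfolding \<omega>_def by (rule lin_D_apply[OF lin_D[OF G'] xX]) auto
  also have "\<dots> = D x (\<lambda>a b. D a (\<lambda>c d. D b (\<lambda>e f. ?Q c d e f)))"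
  proof (rule W_cong[OF x, where s' = s])
    show "bilin s (\<lambda>a b. D (q a \<odot> S (p b)) ?G)"
      by (rule bilinI; rule lin_D_fun[OF G']; intro rules; assumption)
    show "bilin s (\<lambda>a b. D a (\<lambda>c d. D b (\<lambda>e f. ?Q c d e f)))"
      by (intro rules; assumption)
    fix a b
    show "D (q a \<odot> S (p b)) ?G = D a (\<lambda>c d. D b (\<lambda>e f. ?Q c d e f))" if a: "a \<in> K" and b: "b \<in> W"
    proof -
      have "D a (\<lambda>c d. D b (\<lambda>e f. ?Q c d e f)) = D a (\<lambda>c d. 0)"
        by (rule K_cong[OF a, where s' = s])
           (use b in \<open>auto intro!: rules lin_zero simp: G_K D_zero\<close>)
      then show ?thesis
        using a G'_K[of 0] by (simp add: D_zero)
    qed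
    show "D (q a \<odot> S (p b)) ?G = D a (\<lambda>c d. D b (\<lambda>e f. ?Q c d e f))" if a: "a \<in> W" and b: "b \<in> K"
    proof -
      have aX: "a \<in> X" and bX: "b \<in> X" using a b by auto
      \<comment> \<open>Replacing \<open>q a\<close> by \<open>a\<close> changes the product by an
        element of \<open>K\<close>, which contributes nothing by \<open>G'_K\<close>; after that
        the coproduct can be expanded.\<close>
      have "D (q a \<odot> S (p b)) ?G = D (a \<odot> S b - p a \<odot> S b) ?G"
        using aX b by (simp add: q_def mult_diff_left)
      also have "\<dots> = D (a \<odot> S b) ?G"
        using lin_diff[OF lin_D[OF G'], of "a \<odot> S b" "p a \<odot> S b"] aX b G'_K[of "p a \<odot> S b"] by auto
      also have "\<dots> = D a (\<lambda>c d. D (S b) (\<lambda>e f. ?G (c \<odot> e) (d \<odot> f)))"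
        by (rule D_mult[OF aX _ G']) (use bX in auto)
      also have "\<dots> = D a (\<lambda>c d. D b (\<lambda>e f. ?G (c \<odot> S f) (d \<odot> S e)))"
        by (rule D_cong[OF aX], rule D_antipode[OF bX, where s' = s]) (intro rules; assumption)
      also have "\<dots> = D a (\<lambda>c d. D b (\<lambda>e f. ?Q c d e f))"
      proof (rule W_cong[OF a, where s' = s])
        show "bilin s (\<lambda>c d. D b (\<lambda>e f. ?G (c \<odot> S f) (d \<odot> S e)))"
          "bilin s (\<lambda>c d. D b (\<lambda>e f. ?Q c d e f))"
          by (intro rules bX; assumption)+
        fix c d
        show "D b (\<lambda>e f. ?G (c \<odot> S f) (d \<odot> S e)) = D b (\<lambda>e f. ?Q c d e f)" if "c \<in> K" "d \<in> W"
          by (rule K_cong[OF b, where s' = s]) (use that in \<open>auto intro!: rules lin_zero simp: G_K\<close>)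
        show "D b (\<lambda>e f. ?G (c \<odot> S f) (d \<odot> S e)) = D b (\<lambda>e f. ?Q c d e f)"
          if c: "c \<in> W" and d: "d \<in> K"
        proof (rule K_cong[OF b, where s' = s])
          show "bilin s (\<lambda>e f. ?G (c \<odot> S f) (d \<odot> S e))" "bilin s (\<lambda>e f. ?Q c d e f)"
            using c d by (auto intro!: rules)
          fix e f assume ef: "e \<in> K" "f \<in> K"
          have "G (p c \<odot> S f) (d \<odot> S e) = 0"
            using G_K ef d by auto
          then have "G (c \<odot> S f) (d \<odot> S e) = G (q c \<odot> S f) (d \<odot> S e)"
            using lin_diff[OF bilinD2[OF G], of "d \<odot> S e" "c \<odot> S f" "p c \<odot> S f"] c d ef
            by (auto simp: q_def mult_diff_left)
          then show "?G (c \<odot> S f) (d \<odot> S e) = ?Q c d e f"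
            using ef d by auto
        qed
      qed
      finally show ?thesis .
    qed
  qed
  \<comment> \<open>Brings x_(1) and x_(2) together, ready for contraction.\<close>
  also have "\<dots> = D x (\<lambda>c y. D y (\<lambda>z f. D z (\<lambda>d e. ?Q c d e f)))"
    by (intro D_coassoc4[OF xX, where s' = s] rules; assumption)
  also have "\<dots> = D x (\<lambda>c y. G (q c \<odot> S (p y)) \<one>)"
  proof (rule W_cong[OF x, where s' = s])
    show "bilin s (\<lambda>c y. D y (\<lambda>z f. D z (\<lambda>d e. ?Q c d e f)))"
      "bilin s (\<lambda>c y. G (q c \<odot> S (p y)) \<one>)"
      by (intro rules; assumption)+
    fix c y
    show "D y (\<lambda>z f. D z (\<lambda>d e. ?Q c d e f)) = G (q c \<odot> S (p y)) \<one>" if c: "c \<in> K" and y: "y \<in> W"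
    proof -
      have yX: "y \<in> X" using y by auto
      have "D y (\<lambda>z f. D z (\<lambda>d e. ?Q c d e f)) = D y (\<lambda>z f. D z (\<lambda>d e. 0))"
        by (rule D_cong[OF yX], rule D_cong) (use c in \<open>auto simp: G_K\<close>)
      then show ?thesis
        using c by (simp add: D_zero G_K)
    qed
    show "D y (\<lambda>z f. D z (\<lambda>d e. ?Q c d e f)) = G (q c \<odot> S (p y)) \<one>" if c: "c \<in> W" and y: "y \<in> K"
    proof -
      have cX: "q c \<in> X" and yX: "y \<in> X" using c y by auto
      have "D y (\<lambda>z f. D z (\<lambda>d e. ?Q c d e f)) = D y (\<lambda>z f. s (\<epsilon> z) (G (q c \<odot> S (p f)) \<one>))"
      proof (rule K_cong[OF y, where s' = s])
        show "bilin s (\<lambda>z f. D z (\<lambda>d e. ?Q c d e f))"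
          using cX by (auto intro!: rules)
        show "bilin s (\<lambda>z f. s (\<epsilon> z) (G (q c \<odot> S (p f)) \<one>))"
          using cX by (auto intro!: lin_const_scale lin_scale_const lin_counit rules)
        fix z f assume z: "z \<in> K" and f: "f \<in> K"
        let ?g = "\<lambda>w. G (q c \<odot> S (p f)) w"
        have g: "lin s ?g" using cX f by (auto intro!: rules)
        have "D z (\<lambda>d e. ?Q c d e f) = D z (\<lambda>d e. ?g (d \<odot> S e))"
          by (rule K_cong[OF z, where s' = s]) (use cX f in \<open>auto intro!: rules\<close>)
        also have "\<dots> = ?g (s (\<epsilon> z) \<one>)"
          using lin_D_apply[OF g, of z "\<lambda>d e. d \<odot> S e"] D_antipode_right[of z] z by auto
        finally show "D z (\<lambda>d e. ?Q c d e f) = s (\<epsilon> z) (?g \<one>)"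
          using lin_scale[OF g] by simp
      qed
      also have "\<dots> = G (q c \<odot> S (p y)) \<one>"
        by (rule D_counit_left[OF yX]) (use cX in \<open>auto intro!: rules\<close>)
      finally show ?thesis .
    qed
  qed
  also have "\<dots> = G (\<omega> x) \<one>"
    unfolding \<omega>_def by (rule lin_D_apply[OF bilinD2[OF G] xX, symmetric]) auto
  finally show "D (\<omega> x) ?G = G (\<omega> x) \<one>" .
qed

text \<open>
  On a right coinvariant \<open>y\<close>, the powers of the identity are
  \<open>y\<^sub>(\<^sub>1\<^sub>) \<cdots> y\<^sub>(\<^sub>m\<^sub>) = \<Sum>\<^sub>i\<^sub><\<^sub>m y\<^sub>(\<^sub>-\<^sub>i\<^sub>) \<cdots> y\<^sub>(\<^sub>-\<^sub>1\<^sub>) y\<^sub>(\<^sub>0\<^sub>)\<close> modulo \<open>K\<close>.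
\<close>

lemma left_invariant_pw:
  assumes T: "endo T" "\<And>x. x \<in> K \<Longrightarrow> T x = 0"
    "\<And>k x. k \<in> K \<Longrightarrow> x \<in> W \<Longrightarrow> T (k \<odot> x) = s (\<epsilon> k) (T x)"
    and y: "y \<in> W" "coinvariant y"
  shows "T (pw m y) = s (of_nat m) (T y)"
proof (induction m)
  case 0
  then show ?case by (simp add: pw_0 T(2))
next
  case (Suc m)
  have yX: "y \<in> X" using y by auto
  have lT: "lin s T" by (rule endo_lin[OF T(1)])
  have T_fun: "lin s (\<lambda>x. T (f x))" if "lin s f" "\<And>x. x \<in> X \<Longrightarrow> f x \<in> X" for f
    by (rule lin_compose[OF lT that])
  have pw_fun: "lin s (\<lambda>x. pw m (f x))" if "lin s f" "\<And>x. x \<in> X \<Longrightarrow> f x \<in> X" for f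
    by (rule endo_lin_fun[OF endo_pw that])
  note rules = pair_rules T_fun pw_fun pw_X
  have pw_q: "pw m (q x) = pw m x - pw m (p x)" if "x \<in> X" for x
    unfolding q_def using lin_diff[OF endo_lin[OF endo_pw], of x "p x"] that by simp
  have pw_0: "pw m 0 = 0"
    by (rule lin_0[OF endo_lin[OF endo_pw]])
  let ?G = "\<lambda>a b. T (pw m (q a) \<odot> b)"
  have "T (pw (Suc m) y) = D y (\<lambda>a b. T (pw m a \<odot> b))"
    unfolding pw_Suc conv_def by (rule lin_D_apply[OF lT yX]) auto
  \<comment> \<open>One summand for each kind of legs. For \<open>a\<close> in \<open>K\<close>,
    left invariance and \<open>counit_pw\<close> give the first, and \<open>q a = 0\<close> kills
    the second. For \<open>b\<close> in \<open>K\<close> the first is 0, and in the second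
    \<open>q a\<close> may stand for \<open>a\<close> because \<open>T\<close> vanishes on
    \<open>K\<close>.\<close>
  also have "\<dots> = D y (\<lambda>a b. s (\<epsilon> a) (T b) + ?G a (p b))"
  proof (rule W_cong[OF y(1), where s' = s])
    show "bilin s (\<lambda>a b. T (pw m a \<odot> b))"
      by (intro rules; assumption)
    show "bilin s (\<lambda>a b. s (\<epsilon> a) (T b) + ?G a (p b))"
      by (intro bilinI lin_plus lin_const_scale lin_scale_const lin_counit lT rules; assumption)
    fix a b
    show "T (pw m a \<odot> b) = s (\<epsilon> a) (T b) + ?G a (p b)" if "a \<in> K" "b \<in> W"
      using that by (simp add: T(2,3) pw_K counit_pw pw_0)
    show "T (pw m a \<odot> b) = s (\<epsilon> a) (T b) + ?G a (p b)" if "a \<in> W" "b \<in> K"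
    proof -
      have "T (pw m (p a) \<odot> b) = 0"
        using that by (intro T(2)) (auto intro: pw_K)
      moreover have "T (pw m (q a) \<odot> b) = T (pw m a \<odot> b) - T (pw m (p a) \<odot> b)"
        using that lin_diff[OF lT, of "pw m a \<odot> b" "pw m (p a) \<odot> b"]
        by (simp add: pw_q mult_diff_left)
      ultimately show ?thesis
        using that by (simp add: T(2))
    qed
  qed
  also have "\<dots> = T y + D y (\<lambda>a b. ?G a (p b))"
    unfolding D_plus using D_counit_left[OF yX lT] by simp
  \<comment> \<open>Coinvariance replaces the right leg by 1, which leaves the previous power of the
    identity.\<close>
  also have "D y (\<lambda>a b. ?G a (p b)) = ?G y \<one>"
  proof -
    have "bilin s ?G" by (intro rules; assumption)
    moreover have "\<forall>a\<in>K. \<forall>b\<in>X. ?G a b = 0"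
      using lin_0[OF lT] by (auto simp: pw_0)
    ultimately show ?thesis
      using y(2) unfolding coinvariant_def by blast
  qed
  also have "?G y \<one> = T (pw m y)"
    using yX lin_diff[OF lT, of "pw m y" "pw m (p y)"] T(2)[OF pw_K, of "p y"]
    by (simp add: pw_q)
  finally show ?case
    by (simp add: Suc.IH V.scale_left_distrib)
qed

text \<open>Modulo \<open>K\<close>, S(k_(1) m_(-1)) k_(2) m_(0) = S(m_(-1)) S(k_(1)) k_(2) m_(0),
  where the middle factors contract to \<epsilon>(k).\<close>

lemma q_\<pi>_left_invariant:
  assumes k: "k \<in> K" and m: "m \<in> W"
  shows "q (\<pi> (k \<odot> m)) = s (\<epsilon> k) (q (\<pi> m))"
proof -
  have kX: "k \<in> X" and mX: "m \<in> X" using k m by auto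
  let ?F = "\<lambda>a b. q (S (p a) \<odot> q b)"
  have F: "bilin s ?F" by (intro pair_rules; assumption)
  have q_\<pi>: "q (\<pi> x) = D x ?F" if "x \<in> X" for x
    unfolding \<pi>_def by (rule lin_D_apply[OF lin_q that]) auto
  have q_0: "q 0 = 0" by simp
  have "q (\<pi> (k \<odot> m)) = D k (\<lambda>c d. D m (\<lambda>a b. ?F (c \<odot> a) (d \<odot> b)))"
    using D_mult[OF kX mX F] q_\<pi> kX mX by simp
  also have "\<dots> = D k (\<lambda>c d. D m (\<lambda>a b. q (S (p a) \<odot> (S c \<odot> d) \<odot> q b)))"
  proof (rule K_cong[OF k, where s' = s])
    show "bilin s (\<lambda>c d. D m (\<lambda>a b. ?F (c \<odot> a) (d \<odot> b)))"
      "bilin s (\<lambda>c d. D m (\<lambda>a b. q (S (p a) \<odot> (S c \<odot> d) \<odot> q b)))"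
      by (intro pair_rules mX; assumption)+
    fix c d assume c: "c \<in> K" and d: "d \<in> K"
    show "D m (\<lambda>a b. ?F (c \<odot> a) (d \<odot> b)) = D m (\<lambda>a b. q (S (p a) \<odot> (S c \<odot> d) \<odot> q b))"
    proof (rule W_cong[OF m, where s' = s])
      show "bilin s (\<lambda>a b. ?F (c \<odot> a) (d \<odot> b))"
        "bilin s (\<lambda>a b. q (S (p a) \<odot> (S c \<odot> d) \<odot> q b))"
        using c d by (auto intro!: pair_rules)
      fix a b
      show "?F (c \<odot> a) (d \<odot> b) = q (S (p a) \<odot> (S c \<odot> d) \<odot> q b)" if a: "a \<in> K" and b: "b \<in> W"
      proof -
        have X: "a \<in> X" "b \<in> X" "c \<in> X" "d \<in> X" using a b c d by auto
        \<comment> \<open>The projection \<open>q\<close> commutes with left multiplication by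
          \<open>K\<close> only modulo \<open>K\<close>; the outer \<open>q\<close> absorbs the
          difference. This is why the lemma concerns q \<pi> and not \<pi>.\<close>
        have drop_q: "q (u \<odot> q v) = q (u \<odot> v)" if "u \<in> K" "v \<in> X" for u v
        proof -
          have "q (u \<odot> q v) = q (u \<odot> v) - q (u \<odot> p v)"
            using that lin_diff[OF lin_q, of "u \<odot> v" "u \<odot> p v"]
            by (auto simp: q_def[of v] mult_diff_right)
          also have "q (u \<odot> p v) = 0"
            using that by simp
          finally show ?thesis by simp
        qed
        have "?F (c \<odot> a) (d \<odot> b) = q (S (c \<odot> a) \<odot> q (d \<odot> b))"
          using a c by simp
        also have "\<dots> = q (S (c \<odot> a) \<odot> (d \<odot> b))"
          by (rule drop_q) (use X a c in auto)
        also have "\<dots> = q (S a \<odot> (S c \<odot> d) \<odot> b)"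
          using X by (simp add: S_mult mult_assoc)
        also have "\<dots> = q (S a \<odot> (S c \<odot> d) \<odot> q b)"
          by (rule drop_q[symmetric]) (use X a c d in auto)
        finally show ?thesis using a by simp
      qed
      show "?F (c \<odot> a) (d \<odot> b) = q (S (p a) \<odot> (S c \<odot> d) \<odot> q b)" if "a \<in> W" "b \<in> K"
        using that c d by simp
    qed
  qed
  also have "\<dots> = D m (\<lambda>a b. D k (\<lambda>c d. q (S (p a) \<odot> (S c \<odot> d) \<odot> q b)))"
    by (rule D_swap)
  also have "\<dots> = D m (\<lambda>a b. s (\<epsilon> k) (?F a b))"
  proof (rule D_cong[OF mX])
    fix a b assume a: "a \<in> X" and b: "b \<in> X"
    let ?f = "\<lambda>z. q (S (p a) \<odot> z \<odot> q b)"
    have f: "lin s ?f" using a b by (intro pair_rules)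
    have "D k (\<lambda>c d. ?f (S c \<odot> d)) = ?f (s (\<epsilon> k) \<one>)"
      using lin_D_apply[OF f kX, of "\<lambda>c d. S c \<odot> d"] D_antipode_left[OF kX] kX by simp
    then show "D k (\<lambda>c d. ?f (S c \<odot> d)) = s (\<epsilon> k) (?F a b)"
      using lin_scale[OF f] a b by simp
  qed
  also have "\<dots> = s (\<epsilon> k) (q (\<pi> m))"
    by (simp add: D_scale_out[OF vs(1)] q_\<pi>[OF mX])
  finally show ?thesis .
qed

lemma wedge_eq:
  assumes n: "of_nat n \<noteq> (0 :: 'k)" and pw: "\<And>x. x \<in> X \<Longrightarrow> pw n x = s (\<epsilon> x) \<one>"
  shows "W = K"
proof -
  have "q (\<pi> (\<omega> a \<odot> k)) = 0" if a: "a \<in> W" and k: "k \<in> K" for a k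
  proof -
    \<comment> \<open>The image of \<omega> generates the wedge modulo \<open>K\<close> only
      together with right multiplications by \<open>K\<close>, so the multiplier \<open>k\<close> is
      built into the left invariant map.\<close>
    let ?T = "\<lambda>y. q (\<pi> (y \<odot> k))"
    have y: "\<omega> a \<in> W" by (rule \<omega>_W[OF a])
    have "endo ?T"
      by (rule endoI)
         (use k in \<open>auto intro!: lin_q_fun lin_compose[OF lin_\<pi>] lin_mult_left\<close>)
    moreover have "?T x = 0" if "x \<in> K" for x
      using that k by simp
    moreover have "?T (h \<odot> x) = s (\<epsilon> h) (?T x)" if "h \<in> K" "x \<in> W" for h x
      using q_\<pi>_left_invariant[OF that(1), of "x \<odot> k"] that k by (simp add: mult_assoc)
    ultimately have "?T (pw n (\<omega> a)) = s (of_nat n) (?T (\<omega> a))"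
      by (rule left_invariant_pw[OF _ _ _ y coinvariant_\<omega>[OF a]])
    moreover have "?T (pw n (\<omega> a)) = 0"
      using pw[of "\<omega> a"] y k by simp
    ultimately show ?thesis
      using n by simp
  qed
  note T_0 = this
  have "q (\<pi> x) = 0" if x: "x \<in> W" for x
  proof -
    have xX: "x \<in> X" using x by auto
    have l: "lin s (\<lambda>y. q (\<pi> y))" by (intro lin_q_fun lin_\<pi> \<pi>_X)
    \<comment> \<open>By \<open>D_\<omega>\<close>, \<open>q x\<close> is a sum of the products just
      treated; legs \<open>a\<close> in \<open>K\<close> drop out as \<omega> vanishes
      there.\<close>
    have "q (\<pi> (q x)) = D x (\<lambda>a b. q (\<pi> (\<omega> a \<odot> p b)))"
      using lin_D_apply[OF l xX, of "\<lambda>a b. \<omega> a \<odot> p b"] D_\<omega>[OF x] by simp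
    also have "\<dots> = D x (\<lambda>a b. 0)"
    proof (rule W_cong[OF x, where s' = s])
      show "bilin s (\<lambda>a b. q (\<pi> (\<omega> a \<odot> p b)))"
        by (auto intro!: bilinI lin_compose[OF l] lin_mult_left lin_mult_right lin_\<omega> lin_p)
    qed (use T_0 in \<open>auto intro: bilinI lin_zero vs\<close>)
    finally have "q (\<pi> (q x)) = 0"
      by (simp add: D_zero)
    moreover have "q (\<pi> x) = q (\<pi> (p x)) + q (\<pi> (q x))"
      using lin_add[OF l, of "p x" "q x"] xX by (simp flip: p_plus_q)
    ultimately show ?thesis by simp
  qed
  then have \<pi>: "\<pi> x \<in> K" if "x \<in> W" for x
    using that q_eq_0D by blast
  have "x \<in> K" if x: "x \<in> W" for x
  proof -
    \<comment> \<open>By \<open>D_\<pi>\<close> this sum is \<open>q x\<close>, so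
      \<open>q x\<close> lies in \<open>K\<close> as soon as all values of \<pi> on \<open>W\<close>
      do.\<close>
    have "D x (\<lambda>a b. p a \<odot> \<pi> b) \<in> K"
    proof (rule W_mem[OF x _ subspace_K])
      show "bilin s (\<lambda>a b. p a \<odot> \<pi> b)"
        by (intro bilinI lin_mult_left lin_mult_right lin_p lin_\<pi> p_X \<pi>_X)
    qed (use \<pi> in auto)
    then have "p x + q x \<in> K"
      unfolding D_\<pi>[OF x] by (intro K_closed p_K)
    then show ?thesis by (simp flip: p_plus_q)
  qed
  then show ?thesis by auto
qed

end


context hopf
begin

section \<open>Simple right coideals lie in the coradical\<close>

text \<open>These are the right coideals, whose coproduct lies in U \<otimes> H, described by
  stability under the dual action.\<close>

definition rstable :: "'h set \<Rightarrow> bool" where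
  "rstable U \<longleftrightarrow> V.subspace U \<and> U \<subseteq> X \<and> (\<forall>x\<in>U. \<forall>\<phi>. lin (*) \<phi> \<longrightarrow> R \<phi> x \<in> U)"

definition rsimple :: "'h set \<Rightarrow> bool" where
  "rsimple U \<longleftrightarrow> rstable U \<and> U \<noteq> {0} \<and> (\<forall>T. rstable T \<and> T \<subseteq> U \<longrightarrow> T = {0} \<or> T = U)"

text \<open>Maps of right comodules from \<open>U\<close> to \<open>H\<close>. They are linear on
  all of \<open>X\<close>, so that composing with \<epsilon> gives a functional on \<open>X\<close>;
  compatibility with the coaction concerns \<open>U\<close> alone.\<close>

definition rmap :: "'h set \<Rightarrow> ('h \<Rightarrow> 'h) \<Rightarrow> bool" where
  "rmap U f \<longleftrightarrow> endo f \<and> (\<forall>x\<in>U. \<forall>\<phi>. lin (*) \<phi> \<longrightarrow> f (R \<phi> x) = R \<phi> (f x))"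

lemma rstableD:
  assumes "rstable U"
  shows "V.subspace U" "U \<subseteq> X" "x \<in> U \<Longrightarrow> lin (*) \<phi> \<Longrightarrow> R \<phi> x \<in> U" "x \<in> U \<Longrightarrow> x \<in> X" "0 \<in> U"
  using assms by (auto simp: rstable_def intro: V.subspace_0)

lemma rmapD:
  assumes "rmap U f"
  shows "endo f" "lin s f" "x \<in> X \<Longrightarrow> f x \<in> X" "x \<in> U \<Longrightarrow> lin (*) \<phi> \<Longrightarrow> f (R \<phi> x) = R \<phi> (f x)"
  using assms by (auto simp: rmap_def intro: endo_lin endo_X)

lemma rmap_L: "lin (*) \<phi> \<Longrightarrow> U \<subseteq> X \<Longrightarrow> rmap U (L \<phi>)"
  by (auto simp: rmap_def endo_def lin_L L_R_commute)

lemma rmap_comp: "rmap U f \<Longrightarrow> rmap T g \<Longrightarrow> f ` U \<subseteq> T \<Longrightarrow> rmap U (\<lambda>x. g (f x))"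
  unfolding rmap_def endo_def by (auto intro: lin_compose)

lemma rstable_X: "rstable X"
  using subspace_X by (auto simp: rstable_def)

lemma rstable_0: "rstable {0}"
  by (auto simp: rstable_def lin_0[OF lin_R] V.subspace_single_0)

lemma rstable_Int: "rstable U \<Longrightarrow> rstable T \<Longrightarrow> rstable (U \<inter> T)"
  by (auto simp: rstable_def V.subspace_inter)

lemma rstable_sum:
  assumes "rstable U" "rstable T"
  shows "rstable {x + y | x y. x \<in> U \<and> y \<in> T}"
  unfolding rstable_def
proof (intro conjI ballI allI impI)
  show "V.subspace {x + y | x y. x \<in> U \<and> y \<in> T}"
    by (rule V.subspace_sums) (use assms rstableD in auto)
  show "{x + y | x y. x \<in> U \<and> y \<in> T} \<subseteq> X"
    using rstableD(4)[OF assms(1)] rstableD(4)[OF assms(2)] by auto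
  fix z \<phi> assume "z \<in> {x + y | x y. x \<in> U \<and> y \<in> T}" and \<phi>: "lin (*) \<phi>"
  then obtain x y where z: "z = x + y" "x \<in> U" "y \<in> T" by auto
  have "R \<phi> z = R \<phi> x + R \<phi> y"
    unfolding z by (rule lin_add[OF lin_R[OF \<phi>]]) (use z rstableD assms in auto)
  then show "R \<phi> z \<in> {x + y | x y. x \<in> U \<and> y \<in> T}"
    using z rstableD(3)[OF assms(1) _ \<phi>] rstableD(3)[OF assms(2) _ \<phi>] by blast
qed

lemma rstable_image:
  assumes U: "rstable U" and f: "rmap U f"
  shows "rstable (f ` U)"
  unfolding rstable_def
proof (intro conjI ballI allI impI)
  note D = rstableD[OF U] rmapD[OF f]
  show "V.subspace (f ` U)"
  proof (rule V.subspaceI)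
    show "0 \<in> f ` U"
      using lin_0[OF rmapD(2)[OF f]] D(5) by force
    show "y + z \<in> f ` U" if "y \<in> f ` U" "z \<in> f ` U" for y z
    proof -
      from that obtain u v where uv: "u \<in> U" "v \<in> U" "y = f u" "z = f v" by auto
      then have "y + z = f (u + v)" "u + v \<in> U"
        using lin_add[OF rmapD(2)[OF f], of u v] D(4) V.subspace_add[OF D(1)] by auto
      then show ?thesis by blast
    qed
    show "s c y \<in> f ` U" if "y \<in> f ` U" for c y
    proof -
      from that obtain u where u: "u \<in> U" "y = f u" by auto
      then have "s c y = f (s c u)" "s c u \<in> U"
        using lin_scale[OF rmapD(2)[OF f], of u c] D(4) V.subspace_scale[OF D(1)] by auto
      then show ?thesis by blast
    qed
  qed
  show "f ` U \<subseteq> X" using D by auto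
  fix y \<phi> assume "y \<in> f ` U" and \<phi>: "lin (*) \<phi>"
  then obtain u where u: "u \<in> U" "y = f u" by auto
  then have "R \<phi> y = f (R \<phi> u)" "R \<phi> u \<in> U"
    using rmapD(4)[OF f _ \<phi>] rstableD(3)[OF U _ \<phi>] by auto
  then show "R \<phi> y \<in> f ` U" by blast
qed

lemma rstable_vimage:
  assumes U: "rstable U" and T: "rstable T" and f: "rmap U f"
  shows "rstable {u \<in> U. f u \<in> T}"
  unfolding rstable_def
proof (intro conjI ballI allI impI)
  note D = rstableD[OF U]
  show "V.subspace {u \<in> U. f u \<in> T}"
    by (rule V.subspaceI)
       (use D(4) in \<open>auto simp: lin_0[OF rmapD(2)[OF f]] lin_add[OF rmapD(2)[OF f]]
          lin_scale[OF rmapD(2)[OF f]] V.subspace_0[OF D(1)] V.subspace_add[OF D(1)]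
          V.subspace_scale[OF D(1)] rstableD(5)[OF T] V.subspace_add[OF rstableD(1)[OF T]]
          V.subspace_scale[OF rstableD(1)[OF T]]\<close>)
  show "{u \<in> U. f u \<in> T} \<subseteq> X" using D(2) by auto
  show "R \<phi> u \<in> {u \<in> U. f u \<in> T}" if "u \<in> {u \<in> U. f u \<in> T}" "lin (*) \<phi>" for u \<phi>
    using that D(3) rstableD(3)[OF T] rmapD(4)[OF f] by auto
qed

text \<open>Schur's lemma: the kernel in \<open>U\<close> is a right coideal, and it is not all of
  \<open>U\<close>.\<close>

lemma rsimple_rmap_inj:
  assumes U: "rsimple U" and f: "rmap U f" and nz: "u \<in> U" "f u \<noteq> 0" and v: "v \<in> U" "f v = 0"
  shows "v = 0"
proof -
  have "rstable {u \<in> U. f u \<in> {0}}"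
    using U by (intro rstable_vimage rstable_0 f) (simp add: rsimple_def)
  then have "{u \<in> U. f u \<in> {0}} = {0} \<or> {u \<in> U. f u \<in> {0}} = U"
    using U unfolding rsimple_def by blast
  then show ?thesis using nz v by auto
qed

lemma rsimple_image:
  assumes U: "rsimple U" and f: "rmap U f" and nz: "u \<in> U" "f u \<noteq> 0"
  shows "rsimple (f ` U)"
  unfolding rsimple_def
proof (intro conjI allI impI)
  have rU: "rstable U" using U by (simp add: rsimple_def)
  show "rstable (f ` U)" by (rule rstable_image[OF rU f])
  show "f ` U \<noteq> {0}" using nz by auto
  fix T assume T: "rstable T \<and> T \<subseteq> f ` U"
  then have "rstable {u \<in> U. f u \<in> T}"
    by (intro rstable_vimage rU f) simp
  then have "{u \<in> U. f u \<in> T} = {0} \<or> {u \<in> U. f u \<in> T} = U"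
    using U unfolding rsimple_def by blast
  moreover have "T = f ` {u \<in> U. f u \<in> T}" using T by auto
  ultimately show "T = {0} \<or> T = f ` U"
    using lin_0[OF rmapD(2)[OF f]] by auto
qed

text \<open>Right comodule maps between right coideals \<open>U \<subseteq> H\<close> are given by the left action of the
  functional \<open>\<epsilon> \<circ> f\<close>.\<close>

lemma rmap_eq_L:
  assumes U: "rstable U" and f: "rmap U f"
  obtains \<psi> where "lin (*) \<psi>" "\<And>u. u \<in> U \<Longrightarrow> f u = L \<psi> u"
proof
  let ?\<psi> = "\<lambda>x. \<epsilon> (f x)"
  show \<psi>: "lin (*) ?\<psi>"
    by (intro lin_counit_fun rmapD(2)[OF f] rmapD(3)[OF f])
  show "f u = L ?\<psi> u" if u: "u \<in> U" for u
  proof (rule functionals_separate)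
    fix \<phi> assume "Vector_Spaces.linear s (*) \<phi>"
    then have \<phi>: "lin (*) \<phi>" by (rule linear_imp_lin)
    have uX: "u \<in> X" using rstableD(4)[OF U u] .
    have "\<phi> (L ?\<psi> u) = \<epsilon> (f (R \<phi> u))"
      by (rule functional_L_R[OF uX \<psi> \<phi>])
    also have "\<dots> = \<epsilon> (R \<phi> (f u))"
      by (simp add: rmapD(4)[OF f u \<phi>])
    also have "\<dots> = \<phi> (L \<epsilon> (f u))"
      by (rule functional_L_R[OF rmapD(3)[OF f uX] lin_counit \<phi>, symmetric])
    finally show "\<phi> (f u) = \<phi> (L ?\<psi> u)"
      by (simp add: L_counit rmapD(3)[OF f uX])
  qed
qed

text \<open>A linear left inverse of an injective comodule map respects the coaction on the image
  automatically.\<close>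

lemma rmap_left_inverse:
  assumes U: "rstable U" and f: "rmap U f" and inj: "\<And>u. u \<in> U \<Longrightarrow> f u = 0 \<Longrightarrow> u = 0"
  obtains g where "rmap (f ` U) g" "\<And>u. u \<in> U \<Longrightarrow> g (f u) = u"
proof -
  interpret VV: vector_space_pair s s by unfold_locales
  \<comment> \<open>Precomposing with \<open>P\<close> extends \<open>f\<close> from
    \<open>X\<close> to a map linear on the whole type, as the extension theorem for left inverses
    expects.\<close>
  obtain P where P: "Vector_Spaces.linear s s P" "\<And>x. P x \<in> X" "\<And>x. x \<in> X \<Longrightarrow> P x = x"
    using projection_exists[OF subspace_X] by blast
  have lfP: "Vector_Spaces.linear s s (\<lambda>x. f (P x))"
    using P rmapD(2)[OF f] by (simp add: Vector_Spaces.linear_iff vs(1) lin_add lin_scale)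
  have "inj_on (\<lambda>x. f (P x)) U"
  proof (rule inj_onI)
    fix u v assume uv: "u \<in> U" "v \<in> U" "f (P u) = f (P v)"
    then have "f (u - v) = 0" "u - v \<in> U"
      using lin_diff[OF rmapD(2)[OF f], of u v] rstableD(4)[OF U] P(3)
        V.subspace_diff[OF rstableD(1)[OF U]] by auto
    then show "u = v" using inj[of "u - v"] by simp
  qed
  then obtain g where g: "range g \<subseteq> U" "Vector_Spaces.linear s s g" "\<forall>u\<in>U. g (f (P u)) = u"
    using VV.linear_exists_left_inverse_on[OF lfP rstableD(1)[OF U]] by blast
  have gf: "g (f u) = u" if "u \<in> U" for u
    using g(3) that P(3) rstableD(4)[OF U] by auto
  have "rmap (f ` U) g"
    unfolding rmap_def
  proof (intro conjI ballI allI impI)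
    show "endo g"
      using g(1,2) rstableD(2)[OF U] by (auto intro: endoI linear_imp_lin)
    fix y \<phi> assume "y \<in> f ` U" and \<phi>: "lin (*) \<phi>"
    then obtain u where u: "u \<in> U" "y = f u" by auto
    have "g (R \<phi> y) = g (f (R \<phi> u))"
      using rmapD(4)[OF f u(1) \<phi>] u by simp
    then show "g (R \<phi> y) = R \<phi> (g y)"
      using gf u rstableD(3)[OF U u(1) \<phi>] by simp
  qed
  then show ?thesis using gf that by blast
qed

end

locale finite_dim_hopf = hopf H S
  for H :: "('k::field, 'h::ab_group_add) hopf_data" (structure) and S +
  assumes finite_dim: "hfinite_dim H"
begin

section \<open>Simple right coideals generate simple subcoalgebras\<close>

lemma dim_bounded: "\<exists>b. \<forall>U. U \<subseteq> X \<longrightarrow> V.dim U < b"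
proof -
  obtain B where "finite B" "X = V.span B"
    using finite_dim by (auto simp: hfinite_dim_def)
  then have "V.dim U < Suc (card B)" if "U \<subseteq> X" for U
    using V.dim_le_card[of U B] that by auto
  then show ?thesis by blast
qed

lemma dim_strict_mono:
  assumes "V.subspace U" "V.subspace T" "U \<subset> T" "T \<subseteq> X"
  shows "V.dim U < V.dim T"
proof -
  obtain B where B: "finite B" "X = V.span B"
    using finite_dim by (auto simp: hfinite_dim_def)
  obtain BU where BU: "BU \<subseteq> U" "V.independent BU" "U \<subseteq> V.span BU"
    by (rule V.maximal_independent_subset)
  obtain BT where BT: "BU \<subseteq> BT" "BT \<subseteq> T" "V.independent BT" "T \<subseteq> V.span BT"
    using V.maximal_independent_subset_extend[of BU T] BU assms(3) by blast
  have "finite BT"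
    using V.independent_span_bound[OF B(1) BT(3)] BT(2) assms(4) B(2) by auto
  moreover have "BU \<noteq> BT"
  proof
    assume "BU = BT"
    then have "T \<subseteq> V.span BU" using BT by simp
    also have "\<dots> \<subseteq> U" by (rule V.span_minimal[OF BU(1) assms(1)])
    finally show False using assms(3) by blast
  qed
  ultimately have "card BU < card BT"
    using BT(1) by (intro psubset_card_mono) auto
  then show ?thesis
    using V.basis_card_eq_dim[OF BU(1,3,2)] V.basis_card_eq_dim[OF BT(2,4,3)] by simp
qed

lemma rsimple_span_bistable:
  assumes U: "rsimple U"
  defines "C \<equiv> V.span (\<Union>\<phi>\<in>{\<phi>. lin (*) \<phi>}. L \<phi> ` U)"
  shows "bistable C" "U \<subseteq> C" and "\<And>E. bistable E \<Longrightarrow> E \<subseteq> C \<Longrightarrow> E \<noteq> {0} \<Longrightarrow> E = C"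
proof -
  have rU: "rstable U" and UX: "U \<subseteq> X"
    using U rstableD by (auto simp: rsimple_def)
  have gen: "L \<phi> u \<in> C" if "lin (*) \<phi>" "u \<in> U" for \<phi> u
    unfolding C_def by (rule V.span_base) (use that in blast)
  have subC: "V.subspace C" by (simp add: C_def)
  have CX: "C \<subseteq> X"
    unfolding C_def by (rule V.span_minimal[OF _ subspace_X]) (use UX in auto)
  have stable: "f x \<in> C" if f: "endo f" "\<And>\<phi> u. lin (*) \<phi> \<Longrightarrow> u \<in> U \<Longrightarrow> f (L \<phi> u) \<in> C" and x: "x \<in> C"
    for f x
  proof -
    have "V.subspace {x \<in> X. f x \<in> C}"
      by (rule V.subspaceI)
         (auto simp: lin_0[OF endo_lin[OF f(1)]] lin_add[OF endo_lin[OF f(1)]]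
            lin_scale[OF endo_lin[OF f(1)]] V.subspace_0[OF subC] V.subspace_add[OF subC]
            V.subspace_scale[OF subC])
    moreover have "(\<Union>\<phi>\<in>{\<phi>. lin (*) \<phi>}. L \<phi> ` U) \<subseteq> {x \<in> X. f x \<in> C}"
      using f(2) UX by auto
    ultimately have "C \<subseteq> {x \<in> X. f x \<in> C}"
      unfolding C_def by (intro V.span_minimal)
    then show ?thesis using x by auto
  qed
  show "bistable C"
    unfolding bistable_def
  proof (intro conjI ballI allI impI subC CX)
    fix x \<phi> assume x: "x \<in> C" and \<phi>: "lin (*) \<phi>"
    show "L \<phi> x \<in> C"
    proof (rule stable[OF _ _ x])
      show "endo (L \<phi>)" using lin_L[OF \<phi>] by (simp add: endo_def)
      fix \<psi> u assume "lin (*) \<psi>" "u \<in> U"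
      then show "L \<phi> (L \<psi> u) \<in> C"
        using L_L[OF _ \<phi>] UX gen lin_D_functionals[OF _ \<phi>] by auto
    qed
    show "R \<phi> x \<in> C"
    proof (rule stable[OF _ _ x])
      show "endo (R \<phi>)" using lin_R[OF \<phi>] by (simp add: endo_def)
      fix \<psi> u assume "lin (*) \<psi>" "u \<in> U"
      moreover from this have "L \<psi> (R \<phi> u) = R \<phi> (L \<psi> u)"
        using UX by (intro L_R_commute \<phi>) auto
      ultimately show "R \<phi> (L \<psi> u) \<in> C"
        using gen[of \<psi> "R \<phi> u"] rstableD(3)[OF rU _ \<phi>] by simp
    qed
  qed
  show "U \<subseteq> C"
  proof
    fix u assume "u \<in> U"
    then show "u \<in> C" using gen[OF lin_counit, of u] L_counit[of u] UX by auto
  qed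
  fix E assume E: "bistable E" "E \<subseteq> C" "E \<noteq> {0}"
  have rE: "rstable E" and EX: "E \<subseteq> X" using E(1) by (auto simp: bistable_def rstable_def)
  \<comment> \<open>A right coideal \<open>E'\<close> of greatest dimension with this property will
    be the complement of \<open>E\<close>.\<close>
  define Q where "Q T \<longleftrightarrow> rstable T \<and> T \<subseteq> C \<and> E \<inter> T = {0}" for T
  have "Q {0}"
    using rstable_0 rstableD(5)[OF rE] V.subspace_0[OF subC] by (auto simp: Q_def)
  moreover obtain b where b: "\<forall>T. T \<subseteq> X \<longrightarrow> V.dim T < b"
    using dim_bounded by blast
  then have "\<forall>T. Q T \<longrightarrow> V.dim T < b"
    using CX unfolding Q_def by (meson subset_trans)
  ultimately obtain E' where E': "Q E'" and max: "\<And>T. Q T \<Longrightarrow> V.dim T \<le> V.dim E'"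
    using ex_has_greatest_nat[of Q "{0}" V.dim b] by blast
  have rE': "rstable E'" and E'C: "E' \<subseteq> C" and disj: "E \<inter> E' = {0}"
    using E' by (auto simp: Q_def)
  let ?EE = "{x + y | x y. x \<in> E \<and> y \<in> E'}"
  have rEE: "rstable ?EE" by (rule rstable_sum[OF rE rE'])
  have E_EE: "E \<subseteq> ?EE" and E'_EE: "E' \<subseteq> ?EE"
    using rstableD(5)[OF rE] rstableD(5)[OF rE'] by force+
  have "L \<phi> u \<in> ?EE" if \<phi>: "lin (*) \<phi>" and u: "u \<in> U" for \<phi> u
  proof (rule ccontr)
    assume not: "L \<phi> u \<notin> ?EE"
    have f: "rmap U (L \<phi>)" by (rule rmap_L[OF \<phi> UX])
    have "L \<phi> u \<noteq> 0" using not rstableD(5)[OF rEE] by metis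
    then have simple: "rsimple (L \<phi> ` U)"
      by (rule rsimple_image[OF U f u])
    then have rI: "rstable (L \<phi> ` U)" by (simp add: rsimple_def)
    have "rstable (L \<phi> ` U \<inter> ?EE)" by (rule rstable_Int[OF rI rEE])
    then have Int: "L \<phi> ` U \<inter> ?EE = {0}"
      using simple not u unfolding rsimple_def by blast
    let ?T = "{x + y | x y. x \<in> E' \<and> y \<in> L \<phi> ` U}"
    have rT: "rstable ?T" by (rule rstable_sum[OF rE' rI])
    have "Q ?T"
      unfolding Q_def
    proof (intro conjI rT)
      show "?T \<subseteq> C" using E'C gen[OF \<phi>] V.subspace_add[OF subC] by auto
      show "E \<inter> ?T = {0}"
      proof
        show "{0} \<subseteq> E \<inter> ?T" using rstableD(5)[OF rE] rstableD(5)[OF rT] by blast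
        show "E \<inter> ?T \<subseteq> {0}"
        proof
          fix e assume "e \<in> E \<inter> ?T"
          then obtain x y where e: "e \<in> E" "e = x + y" "x \<in> E'" "y \<in> L \<phi> ` U" by blast
          then have "y = e + - x" "- x \<in> E'"
            using V.subspace_neg[OF rstableD(1)[OF rE']] by simp_all
          then have "y \<in> ?EE" using e(1) by blast
          then have "y = 0" using Int e(4) by blast
          then have "e \<in> E \<inter> E'" using e by simp
          then show "e \<in> {0}" using disj by simp
        qed
      qed
    qed
    moreover have "E' \<subset> ?T"
    proof
      show "E' \<subseteq> ?T" using rstableD(5)[OF rI] by force
      have "L \<phi> u = 0 + L \<phi> u" by simp
      then have "L \<phi> u \<in> ?T" using u rstableD(5)[OF rE'] by blast
      then show "E' \<noteq> ?T" using not E'_EE by blast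
    qed
    ultimately show False
      using max[of ?T] dim_strict_mono[OF rstableD(1)[OF rE'] rstableD(1)[OF rT] _ rstableD(2)[OF rT]]
      by (simp add: not_less[symmetric])
  qed
  then have C_EE: "C \<subseteq> ?EE"
    unfolding C_def by (intro V.span_minimal rstableD(1)[OF rEE]) auto
  interpret VV: vector_space_pair s s by unfold_locales
  \<comment> \<open>Prepares the projection \<open>G\<close> of E + E' onto \<open>E\<close> along
    \<open>E'\<close>. The map x - P x kills \<open>E'\<close> and is injective on \<open>E\<close>;
    \<open>G\<close> is that map followed by a left inverse.\<close>
  obtain P where P: "Vector_Spaces.linear s s P" "\<And>x. P x \<in> E'" "\<And>x. x \<in> E' \<Longrightarrow> P x = x"
    using projection_exists[OF rstableD(1)[OF rE']] by blast
  have lP: "Vector_Spaces.linear s s (\<lambda>x. x - P x)"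
    by (intro VV.linear_compose_sub P(1) V.linear_ident)
  have "inj_on (\<lambda>x. x - P x) E"
  proof (rule inj_onI)
    fix x y assume xy: "x \<in> E" "y \<in> E" "x - P x = y - P y"
    have "x - y = P x - P y" using xy(3) by (simp add: algebra_simps)
    then have "x - y \<in> E \<inter> E'"
      using V.subspace_diff[OF rstableD(1)[OF rE] xy(1,2)]
        V.subspace_diff[OF rstableD(1)[OF rE'] P(2) P(2)] by auto
    then show "x = y" using disj by simp
  qed
  then obtain g where g: "range g \<subseteq> E" "Vector_Spaces.linear s s g" "\<forall>x\<in>E. g (x - P x) = x"
    using VV.linear_exists_left_inverse_on[OF lP rstableD(1)[OF rE]] by blast
  define G where "G x = g (x - P x)" for x
  have G_E: "G x = x" if "x \<in> E" for x using g(3) that by (simp add: G_def)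
  have G_E': "G x = 0" if "x \<in> E'" for x
    using P(3)[OF that] VV.linear_0[OF g(2)] by (simp add: G_def)
  have lG: "Vector_Spaces.linear s s G"
    using Vector_Spaces.linear_compose[OF lP g(2)] by (simp add: G_def[abs_def] o_def)
  have G_in: "G x \<in> E" for x using g(1) by (auto simp: G_def)
  have G_add: "G (x + y) = x" if "x \<in> E" "y \<in> E'" for x y
    using that G_E G_E' lG by (simp add: Vector_Spaces.linear_iff vs(1))
  have rG: "rmap ?EE G"
    unfolding rmap_def
  proof (intro conjI ballI allI impI)
    show "endo G" using G_in EX by (auto intro: endoI linear_imp_lin lG)
    fix z \<phi> assume "z \<in> ?EE" and \<phi>: "lin (*) \<phi>"
    then obtain x y where z: "z = x + y" "x \<in> E" "y \<in> E'" by blast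
    have "R \<phi> z = R \<phi> x + R \<phi> y"
      unfolding z(1) by (rule lin_add[OF lin_R[OF \<phi>]]) (use z rstableD rE rE' in auto)
    then show "G (R \<phi> z) = R \<phi> (G z)"
      using z G_add rstableD(3)[OF rE _ \<phi>] rstableD(3)[OF rE' _ \<phi>] by simp
  qed
  have "\<exists>\<phi> u. lin (*) \<phi> \<and> u \<in> U \<and> G (L \<phi> u) \<noteq> 0"
  proof (rule ccontr)
    assume "\<not> ?thesis"
    then have "G (L \<phi> u) = 0" if "lin (*) \<phi>" "u \<in> U" for \<phi> u
      using that by blast
    moreover have "V.subspace {x. G x = 0}"
      by (rule V.subspaceI) (use lG VV.linear_0[OF lG] in \<open>auto simp: Vector_Spaces.linear_iff vs(1)\<close>)
    ultimately have "C \<subseteq> {x. G x = 0}"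
      unfolding C_def by (intro V.span_minimal) auto
    then have "E \<subseteq> {0}" using E(2) G_E by auto
    then show False using E(3) rstableD(5)[OF rE] by blast
  qed
  then obtain \<phi> u where \<phi>: "lin (*) \<phi>" and u: "u \<in> U" "G (L \<phi> u) \<noteq> 0"
    by blast
  have "L \<phi> ` U \<subseteq> ?EE" using gen[OF \<phi>] C_EE by blast
  then have f: "rmap U (\<lambda>x. G (L \<phi> x))"
    by (rule rmap_comp[OF rmap_L[OF \<phi> UX] rG])
  \<comment> \<open>Schur's lemma makes the map x \<mapsto> G (L \<phi> x) injective on
    \<open>U\<close>. Its inverse is a comodule map, hence of the form \<open>L \<psi>\<close>, and
    carries elements of \<open>E\<close> back to \<open>U\<close>.\<close>
  obtain h where h: "rmap ((\<lambda>x. G (L \<phi> x)) ` U) h" "\<And>u. u \<in> U \<Longrightarrow> h (G (L \<phi> u)) = u"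
    using rmap_left_inverse[OF rU f] rsimple_rmap_inj[OF U f u] by blast
  obtain \<psi> where \<psi>: "lin (*) \<psi>" "\<And>x. x \<in> (\<lambda>x. G (L \<phi> x)) ` U \<Longrightarrow> h x = L \<psi> x"
    using rmap_eq_L[OF rstable_image[OF rU f] h(1)] by blast
  have "U \<subseteq> E"
  proof
    fix v assume v: "v \<in> U"
    then have "v = L \<psi> (G (L \<phi> v))" using h(2) \<psi>(2) by force
    then show "v \<in> E" using E(1) \<psi>(1) G_in unfolding bistable_def by metis
  qed
  then have "C \<subseteq> E"
    unfolding C_def using E(1) by (intro V.span_minimal) (auto simp: bistable_def)
  then show "E = C" using E(2) by blast
qed

lemma rsimple_coradical:
  assumes "rsimple U" shows "U \<subseteq> coradical H"
proof -
  let ?C = "V.span (\<Union>\<phi>\<in>{\<phi>. lin (*) \<phi>}. L \<phi> ` U)"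
  note C = rsimple_span_bistable[OF assms]
  have "U \<noteq> {0}" "0 \<in> U"
    using assms rstableD(5) by (auto simp: rsimple_def)
  then have "?C \<noteq> {0}" using C(2) by blast
  then have "simple_subcoalgebra H ?C"
    using C by (auto simp: simple_subcoalgebra_def subcoalgebra_iff_bistable)
  then have "?C \<subseteq> coradical H"
    unfolding coradical_def by (intro subset_trans[OF _ V.span_superset]) blast
  then show ?thesis using C(2) by blast
qed

end

section \<open>Idempotency of the wedge\<close>

locale finite_dim_hopf_pair = hopf_pair H S K + finite_dim_hopf H S
  for H :: "('k::field, 'h::ab_group_add) hopf_data" (structure) and S K
begin

text \<open>A right coideal \<open>T\<close> of minimal dimension not contained in \<open>K\<close> lies in the wedge, because
  \<open>T / (T \<inter> K)\<close> is a simple comodule, whose coefficients lie in simple subcoalgebras.\<close>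

lemma wedge_eq_imp_all:
  assumes simple: "\<And>U. rsimple U \<Longrightarrow> U \<subseteq> K" and wedge: "W = K"
  shows "X = K"
proof (rule ccontr)
  assume "X \<noteq> K"
  then have "rstable X \<and> \<not> X \<subseteq> K"
    using rstable_X by auto
  then obtain T where T: "rstable T" "\<not> T \<subseteq> K"
    and min: "\<And>U. rstable U \<Longrightarrow> \<not> U \<subseteq> K \<Longrightarrow> V.dim T \<le> V.dim U"
    using ex_has_least_nat[of "\<lambda>U. rstable U \<and> \<not> U \<subseteq> K" X V.dim] by blast
  have L_K: "L \<phi> ` T \<subseteq> K" if \<phi>: "lin (*) \<phi>" "\<forall>k\<in>K. \<phi> k = 0" for \<phi>
  proof (cases "L \<phi> ` T = {0}")
    case False
    have f: "rmap T (L \<phi>)" by (rule rmap_L[OF \<phi>(1) rstableD(2)[OF T(1)]])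
    have "rsimple (L \<phi> ` T)"
      unfolding rsimple_def
    proof (intro conjI allI impI rstable_image[OF T(1) f] False)
      fix U assume U: "rstable U \<and> U \<subseteq> L \<phi> ` T"
      let ?U = "{t \<in> T. L \<phi> t \<in> U}"
      have rU: "rstable ?U" using U by (intro rstable_vimage T f) simp
      have U_eq: "U = L \<phi> ` ?U" using U by auto
      show "U = {0} \<or> U = L \<phi> ` T"
      proof (cases "?U = T")
        case True
        then show ?thesis using U_eq by simp
      next
        case False
        then have "?U \<subset> T" by blast
        then have "V.dim ?U < V.dim T"
          using dim_strict_mono rstableD(1)[OF rU] rstableD(1,2)[OF T(1)] by blast
        then have UK: "?U \<subseteq> K" using min[OF rU] by linarith
        have "L \<phi> k = 0" if k: "k \<in> K" for k
          unfolding L_def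
          using K_cong[OF k bilin_L[OF \<phi>(1)], of "\<lambda>a b. 0"] \<phi>(2)
            bilinI[OF lin_zero lin_zero, OF vs(1) vs(1)]
          by (simp add: D_zero)
        then have "L \<phi> ` ?U \<subseteq> {0}" using UK by auto
        then have "U \<subseteq> {0}" by (subst U_eq)
        then show ?thesis using U rstableD(5) by blast
      qed
    qed
    then show ?thesis by (rule simple)
  qed auto
  have "T \<subseteq> W"
  proof
    fix t assume t: "t \<in> T"
    then have tX: "t \<in> X" using rstableD(4)[OF T(1)] by blast
    show "t \<in> W"
      unfolding W_iff_functionals[OF tX]
    proof (intro allI impI)
      fix \<phi> \<psi> assume \<phi>: "lin (*) \<phi>" and \<psi>: "lin (*) \<psi>" and 0: "\<forall>k\<in>K. \<phi> k = 0 \<and> \<psi> k = 0"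
      \<comment> \<open>The Sweedler sum to be shown zero is \<psi>(L \<phi> t), and \<psi> vanishes
        on \<open>K\<close>.\<close>
      then have "L \<phi> t \<in> K" using L_K[of \<phi>] t by blast
      then show "D t (\<lambda>a b. \<phi> a * \<psi> b) = 0"
        using lin_apply_L[OF \<psi> tX, of \<phi>] 0 by simp
    qed
  qed
  then show False using T(2) wedge by simp
qed

end

theorem proposition4p2:
  fixes H :: "('k::field, 'h::ab_group_add) hopf_data"
  assumes "hopf_algebra H" and "hfinite_dim H" and "dual_chevalley H"
  shows "(\<not> cosemisimple H \<and> CHAR('k) = 0 \<longrightarrow> exp0 H = \<infinity>) \<and>
    (\<forall>p N M. CHAR('k) = p \<and> p > 0 \<and>
       exp0 (restrict_hopf H (coradical H)) = enat N \<and>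
       M > 0 \<and> loewy_length H \<le> enat (p ^ M) \<longrightarrow>
       (\<exists>e. exp0 H = enat e \<and> e dvd N * p ^ M))"
proof -
  \<comment> \<open>The antipode is the one supplied by \<open>dual_chevalley\<close>, which is
    known to preserve the coradical.\<close>
  obtain S where S: "is_antipode H S" "S ` coradical H \<subseteq> coradical H"
    "subalgebra H (coradical H)" "subcoalgebra H (coradical H)"
    using assms(3) by (auto simp: dual_chevalley_def hopf_subalgebra_def)
  interpret finite_dim_hopf_pair H S "coradical H"
    using assms S by unfold_locales (auto simp: hopf_algebra_def)
  have "exp0 H = \<infinity>" if "\<not> cosemisimple H" "CHAR('k) = 0"
  proof (cases "exp0 H")
    case (enat n)
    note n = exp0_eq_enatD[OF enat]
    \<comment> \<open>The characteristic enters here: n T = 0 can be divided by the positive number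
      \<open>n\<close>.\<close>
    have "of_nat n \<noteq> (0 :: 'k)"
      using n(1) that(2) by (simp add: of_nat_eq_0_iff_char_dvd)
    then have "hspace H = coradical H"
      by (intro wedge_eq_imp_all rsimple_coradical wedge_eq[of n]) (auto simp: n(2))
    then show ?thesis using that(1) by (simp add: cosemisimple_def)
  qed simp
  then show ?thesis
    using exp0_dvd_coradical[OF assms(3)] by blast
qed

end
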